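(* The following are equivalent over $\mathbf{ECST}+\mathrm{FPA}$: (1) $\mathrm{NID}_{<\omega}$: for each set $S$ and each set $R$ of finitary rules on $S$, the class of $R$-closed subsets of $S$ is set-generated; (2) the category $\mathbf{CSpa}$ of concrete spaces and convergent relation pairs has equalisers.
   Context: Base theory. $\mathbf{ECST}$ (elementary constructive set theory) is the theory in intuitionistic first-order logic with equality and $\in$ whose axioms are Extensionality, Pairing, Union, Restricted Separation (separation for formulas all of whose quantifiers are bounded), Replacement (for arbitrary formulas, with $\exists!$ in the hypothesis), and Strong Infinity (existence of the least set $\omega$ containing $\emptyset$ and closed under $x\mapsto x\cup\{x\}$). There is no power set axiom; $\mathrm{Pow}(S)$ denotes the class of subsets of $S$. $\mathrm{FPA}$ (Finite Powers Axiom): for any set $S$ and $n\in\omega$, the class $S^n$ of functions $\{0,\dots,n-1\}\to S$ is a set. A set $A$ is finitely enumerable if there is a surjection $\{0,\dots,n-1\}\to A$ for some $n\in\omega$. Rules. A rule on a set $S$ is a pair $(a,b)$ of subsets of $S$; it is finitary if $a$ is finitely enumerable. A subset $\alpha\subseteq S$ is closed under $(a,b)$ if $a\subseteq\alpha$ implies that $b\cap\alpha$ is inhabited; it is $R$-closed if closed under every rule in the set $R$ of rules. Set-generation. A subclass $\mathcal{C}$ of $\mathrm{Pow}(S)$ is set-generated if there is a set $G\subseteq\mathcal{C}$ such that $\forall\alpha\in\mathcal{C}\,\forall x\in\alpha\,\exists\beta\in G\,(x\in\beta\subseteq\alpha)$. Concrete spaces. A basic pair is a triple $(X,\Vdash,S)$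 with $X,S$ sets and $\Vdash$ a relation from $X$ to $S$. A relation pair $(X_1,\Vdash_1,S_1)\to(X_2,\Vdash_2,S_2)$ is a pair $(r,s)$ of relations $r\subseteq X_1\times X_2$, $s\subseteq S_1\times S_2$ with ${\Vdash_2}\circ r=s\circ{\Vdash_1}$ (relational composition, right factor first). Two relation pairs $(r_1,s_1),(r_2,s_2)$ are regarded as equal iff ${\Vdash_2}\circ r_1={\Vdash_2}\circ r_2$. For a basic pair put $\mathrm{ext}\,a=\{x\in X\mid x\Vdash a\}$, $\mathrm{ext}\,U=\bigcup_{a\in U}\mathrm{ext}\,a$, $a\downarrow b=\{c\in S\mid\mathrm{ext}\,c\subseteq\mathrm{ext}\,a\cap\mathrm{ext}\,b\}$, $U\downarrow V=\bigcup_{a\in U,b\in V}a\downarrow b$. For a relation $r$, $r^{-}U=\{x\mid\exists y\in U\,(x\,r\,y)\}$ and $r^{-}a=r^{-}\{a\}$. A concrete space is a basic pair with $X=\mathrm{ext}\,S$ and $\mathrm{ext}\,a\cap\mathrm{ext}\,b=\mathrm{ext}(a\downarrow b)$ for all $a,b\in S$. A relation pair $(r,s)$ is convergent if $\mathrm{ext}_1S_1=r^{-}\mathrm{ext}_2S_2$ and $\mathrm{ext}_1(s^{-}a\downarrow s^{-}b)=r^{-}\mathrm{ext}_2(a\downarrow b)$ for all $a,b\in S_2$, where $\mathrm{ext}_i$ is associated with $\Vdash_i$. $\mathbf{CSpa}$ is the category of concrete spaces and convergent relation pairs, with componentwise composition, identities the pairs of diagonal relations, and the equality of relation pairs above. 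*)

theory Defs
  imports Main
begin

section \<open>Intuitionistic first-order logic with equality and membership\<close>

text \<open>Variables are de Bruijn indices. The language has no function symbols, so variables are
  the only terms and substitution is a renaming of free variables.\<close>

datatype fm =
    Falsum
  | Equal nat nat
  | Member nat nat
  | Conj fm fm
  | Disj fm fm
  | Impl fm fm
  | Forall fm
  | Exists fm

abbreviation Iff :: "fm \<Rightarrow> fm \<Rightarrow> fm" where
  "Iff \<phi> \<psi> \<equiv> Conj (Impl \<phi> \<psi>) (Impl \<psi> \<phi>)"

primrec rename :: "(nat \<Rightarrow> nat) \<Rightarrow> fm \<Rightarrow> fm" where
  "rename f Falsum = Falsum"
| "rename f (Equal x y) = Equal (f x) (f y)"
| "rename f (Member x y) = Member (f x) (f y)"
| "rename f (Conj \<phi> \<psi>) = Conj (rename f \<phi>) (rename f \<psi>)"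
| "rename f (Disj \<phi> \<psi>) = Disj (rename f \<phi>) (rename f \<psi>)"
| "rename f (Impl \<phi> \<psi>) = Impl (rename f \<phi>) (rename f \<psi>)"
| "rename f (Forall \<phi>) = Forall (rename (case_nat 0 (\<lambda>x. Suc (f x))) \<phi>)"
| "rename f (Exists \<phi>) = Exists (rename (case_nat 0 (\<lambda>x. Suc (f x))) \<phi>)"

abbreviation lift :: "fm \<Rightarrow> fm" where
  "lift \<equiv> rename Suc"

text \<open>The variable bound by the removed outermost quantifier is replaced by \<open>x\<close>.\<close>

abbreviation inst :: "fm \<Rightarrow> nat \<Rightarrow> fm" where
  "inst \<phi> x \<equiv> rename (case_nat x (\<lambda>y. y)) \<phi>"

primrec fv :: "fm \<Rightarrow> nat set" where
  "fv Falsum = {}"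
| "fv (Equal x y) = {x, y}"
| "fv (Member x y) = {x, y}"
| "fv (Conj \<phi> \<psi>) = fv \<phi> \<union> fv \<psi>"
| "fv (Disj \<phi> \<psi>) = fv \<phi> \<union> fv \<psi>"
| "fv (Impl \<phi> \<psi>) = fv \<phi> \<union> fv \<psi>"
| "fv (Forall \<phi>) = {x. Suc x \<in> fv \<phi>}"
| "fv (Exists \<phi>) = {x. Suc x \<in> fv \<phi>}"

inductive proves :: "fm set \<Rightarrow> fm \<Rightarrow> bool" (infix "\<turnstile>" 40) where
  assumption: "\<phi> \<in> \<Gamma> \<Longrightarrow> \<Gamma> \<turnstile> \<phi>"
| FalsumE: "\<Gamma> \<turnstile> Falsum \<Longrightarrow> \<Gamma> \<turnstile> \<phi>"
| ConjI: "\<Gamma> \<turnstile> \<phi> \<Longrightarrow> \<Gamma> \<turnstile> \<psi> \<Longrightarrow> \<Gamma> \<turnstile> Conj \<phi> \<psi>"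
| ConjE1: "\<Gamma> \<turnstile> Conj \<phi> \<psi> \<Longrightarrow> \<Gamma> \<turnstile> \<phi>"
| ConjE2: "\<Gamma> \<turnstile> Conj \<phi> \<psi> \<Longrightarrow> \<Gamma> \<turnstile> \<psi>"
| DisjI1: "\<Gamma> \<turnstile> \<phi> \<Longrightarrow> \<Gamma> \<turnstile> Disj \<phi> \<psi>"
| DisjI2: "\<Gamma> \<turnstile> \<psi> \<Longrightarrow> \<Gamma> \<turnstile> Disj \<phi> \<psi>"
| DisjE: "\<Gamma> \<turnstile> Disj \<phi> \<psi> \<Longrightarrow> insert \<phi> \<Gamma> \<turnstile> \<chi> \<Longrightarrow> insert \<psi> \<Gamma> \<turnstile> \<chi> \<Longrightarrow> \<Gamma> \<turnstile> \<chi>"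
| ImplI: "insert \<phi> \<Gamma> \<turnstile> \<psi> \<Longrightarrow> \<Gamma> \<turnstile> Impl \<phi> \<psi>"
| ImplE: "\<Gamma> \<turnstile> Impl \<phi> \<psi> \<Longrightarrow> \<Gamma> \<turnstile> \<phi> \<Longrightarrow> \<Gamma> \<turnstile> \<psi>"
| ForallI: "lift ` \<Gamma> \<turnstile> \<phi> \<Longrightarrow> \<Gamma> \<turnstile> Forall \<phi>"
| ForallE: "\<Gamma> \<turnstile> Forall \<phi> \<Longrightarrow> \<Gamma> \<turnstile> inst \<phi> x"
| ExistsI: "\<Gamma> \<turnstile> inst \<phi> x \<Longrightarrow> \<Gamma> \<turnstile> Exists \<phi>"
| ExistsE: "\<Gamma> \<turnstile> Exists \<phi> \<Longrightarrow> insert \<phi> (lift ` \<Gamma>) \<turnstile> lift \<psi> \<Longrightarrow> \<Gamma> \<turnstile> \<psi>"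
| EqualI: "\<Gamma> \<turnstile> Equal x x"
| EqualE: "\<Gamma> \<turnstile> Equal x y \<Longrightarrow> \<Gamma> \<turnstile> inst \<phi> x \<Longrightarrow> \<Gamma> \<turnstile> inst \<phi> y"

text \<open>Formulas all of whose quantifiers are bounded. In the quantifier clauses the bound \<open>y\<close> is
  a variable of the surrounding formula, hence shifted under the binder.\<close>

inductive restricted :: "fm \<Rightarrow> bool" where
  "restricted Falsum"
| "restricted (Equal x y)"
| "restricted (Member x y)"
| "restricted \<phi> \<Longrightarrow> restricted \<psi> \<Longrightarrow> restricted (Conj \<phi> \<psi>)"
| "restricted \<phi> \<Longrightarrow> restricted \<psi> \<Longrightarrow> restricted (Disj \<phi> \<psi>)"
| "restricted \<phi> \<Longrightarrow> restricted \<psi> \<Longrightarrow> restricted (Impl \<phi> \<psi>)"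
| "restricted \<phi> \<Longrightarrow> restricted (Forall (Impl (Member 0 (Suc y)) \<phi>))"
| "restricted \<phi> \<Longrightarrow> restricted (Exists (Conj (Member 0 (Suc y)) \<phi>))"


section \<open>Concrete syntax with named variables\<close>

text \<open>A value of type \<open>form\<close> yields a formula once the number \<open>d\<close> of enclosing quantifiers is
  known. Its variables are de Bruijn levels, numbered from the outermost quantifier: the binders
  pass on the level \<open>d\<close> of the variable they bind, and level \<open>x\<close> is index \<open>d - Suc x\<close> at depth
  \<open>d\<close>. A closed \<open>form\<close> denotes the sentence obtained at depth 0.\<close>

type_synonym var = nat
type_synonym form = "nat \<Rightarrow> fm"

abbreviation sentence :: "form \<Rightarrow> fm" where
  "sentence P \<equiv> P 0"

definition f_eq :: "var \<Rightarrow> var \<Rightarrow> form" (infix "\<^bold>=" 50) where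
  "(x \<^bold>= y) = (\<lambda>d. Equal (d - Suc x) (d - Suc y))"

definition f_mem :: "var \<Rightarrow> var \<Rightarrow> form" (infix "\<^bold>\<in>" 50) where
  "(x \<^bold>\<in> y) = (\<lambda>d. Member (d - Suc x) (d - Suc y))"

definition f_and :: "form \<Rightarrow> form \<Rightarrow> form" (infixr "\<^bold>\<and>" 35) where
  "(P \<^bold>\<and> Q) = (\<lambda>d. Conj (P d) (Q d))"

definition f_or :: "form \<Rightarrow> form \<Rightarrow> form" (infixr "\<^bold>\<or>" 30) where
  "(P \<^bold>\<or> Q) = (\<lambda>d. Disj (P d) (Q d))"

definition f_imp :: "form \<Rightarrow> form \<Rightarrow> form" (infixr "\<^bold>\<longrightarrow>" 25) where
  "(P \<^bold>\<longrightarrow> Q) = (\<lambda>d. Impl (P d) (Q d))"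

definition f_iff :: "form \<Rightarrow> form \<Rightarrow> form" (infixr "\<^bold>\<longleftrightarrow>" 25) where
  "(P \<^bold>\<longleftrightarrow> Q) = (\<lambda>d. Iff (P d) (Q d))"

definition f_not :: "form \<Rightarrow> form" ("\<^bold>\<not> _" [40] 40) where
  "(\<^bold>\<not> P) = (\<lambda>d. Impl (P d) Falsum)"

definition f_all :: "(var \<Rightarrow> form) \<Rightarrow> form" (binder "\<^bold>\<forall>" 10) where
  "f_all P = (\<lambda>d. Forall (P d (Suc d)))"

definition f_ex :: "(var \<Rightarrow> form) \<Rightarrow> form" (binder "\<^bold>\<exists>" 10) where
  "f_ex P = (\<lambda>d. Exists (P d (Suc d)))"

definition f_ex1 :: "(var \<Rightarrow> form) \<Rightarrow> form" (binder "\<^bold>\<exists>\<^bold>!" 10) where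
  "f_ex1 P = (\<^bold>\<exists>x. P x \<^bold>\<and> (\<^bold>\<forall>y. P y \<^bold>\<longrightarrow> y \<^bold>= x))"


section \<open>Set-theoretic vocabulary\<close>

definition subset :: "var \<Rightarrow> var \<Rightarrow> form" (infix "\<^bold>\<subseteq>" 50) where
  "(x \<^bold>\<subseteq> y) = (\<^bold>\<forall>z. z \<^bold>\<in> x \<^bold>\<longrightarrow> z \<^bold>\<in> y)"

definition is_empty :: "var \<Rightarrow> form" where
  "is_empty z = (\<^bold>\<forall>u. \<^bold>\<not> u \<^bold>\<in> z)"

definition is_succ :: "var \<Rightarrow> var \<Rightarrow> form" where
  "is_succ y x = (\<^bold>\<forall>u. u \<^bold>\<in> y \<^bold>\<longleftrightarrow> u \<^bold>\<in> x \<^bold>\<or> u \<^bold>= x)"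

definition is_inductive :: "var \<Rightarrow> form" where
  "is_inductive w =
    ((\<^bold>\<exists>z. z \<^bold>\<in> w \<^bold>\<and> is_empty z) \<^bold>\<and> (\<^bold>\<forall>x. x \<^bold>\<in> w \<^bold>\<longrightarrow> (\<^bold>\<exists>y. y \<^bold>\<in> w \<^bold>\<and> is_succ y x)))"

definition is_omega :: "var \<Rightarrow> form" where
  "is_omega w = (is_inductive w \<^bold>\<and> (\<^bold>\<forall>v. is_inductive v \<^bold>\<longrightarrow> w \<^bold>\<subseteq> v))"

text \<open>Elements of \<open>\<omega>\<close> are von Neumann numerals, so \<open>n\<close> itself is the set \<open>{0, \<dots>, n - 1}\<close>.\<close>

definition is_nat :: "var \<Rightarrow> form" where
  "is_nat n = (\<^bold>\<exists>w. is_omega w \<^bold>\<and> n \<^bold>\<in> w)"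

definition is_upair :: "var \<Rightarrow> var \<Rightarrow> var \<Rightarrow> form" where
  "is_upair z a b = (\<^bold>\<forall>u. u \<^bold>\<in> z \<^bold>\<longleftrightarrow> u \<^bold>= a \<^bold>\<or> u \<^bold>= b)"

text \<open>Kuratowski pairs: \<open>p = {{a}, {a, b}}\<close>.\<close>

definition is_pair :: "var \<Rightarrow> var \<Rightarrow> var \<Rightarrow> form" where
  "is_pair p a b = (\<^bold>\<forall>z. z \<^bold>\<in> p \<^bold>\<longleftrightarrow> is_upair z a a \<^bold>\<or> is_upair z a b)"

definition pair_in :: "var \<Rightarrow> var \<Rightarrow> var \<Rightarrow> form" where
  "pair_in a b r = (\<^bold>\<exists>p. is_pair p a b \<^bold>\<and> p \<^bold>\<in> r)"

definition is_relation :: "var \<Rightarrow> var \<Rightarrow> var \<Rightarrow> form" where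
  "is_relation r A B =
    (\<^bold>\<forall>p. p \<^bold>\<in> r \<^bold>\<longrightarrow> (\<^bold>\<exists>a b. a \<^bold>\<in> A \<^bold>\<and> b \<^bold>\<in> B \<^bold>\<and> is_pair p a b))"

definition is_function :: "var \<Rightarrow> var \<Rightarrow> var \<Rightarrow> form" where
  "is_function f A B =
    (is_relation f A B \<^bold>\<and> (\<^bold>\<forall>x. x \<^bold>\<in> A \<^bold>\<longrightarrow> (\<^bold>\<exists>\<^bold>!y. pair_in x y f)))"

definition is_surjection :: "var \<Rightarrow> var \<Rightarrow> var \<Rightarrow> form" where
  "is_surjection f A B =
    (is_function f A B \<^bold>\<and> (\<^bold>\<forall>y. y \<^bold>\<in> B \<^bold>\<longrightarrow> (\<^bold>\<exists>x. x \<^bold>\<in> A \<^bold>\<and> pair_in x y f)))"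

definition finitely_enumerable :: "var \<Rightarrow> form" where
  "finitely_enumerable A = (\<^bold>\<exists>n. is_nat n \<^bold>\<and> (\<^bold>\<exists>f. is_surjection f n A))"


section \<open>The theory ECST and the Finite Powers Axiom\<close>

definition extensionality :: fm where
  "extensionality = sentence (\<^bold>\<forall>x y. (\<^bold>\<forall>z. z \<^bold>\<in> x \<^bold>\<longleftrightarrow> z \<^bold>\<in> y) \<^bold>\<longrightarrow> x \<^bold>= y)"

definition pairing :: fm where
  "pairing = sentence (\<^bold>\<forall>a b. \<^bold>\<exists>z. is_upair z a b)"

definition union_axiom :: fm where
  "union_axiom = sentence (\<^bold>\<forall>a. \<^bold>\<exists>y. \<^bold>\<forall>x. x \<^bold>\<in> y \<^bold>\<longleftrightarrow> (\<^bold>\<exists>u. u \<^bold>\<in> a \<^bold>\<and> x \<^bold>\<in> u))"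

definition strong_infinity :: fm where
  "strong_infinity = sentence (\<^bold>\<exists>w. is_omega w)"

text \<open>In \<open>schema \<phi> xs\<close> the first \<open>length xs\<close> free variables of \<open>\<phi>\<close> become \<open>xs\<close>, and the
  following ones the parameters, i.e. the variables at levels \<open>0, 1, \<dots>\<close>. These are bound by
  \<open>universal_closure n\<close>, where \<open>n\<close> is the number of parameters.\<close>

definition schema :: "fm \<Rightarrow> var list \<Rightarrow> form" where
  "schema \<phi> xs =
    (\<lambda>d. rename (\<lambda>i. d - Suc (if i < length xs then xs ! i else i - length xs)) \<phi>)"

definition universal_closure :: "nat \<Rightarrow> form \<Rightarrow> fm" where
  "universal_closure n P = (Forall ^^ n) (P n)"

definition separation :: "nat \<Rightarrow> fm \<Rightarrow> fm" where
  "separation n \<phi> = universal_closure n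
    (\<^bold>\<forall>a. \<^bold>\<exists>b. \<^bold>\<forall>x. x \<^bold>\<in> b \<^bold>\<longleftrightarrow> x \<^bold>\<in> a \<^bold>\<and> schema \<phi> [x])"

definition replacement :: "nat \<Rightarrow> fm \<Rightarrow> fm" where
  "replacement n \<phi> = universal_closure n
    (\<^bold>\<forall>a. (\<^bold>\<forall>x. x \<^bold>\<in> a \<^bold>\<longrightarrow> (\<^bold>\<exists>\<^bold>!y. schema \<phi> [x, y])) \<^bold>\<longrightarrow>
      (\<^bold>\<exists>b. \<^bold>\<forall>y. y \<^bold>\<in> b \<^bold>\<longleftrightarrow> (\<^bold>\<exists>x. x \<^bold>\<in> a \<^bold>\<and> schema \<phi> [x, y])))"

definition ECST :: "fm set" where
  "ECST =
    {extensionality, pairing, union_axiom, strong_infinity} \<union>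
    {separation n \<phi> | n \<phi>. restricted \<phi> \<and> fv \<phi> \<subseteq> {..<n + 1}} \<union>
    {replacement n \<phi> | n \<phi>. fv \<phi> \<subseteq> {..<n + 2}}"

definition FPA :: fm where
  "FPA = sentence
    (\<^bold>\<forall>S n. is_nat n \<^bold>\<longrightarrow> (\<^bold>\<exists>F. \<^bold>\<forall>f. f \<^bold>\<in> F \<^bold>\<longleftrightarrow> is_function f n S))"


section \<open>Classes\<close>

text \<open>As usual, classes and class relations are given by formulas with parameters.\<close>

type_synonym cls = "var \<Rightarrow> form"
type_synonym rel = "var \<Rightarrow> var \<Rightarrow> form"

definition elems :: "var \<Rightarrow> cls" where
  "elems A = (\<lambda>x. x \<^bold>\<in> A)"

definition single :: "var \<Rightarrow> cls" where
  "single a = (\<lambda>x. x \<^bold>= a)"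

definition cls_int :: "cls \<Rightarrow> cls \<Rightarrow> cls" where
  "cls_int U V = (\<lambda>x. U x \<^bold>\<and> V x)"

definition cls_sub :: "cls \<Rightarrow> cls \<Rightarrow> form" where
  "cls_sub U V = (\<^bold>\<forall>x. U x \<^bold>\<longrightarrow> V x)"

definition cls_eq :: "cls \<Rightarrow> cls \<Rightarrow> form" where
  "cls_eq U V = (\<^bold>\<forall>x. U x \<^bold>\<longleftrightarrow> V x)"

definition graph :: "var \<Rightarrow> rel" where
  "graph r = (\<lambda>x y. pair_in x y r)"

definition rel_comp :: "rel \<Rightarrow> rel \<Rightarrow> rel" (infixr "\<^bold>\<circ>" 75) where
  "(q \<^bold>\<circ> r) = (\<lambda>x z. \<^bold>\<exists>y. r x y \<^bold>\<and> q y z)"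

definition rel_eq :: "rel \<Rightarrow> rel \<Rightarrow> form" where
  "rel_eq q r = (\<^bold>\<forall>x y. q x y \<^bold>\<longleftrightarrow> r x y)"

definition preimage :: "rel \<Rightarrow> cls \<Rightarrow> cls" where
  "preimage r U = (\<lambda>x. \<^bold>\<exists>y. U y \<^bold>\<and> r x y)"


section \<open>Set-generated classes and \<open>NID\<^sub><\<^sub>\<omega>\<close>\<close>

definition set_generated :: "cls \<Rightarrow> form" where
  "set_generated C = (\<^bold>\<exists>G. (\<^bold>\<forall>\<beta>. \<beta> \<^bold>\<in> G \<^bold>\<longrightarrow> C \<beta>) \<^bold>\<and>
    (\<^bold>\<forall>\<alpha>. C \<alpha> \<^bold>\<longrightarrow> (\<^bold>\<forall>x. x \<^bold>\<in> \<alpha> \<^bold>\<longrightarrow>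
      (\<^bold>\<exists>\<beta>. \<beta> \<^bold>\<in> G \<^bold>\<and> x \<^bold>\<in> \<beta> \<^bold>\<and> \<beta> \<^bold>\<subseteq> \<alpha>))))"

definition set_of_finitary_rules :: "var \<Rightarrow> var \<Rightarrow> form" where
  "set_of_finitary_rules R S = (\<^bold>\<forall>p. p \<^bold>\<in> R \<^bold>\<longrightarrow>
    (\<^bold>\<exists>a b. is_pair p a b \<^bold>\<and> a \<^bold>\<subseteq> S \<^bold>\<and> b \<^bold>\<subseteq> S \<^bold>\<and> finitely_enumerable a))"

definition closed_under :: "var \<Rightarrow> var \<Rightarrow> var \<Rightarrow> form" where
  "closed_under \<alpha> a b = (a \<^bold>\<subseteq> \<alpha> \<^bold>\<longrightarrow> (\<^bold>\<exists>x. x \<^bold>\<in> b \<^bold>\<and> x \<^bold>\<in> \<alpha>))"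

definition closed_subsets :: "var \<Rightarrow> var \<Rightarrow> cls" where
  "closed_subsets S R =
    (\<lambda>\<alpha>. \<alpha> \<^bold>\<subseteq> S \<^bold>\<and> (\<^bold>\<forall>a b. pair_in a b R \<^bold>\<longrightarrow> closed_under \<alpha> a b))"

definition NID_fin :: fm where
  "NID_fin = sentence
    (\<^bold>\<forall>S R. set_of_finitary_rules R S \<^bold>\<longrightarrow> set_generated (closed_subsets S R))"


section \<open>Concrete spaces\<close>

text \<open>A triple \<open>(X, V, S)\<close> of variables stands for the basic pair with forcing relation \<open>V\<close>, a
  pair \<open>(r, s)\<close> for a relation pair.\<close>

type_synonym bpair = "var \<times> var \<times> var"
type_synonym rpair = "var \<times> var"

fun basic_pair :: "bpair \<Rightarrow> form" where
  "basic_pair (X, V, S) = is_relation V X S"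

fun forces :: "bpair \<Rightarrow> rel" where
  "forces (X, V, S) = graph V"

fun ext1 :: "bpair \<Rightarrow> var \<Rightarrow> cls" where
  "ext1 (X, V, S) a = (\<lambda>x. x \<^bold>\<in> X \<^bold>\<and> pair_in x a V)"

definition ext :: "bpair \<Rightarrow> cls \<Rightarrow> cls" where
  "ext A U = (\<lambda>x. \<^bold>\<exists>a. U a \<^bold>\<and> ext1 A a x)"

fun down1 :: "bpair \<Rightarrow> var \<Rightarrow> var \<Rightarrow> cls" where
  "down1 (X, V, S) a b = (\<lambda>c. c \<^bold>\<in> S \<^bold>\<and>
    cls_sub (ext1 (X, V, S) c) (cls_int (ext1 (X, V, S) a) (ext1 (X, V, S) b)))"

definition down :: "bpair \<Rightarrow> cls \<Rightarrow> cls \<Rightarrow> cls" where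
  "down A U W = (\<lambda>c. \<^bold>\<exists>a b. U a \<^bold>\<and> W b \<^bold>\<and> down1 A a b c)"

fun concrete_space :: "bpair \<Rightarrow> form" where
  "concrete_space (X, V, S) =
    (basic_pair (X, V, S) \<^bold>\<and>
     cls_eq (elems X) (ext (X, V, S) (elems S)) \<^bold>\<and>
     (\<^bold>\<forall>a b. a \<^bold>\<in> S \<^bold>\<and> b \<^bold>\<in> S \<^bold>\<longrightarrow>
       cls_eq (cls_int (ext1 (X, V, S) a) (ext1 (X, V, S) b))
              (ext (X, V, S) (down1 (X, V, S) a b))))"

fun relation_pair :: "bpair \<Rightarrow> bpair \<Rightarrow> rpair \<Rightarrow> form" where
  "relation_pair (X1, V1, S1) (X2, V2, S2) (r, s) =
    (is_relation r X1 X2 \<^bold>\<and> is_relation s S1 S2 \<^bold>\<and>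
     rel_eq (graph V2 \<^bold>\<circ> graph r) (graph s \<^bold>\<circ> graph V1))"

fun convergent :: "bpair \<Rightarrow> bpair \<Rightarrow> rpair \<Rightarrow> form" where
  "convergent (X1, V1, S1) (X2, V2, S2) (r, s) =
    (let A1 = (X1, V1, S1); A2 = (X2, V2, S2) in
     cls_eq (ext A1 (elems S1)) (preimage (graph r) (ext A2 (elems S2))) \<^bold>\<and>
     (\<^bold>\<forall>a b. a \<^bold>\<in> S2 \<^bold>\<and> b \<^bold>\<in> S2 \<^bold>\<longrightarrow>
       cls_eq
         (ext A1 (down A1 (preimage (graph s) (single a)) (preimage (graph s) (single b))))
         (preimage (graph r) (ext A2 (down1 A2 a b)))))"

definition CSpa_arrow :: "bpair \<Rightarrow> bpair \<Rightarrow> rpair \<Rightarrow> form" where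
  "CSpa_arrow A B f = (relation_pair A B f \<^bold>\<and> convergent A B f)"

text \<open>Composites are formed as pairs of class relations, with \<open>arrow (r, s)\<close> the pair given by
  the sets \<open>r\<close> and \<open>s\<close>. Equality of arrows with codomain \<open>B\<close> only looks at the composite with
  the forcing relation of \<open>B\<close>.\<close>

fun arrow :: "rpair \<Rightarrow> rel \<times> rel" where
  "arrow (r, s) = (graph r, graph s)"

fun arrow_comp :: "rel \<times> rel \<Rightarrow> rel \<times> rel \<Rightarrow> rel \<times> rel" (infixr "\<^bold>\<odot>" 75) where
  "(r2, s2) \<^bold>\<odot> (r1, s1) = (r2 \<^bold>\<circ> r1, s2 \<^bold>\<circ> s1)"

fun arrow_eq :: "bpair \<Rightarrow> rel \<times> rel \<Rightarrow> rel \<times> rel \<Rightarrow> form" where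
  "arrow_eq B (r1, s1) (r2, s2) = rel_eq (forces B \<^bold>\<circ> r1) (forces B \<^bold>\<circ> r2)"

definition equalises :: "bpair \<Rightarrow> rpair \<Rightarrow> rpair \<Rightarrow> rpair \<Rightarrow> form" where
  "equalises B f g e = arrow_eq B (arrow f \<^bold>\<odot> arrow e) (arrow g \<^bold>\<odot> arrow e)"

definition is_equaliser :: "bpair \<Rightarrow> bpair \<Rightarrow> rpair \<Rightarrow> rpair \<Rightarrow> bpair \<Rightarrow> rpair \<Rightarrow> form" where
  "is_equaliser A B f g E e =
    (concrete_space E \<^bold>\<and> CSpa_arrow E A e \<^bold>\<and> equalises B f g e \<^bold>\<and>
     (\<^bold>\<forall>X V S. concrete_space (X, V, S) \<^bold>\<longrightarrow>
       (\<^bold>\<forall>r s. CSpa_arrow (X, V, S) A (r, s) \<^bold>\<and> equalises B f g (r, s) \<^bold>\<longrightarrow>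
         (\<^bold>\<exists>p q. CSpa_arrow (X, V, S) E (p, q) \<^bold>\<and>
            arrow_eq A (arrow e \<^bold>\<odot> arrow (p, q)) (arrow (r, s)) \<^bold>\<and>
            (\<^bold>\<forall>p' q'. CSpa_arrow (X, V, S) E (p', q') \<^bold>\<and>
               arrow_eq A (arrow e \<^bold>\<odot> arrow (p', q')) (arrow (r, s)) \<^bold>\<longrightarrow>
               arrow_eq E (arrow (p', q')) (arrow (p, q)))))))"

definition CSpa_has_equalisers :: fm where
  "CSpa_has_equalisers = sentence
    (\<^bold>\<forall>X1 V1 S1 X2 V2 S2.
       concrete_space (X1, V1, S1) \<^bold>\<and> concrete_space (X2, V2, S2) \<^bold>\<longrightarrow>
       (\<^bold>\<forall>r s r' s'.
          CSpa_arrow (X1, V1, S1) (X2, V2, S2) (r, s) \<^bold>\<and>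
          CSpa_arrow (X1, V1, S1) (X2, V2, S2) (r', s') \<^bold>\<longrightarrow>
          (\<^bold>\<exists>X V S p q.
             is_equaliser (X1, V1, S1) (X2, V2, S2) (r, s) (r', s') (X, V, S) (p, q))))"

end

theory Submission
  imports Defs "HOL-Library.Countable" "HOL-Library.Infinite_Set"
begin

text \<open>Intuitionistic derivability from a set of sentences is complete for Kripke models, so it suffices
  to argue inside an arbitrary world of the model whose worlds are the saturated theories extending
  \<open>ECST + FPA\<close>.

  From \<open>NID\<^sub><\<^sub>\<omega>\<close> to equalisers: up to equality, an arrow \<open>(r, s)\<close> from a concrete space to \<open>(X1, V1, S1)\<close>
  sends every point to an ideal point, given by the subset of those points of \<open>X1\<close> all of whose
  neighbourhoods it contains. Being an ideal point equalised by two given arrows is closure of such a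
  subset under a set of rules with at most two premises. A generating set of closed subsets carries the
  equaliser.

  From equalisers to \<open>NID\<^sub><\<^sub>\<omega>\<close>: by \<open>FPA\<close> the finitely enumerable subsets of \<open>S\<close> form a set, hence a concrete
  space whose ideal points are the subsets of \<open>S\<close>; likewise for the set \<open>R\<close> of rules. A subset \<open>\<alpha>\<close> is
  \<open>R\<close>-closed iff the maps \<open>\<alpha> \<mapsto> {(a, b) \<in> R. a \<subseteq> \<alpha>}\<close> and \<open>\<alpha> \<mapsto> {(a, b) \<in> R. a \<subseteq> \<alpha> and b meets \<alpha>}\<close>
  agree at \<open>\<alpha>\<close>. The points of the equaliser of these two arrows yield a generating set, since a closed \<open>\<alpha>\<close>
  is an equalising map from the one-point space.\<close>

section \<open>Derivations and saturated theories\<close>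

text \<open>The obstacle is the absence of power sets: ideal points are subsets, and the equalised
  ones form only a class. Set-generation is what replaces this class by a set of points. There is no
  choice either. Gathering finitely many witnesses, such as one conclusion for each rule in a finite
  set of rules, is done by induction on \<open>omega\<close> inside a directed set of candidates, in
  \<open>finen_directed\<close>. As Separation is restricted, every predicate in such an argument
  needs a bounded formula; \<open>definable\<close> records one, and it also yields persistence
  along worlds and invariance under equality once and for all. Equality of arrows sees an arrow only
  through its composite with the forcing relation of the codomain. Most arguments about arrows are
  therefore about this composite, \<open>rcomp\<close>. Worlds may be inconsistent, so an empty set
  can acquire elements at an absurd world. Impossible cases then end at an absurd world, where
  everything holds, instead of at a contradiction in HOL.\<close>

lemma rename_cong: "(\<And>x. x \<in> fv \<phi> \<Longrightarrow> f x = g x) \<Longrightarrow> rename f \<phi> = rename g \<phi>"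
proof -
  have "\<forall>x\<in>fv \<phi>. f x = g x \<Longrightarrow> rename f \<phi> = rename g \<phi>"
  proof (induction \<phi> arbitrary: f g)
    case (Forall \<phi>)
    show ?case by (simp, rule Forall.IH) (use Forall.prems in \<open>auto split: nat.split\<close>)
  next
    case (Exists \<phi>)
    show ?case by (simp, rule Exists.IH) (use Exists.prems in \<open>auto split: nat.split\<close>)
  qed auto
  then show "(\<And>x. x \<in> fv \<phi> \<Longrightarrow> f x = g x) \<Longrightarrow> ?thesis" by blast
qed

lemma rename_ident: "rename (\<lambda>x. x) \<phi> = \<phi>"
proof (induction \<phi>)
  case (Forall \<phi>)
  have "case_nat 0 Suc = (\<lambda>x. x)" by (auto simp: fun_eq_iff split: nat.split)
  with Forall show ?case by simp
next
  case (Exists \<phi>)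
  have "case_nat 0 Suc = (\<lambda>x. x)" by (auto simp: fun_eq_iff split: nat.split)
  with Exists show ?case by simp
qed simp_all

lemma rename_id: "(\<And>x. x \<in> fv \<phi> \<Longrightarrow> f x = x) \<Longrightarrow> rename f \<phi> = \<phi>"
  using rename_cong[of \<phi> f "\<lambda>x. x"] by (simp add: rename_ident)

lemma case_nat_comp:
  "case_nat 0 (\<lambda>x. Suc (f x)) \<circ> case_nat 0 (\<lambda>x. Suc (g x)) = case_nat 0 (\<lambda>x. Suc ((f \<circ> g) x))"
  by (auto simp: fun_eq_iff split: nat.split)

lemma rename_rename: "rename f (rename g \<phi>) = rename (f \<circ> g) \<phi>"
  by (induction \<phi> arbitrary: f g) (simp_all add: case_nat_comp)

lemma fv_rename: "fv (rename f \<phi>) = f ` fv \<phi>"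
proof (induction \<phi> arbitrary: f)
  case (Forall \<phi>)
  show ?case by (simp add: Forall.IH) (force split: nat.splits)
next
  case (Exists \<phi>)
  show ?case by (simp add: Exists.IH) (force split: nat.splits)
qed auto

lemma finite_fv: "finite (fv \<phi>)"
proof (induction \<phi>)
  case (Forall \<phi>)
  have "fv (Forall \<phi>) = Suc -` fv \<phi>" by auto
  with Forall show ?case by (simp add: finite_vimageI)
next
  case (Exists \<phi>)
  have "fv (Exists \<phi>) = Suc -` fv \<phi>" by auto
  with Exists show ?case by (simp add: finite_vimageI)
qed auto

lemma lift_rename: "rename (case_nat 0 (\<lambda>x. Suc (f x))) (lift \<phi>) = lift (rename f \<phi>)"
  by (simp add: rename_rename comp_def)

lemma rename_inst:
  "rename f (inst \<phi> x) = inst (rename (case_nat 0 (\<lambda>x. Suc (f x))) \<phi>) (f x)"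
  unfolding rename_rename by (rule arg_cong[of _ _ "\<lambda>g. rename g \<phi>"]) (auto simp: fun_eq_iff split: nat.split)

lemma proves_weaken: "\<Gamma> \<turnstile> \<phi> \<Longrightarrow> \<Gamma> \<subseteq> \<Delta> \<Longrightarrow> \<Delta> \<turnstile> \<phi>"
proof (induction arbitrary: \<Delta> rule: proves.induct)
  case (DisjE \<Gamma> \<phi> \<psi> \<chi>)
  then show ?case by (meson insert_mono proves.DisjE)
next
  case (ImplI \<phi> \<Gamma> \<psi>)
  then show ?case by (meson insert_mono proves.ImplI)
next
  case (ForallI \<Gamma> \<phi>)
  then show ?case by (meson image_mono proves.ForallI)
next
  case (ExistsE \<Gamma> \<phi> \<psi>)
  then show ?case by (meson image_mono insert_mono proves.ExistsE)
qed (blast intro: proves.intros)+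

text \<open>All terms are variables, so substitution in a derivation is a renaming, which need not
  be injective. Moving a fresh variable to index 0 in this way gives the eigenvariable rules
  below.\<close>

lemma proves_rename: "\<Gamma> \<turnstile> \<phi> \<Longrightarrow> rename f ` \<Gamma> \<turnstile> rename f \<phi>"
proof (induction arbitrary: f rule: proves.induct)
  case (ForallI \<Gamma> \<phi>)
  from ForallI.IH[of "case_nat 0 (\<lambda>x. Suc (f x))"] show ?case
    by (auto intro!: proves.ForallI simp: image_image lift_rename)
next
  case (ForallE \<Gamma> \<phi> x)
  then show ?case using proves.ForallE[of "rename f ` \<Gamma>"] by (simp add: rename_inst)
next
  case (ExistsI \<Gamma> \<phi> x)
  then show ?case by (auto simp: rename_inst intro: proves.ExistsI)
next
  case (ExistsE \<Gamma> \<phi> \<psi>)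
  show ?case
  proof (rule proves.ExistsE)
    show "rename f ` \<Gamma> \<turnstile> Exists (rename (case_nat 0 (\<lambda>x. Suc (f x))) \<phi>)"
      using ExistsE.IH(1)[of f] by simp
    show "insert (rename (case_nat 0 (\<lambda>x. Suc (f x))) \<phi>) (lift ` rename f ` \<Gamma>) \<turnstile> lift (rename f \<psi>)"
      using ExistsE.IH(2)[of "case_nat 0 (\<lambda>x. Suc (f x))"] by (simp add: image_image lift_rename)
  qed
next
  case (EqualE \<Gamma> x y \<phi>)
  then show ?case using proves.EqualE[of "rename f ` \<Gamma>" "f x" "f y"] by (simp add: rename_inst)
next
  case (DisjE \<Gamma> \<phi> \<psi> \<chi>)
  then show ?case
    using proves.DisjE[of "rename f ` \<Gamma>" "rename f \<phi>" "rename f \<psi>" "rename f \<chi>"] by simp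
qed (auto intro: proves.intros)

text \<open>A derivation uses finitely many assumptions. This keeps the union of a chain of theories
  from deriving a formula that no member of the chain derives.\<close>

lemma proves_finite: "\<Gamma> \<turnstile> \<phi> \<Longrightarrow> \<exists>\<Delta>\<subseteq>\<Gamma>. finite \<Delta> \<and> \<Delta> \<turnstile> \<phi>"
proof (induction rule: proves.induct)
  case (assumption \<phi> \<Gamma>)
  then show ?case by (intro exI[of _ "{\<phi>}"]) (auto intro: proves.assumption)
next
  case (ConjI \<Gamma> \<phi> \<psi>)
  from ConjI.IH obtain A B where *: "A \<subseteq> \<Gamma>" "finite A" "A \<turnstile> \<phi>" "B \<subseteq> \<Gamma>" "finite B" "B \<turnstile> \<psi>"
    by (elim exE conjE)
  have "A \<union> B \<turnstile> \<phi>" "A \<union> B \<turnstile> \<psi>"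
    using proves_weaken[OF *(3)] proves_weaken[OF *(6)] by simp_all
  then have "A \<union> B \<turnstile> Conj \<phi> \<psi>" by (rule proves.ConjI)
  with * show ?case by (intro exI[of _ "A \<union> B"]) simp
next
  case (DisjE \<Gamma> \<phi> \<psi> \<chi>)
  from DisjE.IH obtain A B C where *: "A \<subseteq> \<Gamma>" "finite A" "A \<turnstile> Disj \<phi> \<psi>"
    "B \<subseteq> insert \<phi> \<Gamma>" "finite B" "B \<turnstile> \<chi>" "C \<subseteq> insert \<psi> \<Gamma>" "finite C" "C \<turnstile> \<chi>"
    by (elim exE conjE)
  let ?D = "A \<union> (B - {\<phi>}) \<union> (C - {\<psi>})"
  have "?D \<turnstile> \<chi>"
    by (rule proves.DisjE[OF proves_weaken[OF *(3)] proves_weaken[OF *(6)] proves_weaken[OF *(9)]]) auto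
  with * show ?case by (intro exI[of _ ?D]) auto
next
  case (ImplI \<phi> \<Gamma> \<psi>)
  from ImplI.IH obtain B where *: "B \<subseteq> insert \<phi> \<Gamma>" "finite B" "B \<turnstile> \<psi>"
    by (elim exE conjE)
  have "B - {\<phi>} \<turnstile> Impl \<phi> \<psi>" by (rule proves.ImplI[OF proves_weaken[OF *(3)]]) auto
  with * show ?case by (intro exI[of _ "B - {\<phi>}"]) auto
next
  case (ImplE \<Gamma> \<phi> \<psi>)
  from ImplE.IH obtain A B where *: "A \<subseteq> \<Gamma>" "finite A" "A \<turnstile> Impl \<phi> \<psi>" "B \<subseteq> \<Gamma>" "finite B" "B \<turnstile> \<phi>"
    by (elim exE conjE)
  have "A \<union> B \<turnstile> \<psi>"
    by (rule proves.ImplE[OF proves_weaken[OF *(3)] proves_weaken[OF *(6)]]) auto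
  with * show ?case by (intro exI[of _ "A \<union> B"]) simp
next
  case (ForallI \<Gamma> \<phi>)
  from ForallI.IH obtain A where "A \<subseteq> lift ` \<Gamma>" "finite A" "A \<turnstile> \<phi>" by (elim exE conjE)
  then obtain B where "B \<subseteq> \<Gamma>" "finite B" "lift ` B \<turnstile> \<phi>" by (metis finite_subset_image)
  then show ?case using proves.ForallI by (intro exI[of _ B]) simp
next
  case (ExistsE \<Gamma> \<phi> \<psi>)
  from ExistsE.IH obtain A B where A: "A \<subseteq> \<Gamma>" "finite A" "A \<turnstile> Exists \<phi>"
    and B: "B \<subseteq> insert \<phi> (lift ` \<Gamma>)" "finite B" "B \<turnstile> lift \<psi>" by (elim exE conjE)
  from B have "B - {\<phi>} \<subseteq> lift ` \<Gamma>" "finite (B - {\<phi>})" by auto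
  then obtain C where C: "C \<subseteq> \<Gamma>" "finite C" "B - {\<phi>} = lift ` C" by (metis finite_subset_image)
  have "A \<union> C \<turnstile> \<psi>"
    by (rule proves.ExistsE[OF proves_weaken[OF A(3)] proves_weaken[OF B(3)]]) (use C(3) in auto)
  with A C show ?case by (intro exI[of _ "A \<union> C"]) simp
next
  case (EqualI \<Gamma> x)
  then show ?case by (auto intro: proves.EqualI)
next
  case (EqualE \<Gamma> x y \<phi>)
  from EqualE.IH obtain A B
    where *: "A \<subseteq> \<Gamma>" "finite A" "A \<turnstile> Equal x y" "B \<subseteq> \<Gamma>" "finite B" "B \<turnstile> inst \<phi> x"
    by (elim exE conjE)
  have "A \<union> B \<turnstile> inst \<phi> y"
    by (rule proves.EqualE[OF proves_weaken[OF *(3)] proves_weaken[OF *(6)]]) auto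
  with * show ?case by (intro exI[of _ "A \<union> B"]) simp
qed (elim exE conjE, intro exI conjI, assumption, assumption,
    (erule proves.FalsumE | erule proves.ConjE1 | erule proves.ConjE2 | erule proves.DisjI1
      | erule proves.DisjI2 | erule proves.ForallE | erule proves.ExistsI))+

lemma proves_cut: "\<Gamma> \<turnstile> \<phi> \<Longrightarrow> insert \<phi> \<Gamma> \<turnstile> \<psi> \<Longrightarrow> \<Gamma> \<turnstile> \<psi>"
  by (blast intro: proves.ImplI proves.ImplE)

text \<open>For fresh \<open>x\<close>, sending \<open>x\<close> to 0 and shifting all other
  variables undoes the instantiation with \<open>x\<close>. It turns a derivation with the named
  eigenvariable \<open>x\<close> into a premise of the de Bruijn rules.\<close>

lemma rename_inst_fresh:
  assumes "x \<notin> fv (Forall \<phi>)"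
  shows "rename (\<lambda>y. if y = x then 0 else Suc y) (inst \<phi> x) = \<phi>"
  unfolding rename_rename using assms
  by (intro rename_id) (auto split: nat.split)

lemma rename_fresh: "x \<notin> fv \<phi> \<Longrightarrow> rename (\<lambda>y. if y = x then 0 else Suc y) \<phi> = lift \<phi>"
  by (intro rename_cong) auto

lemma ForallI_fresh:
  assumes "\<Gamma> \<turnstile> inst \<phi> x" "x \<notin> fv (Forall \<phi>)" "\<And>\<gamma>. \<gamma> \<in> \<Gamma> \<Longrightarrow> x \<notin> fv \<gamma>"
  shows "\<Gamma> \<turnstile> Forall \<phi>"
proof -
  let ?f = "\<lambda>y. if y = x then 0 else Suc y"
  have "rename ?f ` \<Gamma> = lift ` \<Gamma>" using assms(3) by (auto simp: rename_fresh)
  with proves_rename[OF assms(1), of ?f] rename_inst_fresh[OF assms(2)]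
  show ?thesis by (simp add: proves.ForallI)
qed

lemma ExistsE_fresh:
  assumes "\<Gamma> \<turnstile> Exists \<phi>" "insert (inst \<phi> x) \<Gamma> \<turnstile> \<psi>" "x \<notin> fv (Exists \<phi>)" "x \<notin> fv \<psi>"
    "\<And>\<gamma>. \<gamma> \<in> \<Gamma> \<Longrightarrow> x \<notin> fv \<gamma>"
  shows "\<Gamma> \<turnstile> \<psi>"
proof -
  let ?f = "\<lambda>y. if y = x then 0 else Suc y"
  have "rename ?f ` \<Gamma> = lift ` \<Gamma>" using assms(5) by (auto simp: rename_fresh)
  moreover have "rename ?f (inst \<phi> x) = \<phi>" using assms(3) by (intro rename_inst_fresh) simp
  ultimately show ?thesis
    using proves_rename[OF assms(2), of ?f] assms(1,4) by (simp add: rename_fresh proves.ExistsE)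
qed

section \<open>Extension of theories to saturated ones\<close>

instance fm :: countable by countable_datatype

text \<open>Prime theories with witnesses, over the variables \<open>V\<close> that act as
  constants. Infinitely many variables stay outside \<open>V\<close>, so that later worlds can add
  objects. Consistency is not demanded.\<close>

definition saturated :: "nat set \<Rightarrow> fm set \<Rightarrow> bool" where
  "saturated V w \<longleftrightarrow> infinite (- V) \<and> (\<forall>\<phi>\<in>w. fv \<phi> \<subseteq> V) \<and>
    (\<forall>\<phi>. fv \<phi> \<subseteq> V \<longrightarrow> w \<turnstile> \<phi> \<longrightarrow> \<phi> \<in> w) \<and>
    (\<forall>\<phi> \<psi>. Disj \<phi> \<psi> \<in> w \<longrightarrow> \<phi> \<in> w \<or> \<psi> \<in> w) \<and>
    (\<forall>\<phi>. Exists \<phi> \<in> w \<longrightarrow> (\<exists>x\<in>V. inst \<phi> x \<in> w))"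

text \<open>Every second element in the increasing enumeration. It splits the remaining variables
  into witnesses for one extension and a reserve for all later ones.\<close>

lemma infinite_coinfinite_subset:
  fixes A :: "nat set"
  assumes "infinite A"
  obtains C where "C \<subseteq> A" "infinite C" "infinite (A - C)"
proof
  let ?e = "enumerate A"
  have inj: "inj ?e" using assms by (simp add: strict_mono_enumerate strict_mono_imp_inj_on)
  show "range (\<lambda>n. ?e (2 * n)) \<subseteq> A" using assms by (auto simp: enumerate_in_set)
  show "infinite (range (\<lambda>n. ?e (2 * n)))"
    by (intro range_inj_infinite injI) (simp add: inj_eq[OF inj])
  have "range (\<lambda>n. ?e (2 * n + 1)) \<subseteq> A - range (\<lambda>n. ?e (2 * n))"
    using assms by (auto simp: enumerate_in_set inj_eq[OF inj]) presburger
  moreover have "infinite (range (\<lambda>n. ?e (2 * n + 1)))"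
    by (intro range_inj_infinite injI) (simp add: inj_eq[OF inj])
  ultimately show "infinite (A - range (\<lambda>n. ?e (2 * n)))" using infinite_super by blast
qed

text \<open>Henkin construction: all formulas are run through, each is added unless
  \<open>\<psi>\<close> would become derivable, and an added existential formula receives a witness
  at once. In the limit \<open>\<psi>\<close> is still underivable, and maximality with this
  property makes the theory prime.\<close>

lemma saturated_extension:
  assumes "\<not> \<Gamma> \<turnstile> \<psi>" "infinite (- V0)" "\<And>\<gamma>. \<gamma> \<in> \<Gamma> \<Longrightarrow> fv \<gamma> \<subseteq> V0" "fv \<psi> \<subseteq> V0"
  obtains V w where "saturated V w" "\<Gamma> \<subseteq> w" "V0 \<subseteq> V" "\<psi> \<notin> w"
proof -
  from infinite_coinfinite_subset[OF assms(2)] obtain C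
    where C: "C \<subseteq> - V0" "infinite C" "infinite (- V0 - C)" .
  define V where "V = V0 \<union> C"
  \<comment> \<open>Each stage mentions only finitely many variables of \<open>C\<close>, so a fresh
    witness from \<open>C\<close> is always available.\<close>
  define inv where "inv \<Delta> \<longleftrightarrow> \<Gamma> \<subseteq> \<Delta> \<and> \<not> \<Delta> \<turnstile> \<psi> \<and> (\<forall>\<gamma>\<in>\<Delta>. fv \<gamma> \<subseteq> V) \<and> finite (C \<inter> \<Union> (fv ` \<Delta>))" for \<Delta>
  define handled where "handled \<Delta> \<Delta>' \<phi> \<longleftrightarrow> (fv \<phi> \<subseteq> V \<longrightarrow> \<phi> \<in> \<Delta>' \<or> insert \<phi> \<Delta> \<turnstile> \<psi>) \<and>
     (\<forall>\<chi>. \<phi> = Exists \<chi> \<longrightarrow> \<phi> \<in> \<Delta>' \<longrightarrow> insert \<phi> \<Delta> \<turnstile> \<psi> \<or> (\<exists>x\<in>V. inst \<chi> x \<in> \<Delta>'))" for \<Delta> \<Delta>' \<phi>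
  have step: "\<exists>\<Delta>'. inv \<Delta>' \<and> \<Delta> \<subseteq> \<Delta>' \<and> handled \<Delta> \<Delta>' \<phi>" if "inv \<Delta>" for \<Delta> \<phi>
  proof (cases "fv \<phi> \<subseteq> V \<and> \<not> insert \<phi> \<Delta> \<turnstile> \<psi>")
    case False
    then have "handled \<Delta> \<Delta> \<phi>"
      using that unfolding handled_def inv_def handled_def by blast
    with that show ?thesis by blast
  next
    case True
    let ?B = "C \<inter> \<Union> (fv ` insert \<phi> \<Delta>)"
    have fin: "finite ?B"
      using that finite_fv[of \<phi>] by (auto simp: inv_def Int_Un_distrib)
    show ?thesis
    proof (cases "\<exists>\<chi>. \<phi> = Exists \<chi>")
      case False
      with True that fin have "inv (insert \<phi> \<Delta>)" "handled \<Delta> (insert \<phi> \<Delta>) \<phi>"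
        unfolding inv_def handled_def by auto
      then show ?thesis by blast
    next
      case ex: True
      then obtain \<chi> where \<chi>: "\<phi> = Exists \<chi>" by blast
      from fin C(2) have "infinite (C - ?B)" by simp
      then have "C - ?B \<noteq> {}" by (rule infinite_imp_nonempty)
      then obtain c where c: "c \<in> C" "c \<notin> ?B" by blast
      let ?D = "insert (inst \<chi> c) (insert \<phi> \<Delta>)"
      have fvi: "fv (inst \<chi> c) \<subseteq> insert c (fv \<phi>)"
        unfolding \<chi> fv_rename by (auto split: nat.splits)
      have "\<not> ?D \<turnstile> \<psi>"
      proof
        assume *: "?D \<turnstile> \<psi>"
        have ex: "insert \<phi> \<Delta> \<turnstile> Exists \<chi>" by (simp add: \<chi> proves.assumption)
        have "c \<notin> fv (Exists \<chi>)" "c \<notin> fv \<psi>" "\<And>\<gamma>. \<gamma> \<in> insert \<phi> \<Delta> \<Longrightarrow> c \<notin> fv \<gamma>"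
          using c C assms(4) by (auto simp: \<chi>)
        from ExistsE_fresh[OF ex * this] have "insert \<phi> \<Delta> \<turnstile> \<psi>" .
        with True show False by blast
      qed
      moreover have "finite (C \<inter> \<Union> (fv ` ?D))"
        by (rule finite_subset[of _ "insert c ?B"]) (use fvi fin in auto)
      moreover have "\<forall>\<gamma>\<in>?D. fv \<gamma> \<subseteq> V"
        using fvi True c that by (auto simp: inv_def V_def)
      ultimately have "inv ?D" using that by (auto simp: inv_def)
      moreover have "handled \<Delta> ?D \<phi>"
        using c by (auto simp: handled_def \<chi> V_def)
      ultimately show ?thesis by blast
    qed
  qed
  have "C \<inter> \<Union> (fv ` \<Gamma>) = {}" using assms(3) C(1) by blast
  then have "inv \<Gamma>" using assms by (auto simp: inv_def V_def)
  have "\<exists>G. \<forall>n. inv (G n) \<and> (G n \<subseteq> G (Suc n) \<and> handled (G n) (G (Suc n)) (from_nat n))"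
  proof (rule dependent_nat_choice)
    show "\<exists>\<Delta>. inv \<Delta>" using \<open>inv \<Gamma>\<close> by (rule exI)
    show "\<exists>\<Delta>'. inv \<Delta>' \<and> \<Delta> \<subseteq> \<Delta>' \<and> handled \<Delta> \<Delta>' (from_nat n)" if "inv \<Delta>" for \<Delta> n
      using that by (rule step)
  qed
  then obtain G where G: "\<And>n. inv (G n)" "\<And>n. G n \<subseteq> G (Suc n)"
    "\<And>n. handled (G n) (G (Suc n)) (from_nat n)" by metis
  define w where "w = (\<Union>n. G n)"
  have mono: "G m \<subseteq> G n" if "m \<le> n" for m n using G(2) that by (rule lift_Suc_mono_le)
  have sub: "G n \<subseteq> w" for n by (auto simp: w_def)
  have cons: "\<not> w \<turnstile> \<psi>"
  proof
    assume "w \<turnstile> \<psi>"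
    then obtain \<Delta> where \<Delta>: "\<Delta> \<subseteq> w" "finite \<Delta>" "\<Delta> \<turnstile> \<psi>" using proves_finite by blast
    from \<Delta>(2,1) have "\<exists>n. \<Delta> \<subseteq> G n"
    proof induction
      case (insert x F)
      then obtain n m where "F \<subseteq> G n" "x \<in> G m" by (auto simp: w_def)
      then have "insert x F \<subseteq> G (max m n)" using mono[of n "max m n"] mono[of m "max m n"] by auto
      then show ?case by blast
    qed simp
    with \<Delta> G(1) show False unfolding inv_def by (meson proves_weaken)
  qed
  \<comment> \<open>Every rejected formula over \<open>V\<close> derives \<open>\<psi>\<close>
    together with \<open>w\<close>. Deductive closure and primeness follow by playing this against
    \<open>cons\<close>.\<close>
  have ins: "insert \<phi> w \<turnstile> \<psi>" if "fv \<phi> \<subseteq> V" "\<phi> \<notin> w" for \<phi>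
  proof -
    have "insert \<phi> (G (to_nat \<phi>)) \<turnstile> \<psi>"
      using G(3)[of "to_nat \<phi>"] that sub by (auto simp: handled_def)
    then show ?thesis using sub by (meson insert_mono proves_weaken)
  qed
  have fvw: "fv \<phi> \<subseteq> V" if "\<phi> \<in> w" for \<phi> using that G(1) by (auto simp: w_def inv_def)
  have "saturated V w"
    unfolding saturated_def
  proof (intro conjI allI impI ballI)
    show "infinite (- V)" using C(3) by (simp add: V_def Diff_eq)
    show "fv \<phi> \<subseteq> V" if "\<phi> \<in> w" for \<phi> using fvw that .
    show "\<phi> \<in> w" if "fv \<phi> \<subseteq> V" "w \<turnstile> \<phi>" for \<phi>
      using ins that cons proves_cut by blast
    show "\<phi> \<in> w \<or> \<chi> \<in> w" if "Disj \<phi> \<chi> \<in> w" for \<phi> \<chi>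
      using ins[of \<phi>] ins[of \<chi>] fvw[OF that] cons that
      by (metis Un_subset_iff fv.simps(5) proves.DisjE proves.assumption)
    show "\<exists>x\<in>V. inst \<phi> x \<in> w" if e: "Exists \<phi> \<in> w" for \<phi>
    proof -
      let ?n = "to_nat (Exists \<phi>)"
      have "\<not> insert (Exists \<phi>) (G ?n) \<turnstile> \<psi>"
        using cons e sub[of ?n] by (meson insert_subset proves_weaken)
      with G(3)[of ?n] fvw[OF e] sub[of "Suc ?n"] show ?thesis by (auto simp: handled_def)
    qed
  qed
  moreover have "\<Gamma> \<subseteq> w" using G(1)[of 0] sub[of 0] by (auto simp: inv_def)
  moreover have "\<psi> \<notin> w" using cons proves.assumption by blast
  ultimately show thesis using that by (auto simp: V_def)
qed

section \<open>The canonical Kripke model\<close>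

lemma fv_schema: "0 < d \<Longrightarrow> fv (schema \<phi> xs d) \<subseteq> {..<d}"
  by (auto simp: schema_def fv_rename)

lemma fv_Forall_funpow: "fv ((Forall ^^ n) \<phi>) = {x. x + n \<in> fv \<phi>}"
  by (induction n) simp_all

lemma fv_universal_closure: "fv (P n) \<subseteq> {..<n} \<Longrightarrow> fv (universal_closure n P) = {}"
  by (auto simp: universal_closure_def fv_Forall_funpow)

lemmas form_defs = f_eq_def f_mem_def f_and_def f_or_def f_imp_def f_iff_def f_not_def f_all_def
  f_ex_def f_ex1_def

lemmas vocabulary_defs = subset_def is_empty_def is_succ_def is_inductive_def is_omega_def
  is_nat_def is_upair_def is_pair_def pair_in_def is_relation_def is_function_def
  is_surjection_def finitely_enumerable_def

lemma fv_separation: "fv (separation n \<phi>) = {}"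
proof -
  have "fv (schema \<phi> [Suc (Suc n)] (Suc (Suc (Suc n)))) \<subseteq> {..<Suc (Suc (Suc n))}"
    by (rule fv_schema) simp
  then show ?thesis
    unfolding separation_def by (intro fv_universal_closure) (auto simp: form_defs)
qed

lemma fv_replacement: "fv (replacement n \<phi>) = {}"
proof -
  have "i < Suc d" if "i \<in> fv (schema \<phi> xs (Suc d))" for i xs d
    using that fv_schema[of "Suc d"] by auto
  then show ?thesis
    unfolding replacement_def
    by (intro fv_universal_closure) (force simp: form_defs)
qed

abbreviation theory_axioms :: "fm set" where
  "theory_axioms \<equiv> ECST \<union> {FPA}"

lemma fv_theory_axioms: "\<phi> \<in> theory_axioms \<Longrightarrow> fv \<phi> = {}"
  unfolding ECST_def FPA_def extensionality_def pairing_def union_axiom_def strong_infinity_def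
  by (auto simp: fv_separation fv_replacement) 
     (auto simp: form_defs vocabulary_defs)

text \<open>A world may contain \<open>Falsum\<close>, so that the existence of worlds does not depend on the consistency
  of the theory.\<close>

typedef world = "{w. theory_axioms \<subseteq> w \<and> (\<exists>V. saturated V w)}"
proof -
  \<comment> \<open>The theory of all formulas over the even variables shows that the type is
    inhabited. It is inconsistent, and the odd variables stay in reserve.\<close>
  have "saturated {n. even n} {\<phi>. fv \<phi> \<subseteq> {n. even n}}"
    unfolding saturated_def
  proof (intro conjI allI impI ballI)
    show "infinite (- {n::nat. even n})"
    proof -
      have "range (\<lambda>n. 2 * n + 1) \<subseteq> - {n::nat. even n}" by auto
      moreover have "infinite (range (\<lambda>n::nat. 2 * n + 1))" by (intro range_inj_infinite injI) simp
      ultimately show ?thesis using infinite_super by blast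
    qed
    show "\<exists>x\<in>{n. even n}. inst \<phi> x \<in> {\<phi>. fv \<phi> \<subseteq> {n. even n}}"
      if "Exists \<phi> \<in> {\<phi>. fv \<phi> \<subseteq> {n. even n}}" for \<phi>
      using that by (intro bexI[of _ 0]) (auto simp: fv_rename split: nat.split)
  qed auto
  with fv_theory_axioms show ?thesis by (intro exI[of _ "{\<phi>. fv \<phi> \<subseteq> {n. even n}}"]) auto
qed

instantiation world :: order
begin
definition less_eq_world :: "world \<Rightarrow> world \<Rightarrow> bool" where
  "w \<le> w' \<longleftrightarrow> Rep_world w \<subseteq> Rep_world w'"
definition less_world :: "world \<Rightarrow> world \<Rightarrow> bool" where
  "w < w' \<longleftrightarrow> Rep_world w \<subset> Rep_world w'"
instance
  by standard (auto simp: less_eq_world_def less_world_def Rep_world_inject)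
end

definition absurd :: "world \<Rightarrow> bool" where "absurd w \<longleftrightarrow> Falsum \<in> Rep_world w"
definition eql :: "world \<Rightarrow> nat \<Rightarrow> nat \<Rightarrow> bool" where "eql w x y \<longleftrightarrow> Equal x y \<in> Rep_world w"
definition mem :: "world \<Rightarrow> nat \<Rightarrow> nat \<Rightarrow> bool" where "mem w x y \<longleftrightarrow> Member x y \<in> Rep_world w"
text \<open>A world does not store its variable set. It is recovered from reflexivity:
  \<open>Equal x x\<close> is derivable, so it belongs to a saturated theory exactly when
  \<open>x\<close> is one of its variables.\<close>

definition obj :: "world \<Rightarrow> nat set" where "obj w = {x. eql w x x}"

lemma saturated_obj: "saturated V (Rep_world w) \<Longrightarrow> V = obj w"
  unfolding saturated_def obj_def eql_def using proves.EqualI by auto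

lemma saturated_Rep_world: "saturated (obj w) (Rep_world w)"
  using Rep_world[of w] saturated_obj by blast

lemma fv_Rep_world: "\<phi> \<in> Rep_world w \<Longrightarrow> fv \<phi> \<subseteq> obj w"
  using saturated_Rep_world unfolding saturated_def by blast

lemma Rep_world_closed: "Rep_world w \<turnstile> \<phi> \<Longrightarrow> fv \<phi> \<subseteq> obj w \<Longrightarrow> \<phi> \<in> Rep_world w"
  using saturated_Rep_world unfolding saturated_def by blast

lemma world_extension:
  assumes "\<not> \<Gamma> \<turnstile> \<psi>" "theory_axioms \<subseteq> \<Gamma>" "infinite (- V0)" "\<And>\<gamma>. \<gamma> \<in> \<Gamma> \<Longrightarrow> fv \<gamma> \<subseteq> V0" "fv \<psi> \<subseteq> V0"
  obtains w where "\<Gamma> \<subseteq> Rep_world w" "V0 \<subseteq> obj w" "\<psi> \<notin> Rep_world w"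
proof -
  from saturated_extension[OF assms(1,3,4,5)] obtain V w
    where w: "saturated V w" "\<Gamma> \<subseteq> w" "V0 \<subseteq> V" "\<psi> \<notin> w" by blast
  then have "Rep_world (Abs_world w) = w" using assms(2) by (intro Abs_world_inverse) auto
  with w saturated_obj[of V "Abs_world w"] show thesis by (intro that[of "Abs_world w"]) auto
qed

lemma mem_mono: "mem w x y \<Longrightarrow> w \<le> w' \<Longrightarrow> mem w' x y"
  and eql_mono: "eql w x y \<Longrightarrow> w \<le> w' \<Longrightarrow> eql w' x y"
  and absurd_mono: "absurd w \<Longrightarrow> w \<le> w' \<Longrightarrow> absurd w'"
  and obj_mono: "x \<in> obj w \<Longrightarrow> w \<le> w' \<Longrightarrow> x \<in> obj w'"
  by (auto simp: mem_def eql_def absurd_def obj_def less_eq_world_def)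

lemma mem_obj: assumes "mem w x y" shows "x \<in> obj w" "y \<in> obj w"
  using assms fv_Rep_world unfolding mem_def by force+

lemma eql_obj: assumes "eql w x y" shows "x \<in> obj w" "y \<in> obj w"
  using assms fv_Rep_world unfolding eql_def by force+

lemma eql_refl: "x \<in> obj w \<Longrightarrow> eql w x x"
  by (simp add: obj_def)

lemma eql_subst:
  assumes "eql w x y" "inst \<phi> x \<in> Rep_world w" "fv (inst \<phi> y) \<subseteq> obj w"
  shows "inst \<phi> y \<in> Rep_world w"
  using assms by (intro Rep_world_closed proves.EqualE[of _ x y \<phi>]) (auto simp: eql_def proves.assumption)

lemma eql_sym: "eql w x y \<Longrightarrow> eql w y x"
  using eql_subst[of w x y "Equal 0 (Suc x)"] eql_obj[of w x y] by (auto simp: eql_def obj_def)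

lemma eql_trans: "eql w x y \<Longrightarrow> eql w y z \<Longrightarrow> eql w x z"
  using eql_subst[of w y z "Equal (Suc x) 0"] eql_obj[of w x y] eql_obj[of w y z] by (auto simp: eql_def obj_def)

lemma mem_eql1: "mem w x y \<Longrightarrow> eql w x x' \<Longrightarrow> mem w x' y"
  using eql_subst[of w x x' "Member 0 (Suc y)"] eql_obj[of w x x'] mem_obj[of w x y] by (auto simp: mem_def obj_def)

lemma mem_eql2: "mem w x y \<Longrightarrow> eql w y y' \<Longrightarrow> mem w x y'"
  using eql_subst[of w y y' "Member (Suc x) 0"] eql_obj[of w y y'] mem_obj[of w x y] by (auto simp: mem_def obj_def)

text \<open>Kripke forcing with exploding worlds: a world forcing \<open>Falsum\<close> forces
  everything. Disjunction and existence are decided at the world itself, which primeness and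
  witnesses make possible.\<close>

primrec sat :: "world \<Rightarrow> (nat \<Rightarrow> nat) \<Rightarrow> fm \<Rightarrow> bool" where
  "sat w e Falsum \<longleftrightarrow> absurd w"
| "sat w e (Equal x y) \<longleftrightarrow> eql w (e x) (e y)"
| "sat w e (Member x y) \<longleftrightarrow> mem w (e x) (e y)"
| "sat w e (Conj \<phi> \<psi>) \<longleftrightarrow> sat w e \<phi> \<and> sat w e \<psi>"
| "sat w e (Disj \<phi> \<psi>) \<longleftrightarrow> sat w e \<phi> \<or> sat w e \<psi>"
| "sat w e (Impl \<phi> \<psi>) \<longleftrightarrow> (\<forall>w'\<ge>w. sat w' e \<phi> \<longrightarrow> sat w' e \<psi>)"
| "sat w e (Forall \<phi>) \<longleftrightarrow> (\<forall>w'\<ge>w. \<forall>x\<in>obj w'. sat w' (case_nat x e) \<phi>)"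
| "sat w e (Exists \<phi>) \<longleftrightarrow> (\<exists>x\<in>obj w. sat w (case_nat x e) \<phi>)"

lemma sat_mono: "sat w e \<phi> \<Longrightarrow> w \<le> w' \<Longrightarrow> sat w' e \<phi>"
proof (induction \<phi> arbitrary: w w' e)
  case (Impl \<phi> \<psi>)
  then show ?case using order_trans by auto
next
  case (Forall \<phi>)
  then show ?case using order_trans by auto
next
  case (Exists \<phi>)
  then show ?case using obj_mono by (simp; blast)
qed (auto intro: mem_mono eql_mono absurd_mono)

text \<open>Equality is interpreted by a congruence that need not be identity, so forcing has to be
  shown invariant under it.\<close>

lemma sat_eql: "\<forall>i\<in>fv \<phi>. eql w (e i) (e' i) \<Longrightarrow> sat w e \<phi> \<longleftrightarrow> sat w e' \<phi>"
proof (induction \<phi> arbitrary: w e e')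
  case (Equal x y)
  then show ?case by simp (meson eql_trans eql_sym)
next
  case (Member x y)
  then show ?case by simp (meson mem_eql1 mem_eql2 eql_sym)
next
  case (Conj \<phi> \<psi>)
  show ?case using Conj.IH[of w e e'] Conj.prems by simp
next
  case (Disj \<phi> \<psi>)
  show ?case using Disj.IH[of w e e'] Disj.prems by simp
next
  case (Impl \<phi> \<psi>)
  have "sat w' e \<phi> = sat w' e' \<phi> \<and> sat w' e \<psi> = sat w' e' \<psi>" if "w \<le> w'" for w'
    using Impl.IH[of w' e e'] Impl.prems eql_mono[OF _ that] by simp
  then show ?case by simp
next
  case (Forall \<phi>)
  have "sat w' (case_nat x e) \<phi> = sat w' (case_nat x e') \<phi>" if "w \<le> w'" "x \<in> obj w'" for w' x
    using Forall.prems that by (intro Forall.IH) (auto split: nat.split intro: eql_mono eql_refl)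
  then show ?case by simp
next
  case (Exists \<phi>)
  have "sat w (case_nat x e) \<phi> = sat w (case_nat x e') \<phi>" if "x \<in> obj w" for x
    using Exists.prems that by (intro Exists.IH) (auto split: nat.split intro: eql_refl)
  then show ?case by simp
qed simp

lemma sat_cong: "(\<And>i. i \<in> fv \<phi> \<Longrightarrow> e i = e' i) \<Longrightarrow> sat w e \<phi> \<longleftrightarrow> sat w e' \<phi>"
proof -
  have "\<forall>i\<in>fv \<phi>. e i = e' i \<Longrightarrow> sat w e \<phi> \<longleftrightarrow> sat w e' \<phi>"
  proof (induction \<phi> arbitrary: w e e')
    case (Impl \<phi> \<psi>)
    have "sat w' e \<phi> = sat w' e' \<phi> \<and> sat w' e \<psi> = sat w' e' \<psi>" for w'
      using Impl.IH[of e e' w'] Impl.prems by simp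
    then show ?case by simp
  next
    case (Conj \<phi> \<psi>)
    show ?case using Conj.IH[of e e' w] Conj.prems by simp
  next
    case (Disj \<phi> \<psi>)
    show ?case using Disj.IH[of e e' w] Disj.prems by simp
  next
    case (Forall \<phi>)
    have "sat w' (case_nat x e) \<phi> = sat w' (case_nat x e') \<phi>" for w' x
      using Forall.prems by (intro Forall.IH) (auto split: nat.split)
    then show ?case by simp
  next
    case (Exists \<phi>)
    have "sat w' (case_nat x e) \<phi> = sat w' (case_nat x e') \<phi>" for w' x
      using Exists.prems by (intro Exists.IH) (auto split: nat.split)
    then show ?case by simp
  qed simp_all
  then show "(\<And>i. i \<in> fv \<phi> \<Longrightarrow> e i = e' i) \<Longrightarrow> ?thesis" by blast
qed

lemma sat_rename: "sat w e (rename f \<phi>) \<longleftrightarrow> sat w (\<lambda>x. e (f x)) \<phi>"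
proof (induction \<phi> arbitrary: w e f)
  case (Forall \<phi>)
  have "(\<lambda>a. case_nat x e (case_nat 0 (\<lambda>x. Suc (f x)) a)) = case_nat x (\<lambda>a. e (f a))" for x
    by (auto simp: fun_eq_iff split: nat.split)
  with Forall show ?case by simp
next
  case (Exists \<phi>)
  have "(\<lambda>a. case_nat x e (case_nat 0 (\<lambda>x. Suc (f x)) a)) = case_nat x (\<lambda>a. e (f a))" for x
    by (auto simp: fun_eq_iff split: nat.split)
  with Exists show ?case by simp
qed simp_all

lemma inst_rename_case_nat:
  "inst (rename (case_nat 0 (\<lambda>x. Suc (e x))) \<phi>) x = rename (case_nat x e) \<phi>"
  unfolding rename_rename
  by (rule arg_cong[of _ _ "\<lambda>f. rename f \<phi>"]) (auto simp: fun_eq_iff split: nat.split)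

text \<open>Truth lemma of the canonical model. The hard directions are implication and universal
  quantification: what is not derivable is refuted at a larger world, obtained by adding the
  antecedent, respectively by taking a variable outside the world as a new object.\<close>

lemma sat_iff_Rep_world: "e ` fv \<phi> \<subseteq> obj w \<Longrightarrow> sat w e \<phi> \<longleftrightarrow> rename e \<phi> \<in> Rep_world w"
proof (induction \<phi> arbitrary: e w)
  case Falsum
  show ?case by (simp add: absurd_def)
next
  case (Equal x y)
  show ?case by (simp add: eql_def)
next
  case (Member x y)
  show ?case by (simp add: mem_def)
next
  case (Conj \<phi> \<psi>)
  let ?A = "rename e \<phi>" and ?B = "rename e \<psi>"
  have fv: "fv ?A \<subseteq> obj w" "fv ?B \<subseteq> obj w" using Conj.prems by (auto simp: fv_rename)
  have "Conj ?A ?B \<in> Rep_world w \<longleftrightarrow> ?A \<in> Rep_world w \<and> ?B \<in> Rep_world w"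
    using Rep_world_closed[of w ?A] Rep_world_closed[of w ?B] Rep_world_closed[of w "Conj ?A ?B"] fv
      proves.ConjE1 proves.ConjE2 proves.ConjI proves.assumption fv.simps(4) by (metis Un_least)
  with Conj.IH[of e w] Conj.prems show ?case by (simp add: image_Un)
next
  case (Disj \<phi> \<psi>)
  let ?A = "rename e \<phi>" and ?B = "rename e \<psi>"
  have fv: "fv ?A \<subseteq> obj w" "fv ?B \<subseteq> obj w" using Disj.prems by (auto simp: fv_rename)
  have "Disj ?A ?B \<in> Rep_world w \<longleftrightarrow> ?A \<in> Rep_world w \<or> ?B \<in> Rep_world w"
    using Rep_world_closed[of w "Disj ?A ?B"] fv saturated_Rep_world[of w]
      proves.DisjI1 proves.DisjI2 proves.assumption fv.simps(5) unfolding saturated_def by (metis Un_least)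
  with Disj.IH[of e w] Disj.prems show ?case by (simp add: image_Un)
next
  case (Impl \<phi> \<psi>)
  let ?A = "rename e \<phi>" and ?B = "rename e \<psi>"
  have fv: "fv ?A \<subseteq> obj w" "fv ?B \<subseteq> obj w" using Impl.prems by (auto simp: fv_rename)
  have IH: "sat w' e \<phi> \<longleftrightarrow> ?A \<in> Rep_world w'" "sat w' e \<psi> \<longleftrightarrow> ?B \<in> Rep_world w'" if "w \<le> w'" for w'
    using Impl.IH[of e w'] Impl.prems obj_mono[OF _ that] by auto
  show ?case
  proof
    assume *: "sat w e (Impl \<phi> \<psi>)"
    show "rename e (Impl \<phi> \<psi>) \<in> Rep_world w"
    proof (rule ccontr)
      assume "rename e (Impl \<phi> \<psi>) \<notin> Rep_world w"
      then have 1: "\<not> insert ?A (Rep_world w) \<turnstile> ?B"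
        using Rep_world_closed[of w "Impl ?A ?B"] fv proves.ImplI by auto
      have 2: "theory_axioms \<subseteq> insert ?A (Rep_world w)" using Rep_world[of w] by auto
      have 3: "infinite (- obj w)" using saturated_Rep_world[of w] by (simp add: saturated_def)
      have 4: "fv \<gamma> \<subseteq> obj w" if "\<gamma> \<in> insert ?A (Rep_world w)" for \<gamma>
        using that fv fv_Rep_world by blast
      from world_extension[OF 1 2 3 4 fv(2)]
      obtain w' where w': "insert ?A (Rep_world w) \<subseteq> Rep_world w'" "?B \<notin> Rep_world w'" by metis
      then have "w \<le> w'" by (simp add: less_eq_world_def)
      with * w' IH show False by auto
    qed
  next
    assume *: "rename e (Impl \<phi> \<psi>) \<in> Rep_world w"
    have "?B \<in> Rep_world w'" if w': "w \<le> w'" "?A \<in> Rep_world w'" for w'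
    proof (rule Rep_world_closed)
      show "Rep_world w' \<turnstile> ?B"
        using * w' by (intro proves.ImplE[of _ ?A ?B]) (auto simp: less_eq_world_def intro: proves.assumption)
      show "fv ?B \<subseteq> obj w'" using fv obj_mono w' by blast
    qed
    with IH show "sat w e (Impl \<phi> \<psi>)" by simp
  qed
next
  case (Forall \<phi>)
  let ?A = "rename (case_nat 0 (\<lambda>x. Suc (e x))) \<phi>"
  have fv: "fv (Forall ?A) \<subseteq> obj w"
    using Forall.prems fv_rename[of e "Forall \<phi>"] by simp
  have IH: "sat w' (case_nat x e) \<phi> \<longleftrightarrow> inst ?A x \<in> Rep_world w'" if "w \<le> w'" "x \<in> obj w'" for w' x
    unfolding inst_rename_case_nat using Forall.prems obj_mono[OF _ that(1)] that(2)
    by (intro Forall.IH) (force split: nat.splits)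
  show ?case
  proof
    assume *: "sat w e (Forall \<phi>)"
    show "rename e (Forall \<phi>) \<in> Rep_world w"
    proof (rule ccontr)
      assume neg: "rename e (Forall \<phi>) \<notin> Rep_world w"
      have inf: "infinite (- obj w)" using saturated_Rep_world[of w] by (simp add: saturated_def)
      then obtain x where x: "x \<notin> obj w" by (metis ComplD finite.emptyI ex_in_conv)
      have 1: "\<not> Rep_world w \<turnstile> inst ?A x"
        using Rep_world_closed[of w "Forall ?A"] ForallI_fresh[of "Rep_world w" x ?A] neg fv x fv_Rep_world
        by auto
      have 2: "theory_axioms \<subseteq> Rep_world w" using Rep_world[of w] by auto
      have 3: "infinite (- insert x (obj w))" using inf by (simp add: Compl_insert)
      have 4: "fv \<gamma> \<subseteq> insert x (obj w)" if "\<gamma> \<in> Rep_world w" for \<gamma>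
        using fv_Rep_world[OF that] by blast
      have 5: "fv (inst ?A x) \<subseteq> insert x (obj w)"
        using fv unfolding fv_rename[of _ ?A] by (force split: nat.splits)
      from world_extension[OF 1 2 3 4 5] obtain w'
        where w': "Rep_world w \<subseteq> Rep_world w'" "insert x (obj w) \<subseteq> obj w'" "inst ?A x \<notin> Rep_world w'"
        by metis
      then have "w \<le> w'" "x \<in> obj w'" by (simp_all add: less_eq_world_def)
      with * w' IH show False by auto
    qed
  next
    assume *: "rename e (Forall \<phi>) \<in> Rep_world w"
    have "inst ?A x \<in> Rep_world w'" if w': "w \<le> w'" "x \<in> obj w'" for w' x
    proof (rule Rep_world_closed)
      show "Rep_world w' \<turnstile> inst ?A x"
        using * w' by (intro proves.ForallE) (auto simp: less_eq_world_def intro: proves.assumption)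
      show "fv (inst ?A x) \<subseteq> obj w'"
        using fv w' obj_mono[OF _ w'(1)] unfolding fv_rename[of _ ?A] by (force split: nat.splits)
    qed
    with IH show "sat w e (Forall \<phi>)" by simp
  qed
next
  case (Exists \<phi>)
  let ?A = "rename (case_nat 0 (\<lambda>x. Suc (e x))) \<phi>"
  have fv: "fv (Exists ?A) \<subseteq> obj w"
    using Exists.prems fv_rename[of e "Exists \<phi>"] by simp
  have IH: "sat w (case_nat x e) \<phi> \<longleftrightarrow> inst ?A x \<in> Rep_world w" if "x \<in> obj w" for x
    unfolding inst_rename_case_nat using Exists.prems that
    by (intro Exists.IH) (force split: nat.splits)
  have "Exists ?A \<in> Rep_world w \<longleftrightarrow> (\<exists>x\<in>obj w. inst ?A x \<in> Rep_world w)"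
  proof
    assume "Exists ?A \<in> Rep_world w"
    with saturated_Rep_world[of w] show "\<exists>x\<in>obj w. inst ?A x \<in> Rep_world w"
      unfolding saturated_def by blast
  next
    assume "\<exists>x\<in>obj w. inst ?A x \<in> Rep_world w"
    then obtain x where "inst ?A x \<in> Rep_world w" by blast
    then have "Rep_world w \<turnstile> Exists ?A" by (intro proves.ExistsI[of _ x ?A] proves.assumption)
    with fv show "Exists ?A \<in> Rep_world w" by (rule Rep_world_closed[rotated])
  qed
  with IH show ?case by simp
qed

lemma sat_theory_axioms: "\<phi> \<in> theory_axioms \<Longrightarrow> sat w e \<phi>"
proof -
  assume "\<phi> \<in> theory_axioms"
  then have "\<phi> \<in> Rep_world w" "fv \<phi> = {}" using Rep_world[of w] fv_theory_axioms by auto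
  moreover from this have "rename e \<phi> = \<phi>" by (intro rename_id) simp
  ultimately show ?thesis by (simp add: sat_iff_Rep_world)
qed

text \<open>A formula that is not derivable is absent from some world, where the truth lemma makes
  it fail under the identity valuation.\<close>

theorem completeness:
  assumes "\<And>w. sat w id \<phi>"
  shows "theory_axioms \<turnstile> \<phi>"
proof (rule ccontr)
  assume *: "\<not> theory_axioms \<turnstile> \<phi>"
  obtain w where w: "fv \<phi> \<subseteq> obj w" "\<phi> \<notin> Rep_world w"
    by (rule world_extension[OF *, of "fv \<phi>"]) (auto simp: fv_theory_axioms finite_fv)
  then show False
    using assms[of w] sat_iff_Rep_world[of id \<phi> w] by (simp add: id_def rename_ident)
qed

section \<open>Evaluation of the concrete syntax\<close>

text \<open>Level \<open>x\<close> is index \<open>d - Suc x\<close>. The indices from \<open>d\<close> on do not occur in a closed \<open>form\<close>;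
  they are read off an arbitrary \<open>j\<close>.\<close>

definition env :: "(nat \<Rightarrow> nat) \<Rightarrow> nat \<Rightarrow> (nat \<Rightarrow> nat) \<Rightarrow> nat \<Rightarrow> nat" where
  "env j d \<rho> = (\<lambda>i. if i < d then \<rho> (d - Suc i) else j (i - d))"

definition holds :: "(nat \<Rightarrow> nat) \<Rightarrow> world \<Rightarrow> (nat \<Rightarrow> nat) \<Rightarrow> nat \<Rightarrow> form \<Rightarrow> bool" where
  "holds j w \<rho> d P = sat w (env j d \<rho>) (P d)"

lemma case_nat_env: "case_nat x (env j d \<rho>) = env j (Suc d) (\<rho>(d := x))"
  by (auto simp: env_def fun_eq_iff split: nat.split)

lemma env_level: "x < d \<Longrightarrow> env j d \<rho> (d - Suc x) = \<rho> x"
  by (simp add: env_def Suc_diff_Suc)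

text \<open>\<open>Forall\<close> and \<open>Impl\<close> each range over later worlds. Domains only
  grow, so an object of \<open>w'\<close> is still one of \<open>w''\<close> and the doubled
  quantification over worlds contracts.\<close>

lemma collapse_forcing:
  "(\<forall>w'\<ge>w. \<forall>x\<in>obj w'. \<forall>w''\<ge>w'. P w'' x) \<longleftrightarrow> (\<forall>w'\<ge>w. \<forall>x\<in>obj w'. P w' x)"
  for w :: world
  by (meson obj_mono order_refl order_trans)

lemma collapse_forcing2:
  "(\<forall>w'\<ge>w. \<forall>w''\<ge>w'. P w'') \<longleftrightarrow> (\<forall>w'\<ge>w. P w')"
  for w :: world
  by (meson order_refl order_trans)

lemma holds_connectives:
  "x < d \<Longrightarrow> y < d \<Longrightarrow> holds j w \<rho> d (x \<^bold>= y) \<longleftrightarrow> eql w (\<rho> x) (\<rho> y)"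
  "x < d \<Longrightarrow> y < d \<Longrightarrow> holds j w \<rho> d (x \<^bold>\<in> y) \<longleftrightarrow> mem w (\<rho> x) (\<rho> y)"
  "holds j w \<rho> d (P \<^bold>\<and> Q) \<longleftrightarrow> holds j w \<rho> d P \<and> holds j w \<rho> d Q"
  "holds j w \<rho> d (P \<^bold>\<or> Q) \<longleftrightarrow> holds j w \<rho> d P \<or> holds j w \<rho> d Q"
  "holds j w \<rho> d (P \<^bold>\<longrightarrow> Q) \<longleftrightarrow> (\<forall>w'\<ge>w. holds j w' \<rho> d P \<longrightarrow> holds j w' \<rho> d Q)"
  "holds j w \<rho> d (\<^bold>\<not> P) \<longleftrightarrow> (\<forall>w'\<ge>w. holds j w' \<rho> d P \<longrightarrow> absurd w')"
  "holds j w \<rho> d (P \<^bold>\<longleftrightarrow> Q) \<longleftrightarrow> (\<forall>w'\<ge>w. holds j w' \<rho> d P \<longleftrightarrow> holds j w' \<rho> d Q)"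
  "holds j w \<rho> d (f_all F) \<longleftrightarrow> (\<forall>w'\<ge>w. \<forall>x\<in>obj w'. holds j w' (\<rho>(d := x)) (Suc d) (F d))"
  "holds j w \<rho> d (f_ex F) \<longleftrightarrow> (\<exists>x\<in>obj w. holds j w (\<rho>(d := x)) (Suc d) (F d))"
  by (auto simp: holds_def form_defs case_nat_env env_level)

lemmas holds_simps = holds_connectives f_ex1_def collapse_forcing collapse_forcing2

text \<open>From here on the vocabulary is restated as HOL predicates on worlds, in the shape to
  which the forcing clauses simplify: nested worlds are contracted, and the bound \<open>obj\<close>
  is dropped where membership already implies it.\<close>

definition incl :: "world \<Rightarrow> nat \<Rightarrow> nat \<Rightarrow> bool" where
  "incl w x y \<longleftrightarrow> (\<forall>w'\<ge>w. \<forall>z. mem w' z x \<longrightarrow> mem w' z y)"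

text \<open>An empty set may have elements, but only at absurd worlds.\<close>

definition empt :: "world \<Rightarrow> nat \<Rightarrow> bool" where
  "empt w z \<longleftrightarrow> (\<forall>w'\<ge>w. \<forall>u. mem w' u z \<longrightarrow> absurd w')"

definition succ :: "world \<Rightarrow> nat \<Rightarrow> nat \<Rightarrow> bool" where
  "succ w y x \<longleftrightarrow> (\<forall>w'\<ge>w. \<forall>u. mem w' u y \<longleftrightarrow> mem w' u x \<or> eql w' u x)"

definition induc :: "world \<Rightarrow> nat \<Rightarrow> bool" where
  "induc w o' \<longleftrightarrow> (\<exists>z. mem w z o' \<and> empt w z) \<and>
     (\<forall>w'\<ge>w. \<forall>x. mem w' x o' \<longrightarrow> (\<exists>y. mem w' y o' \<and> succ w' y x))"

definition omega :: "world \<Rightarrow> nat \<Rightarrow> bool" where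
  "omega w o' \<longleftrightarrow> induc w o' \<and> (\<forall>w'\<ge>w. \<forall>v\<in>obj w'. induc w' v \<longrightarrow> incl w' o' v)"

definition upair :: "world \<Rightarrow> nat \<Rightarrow> nat \<Rightarrow> nat \<Rightarrow> bool" where
  "upair w z a b \<longleftrightarrow> (\<forall>w'\<ge>w. \<forall>u. mem w' u z \<longleftrightarrow> eql w' u a \<or> eql w' u b)"

definition opair :: "world \<Rightarrow> nat \<Rightarrow> nat \<Rightarrow> nat \<Rightarrow> bool" where
  "opair w p a b \<longleftrightarrow> (\<forall>w'\<ge>w. \<forall>z\<in>obj w'. mem w' z p \<longleftrightarrow> upair w' z a a \<or> upair w' z a b)"

definition rl :: "world \<Rightarrow> nat \<Rightarrow> nat \<Rightarrow> nat \<Rightarrow> bool" where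
  "rl w r a b \<longleftrightarrow> (\<exists>p. opair w p a b \<and> mem w p r)"

definition isrel :: "world \<Rightarrow> nat \<Rightarrow> nat \<Rightarrow> nat \<Rightarrow> bool" where
  "isrel w r A B \<longleftrightarrow> (\<forall>w'\<ge>w. \<forall>p. mem w' p r \<longrightarrow> (\<exists>a b. mem w' a A \<and> mem w' b B \<and> opair w' p a b))"

definition isfun :: "world \<Rightarrow> nat \<Rightarrow> nat \<Rightarrow> nat \<Rightarrow> bool" where
  "isfun w f A B \<longleftrightarrow> isrel w f A B \<and> (\<forall>w'\<ge>w. \<forall>x. mem w' x A \<longrightarrow>
     (\<exists>y\<in>obj w'. rl w' f x y \<and> (\<forall>w''\<ge>w'. \<forall>y'\<in>obj w''. rl w'' f x y' \<longrightarrow> eql w'' y' y)))"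

definition surjection :: "world \<Rightarrow> nat \<Rightarrow> nat \<Rightarrow> nat \<Rightarrow> bool" where
  "surjection w f A B \<longleftrightarrow> isfun w f A B \<and>
     (\<forall>w'\<ge>w. \<forall>y. mem w' y B \<longrightarrow> (\<exists>x. mem w' x A \<and> rl w' f x y))"

definition finen :: "world \<Rightarrow> nat \<Rightarrow> bool" where
  "finen w A \<longleftrightarrow> (\<exists>n o'. omega w o' \<and> mem w n o' \<and> (\<exists>f\<in>obj w. surjection w f n A))"

lemma bounded_obj: "(\<exists>x\<in>obj w. mem w x A \<and> P x) \<longleftrightarrow> (\<exists>x. mem w x A \<and> P x)"
  "(\<forall>x\<in>obj w. mem w x A \<longrightarrow> Q x) \<longleftrightarrow> (\<forall>x. mem w x A \<longrightarrow> Q x)"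
  "(\<exists>x\<in>obj w. P x \<and> mem w x A) \<longleftrightarrow> (\<exists>x. P x \<and> mem w x A)"
  "(\<exists>x\<in>obj w. mem w x A) \<longleftrightarrow> (\<exists>x. mem w x A)"
  using mem_obj by blast+

lemma holds_vocabulary:
  "x < d \<Longrightarrow> y < d \<Longrightarrow> holds j w \<rho> d (x \<^bold>\<subseteq> y) \<longleftrightarrow> incl w (\<rho> x) (\<rho> y)"
  "x < d \<Longrightarrow> holds j w \<rho> d (is_empty x) \<longleftrightarrow> empt w (\<rho> x)"
  "x < d \<Longrightarrow> y < d \<Longrightarrow> holds j w \<rho> d (is_succ y x) \<longleftrightarrow> succ w (\<rho> y) (\<rho> x)"
  "x < d \<Longrightarrow> y < d \<Longrightarrow> z < d \<Longrightarrow> holds j w \<rho> d (is_upair z x y) \<longleftrightarrow> upair w (\<rho> z) (\<rho> x) (\<rho> y)"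
proof -
  have "(\<forall>w'\<ge>w. \<forall>u\<in>obj w'. mem w' u z \<longleftrightarrow> mem w' u x \<or> eql w' u x) \<longleftrightarrow> succ w z x" for x z w
    unfolding succ_def using eql_obj mem_obj by blast
  moreover have "(\<forall>w'\<ge>w. \<forall>u\<in>obj w'. mem w' u z \<longleftrightarrow> eql w' u x \<or> eql w' u y) \<longleftrightarrow> upair w z x y" for x y z w
    unfolding upair_def using eql_obj mem_obj by blast
  ultimately show
    "x < d \<Longrightarrow> y < d \<Longrightarrow> holds j w \<rho> d (x \<^bold>\<subseteq> y) \<longleftrightarrow> incl w (\<rho> x) (\<rho> y)"
    "x < d \<Longrightarrow> holds j w \<rho> d (is_empty x) \<longleftrightarrow> empt w (\<rho> x)"
    "x < d \<Longrightarrow> y < d \<Longrightarrow> holds j w \<rho> d (is_succ y x) \<longleftrightarrow> succ w (\<rho> y) (\<rho> x)"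
    "x < d \<Longrightarrow> y < d \<Longrightarrow> z < d \<Longrightarrow> holds j w \<rho> d (is_upair z x y) \<longleftrightarrow> upair w (\<rho> z) (\<rho> x) (\<rho> y)"
    by (simp_all add: vocabulary_defs holds_simps incl_def empt_def bounded_obj)
qed

lemma holds_is_pair:
  "x < d \<Longrightarrow> y < d \<Longrightarrow> z < d \<Longrightarrow> holds j w \<rho> d (is_pair z x y) \<longleftrightarrow> opair w (\<rho> z) (\<rho> x) (\<rho> y)"
  by (simp add: is_pair_def holds_simps holds_vocabulary opair_def)

lemma holds_pair_in:
  "x < d \<Longrightarrow> y < d \<Longrightarrow> z < d \<Longrightarrow> holds j w \<rho> d (pair_in x y z) \<longleftrightarrow> rl w (\<rho> z) (\<rho> x) (\<rho> y)"
  by (simp add: pair_in_def holds_simps holds_is_pair rl_def bounded_obj)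

lemma holds_is_relation:
  "x < d \<Longrightarrow> y < d \<Longrightarrow> z < d \<Longrightarrow> holds j w \<rho> d (is_relation z x y) \<longleftrightarrow> isrel w (\<rho> z) (\<rho> x) (\<rho> y)"
  unfolding isrel_def is_relation_def
  by (simp add: holds_simps holds_is_pair bounded_obj)

lemma holds_is_function:
  "x < d \<Longrightarrow> y < d \<Longrightarrow> z < d \<Longrightarrow> holds j w \<rho> d (is_function z x y) \<longleftrightarrow> isfun w (\<rho> z) (\<rho> x) (\<rho> y)"
  unfolding isfun_def is_function_def
  by (simp add: holds_simps holds_is_relation holds_pair_in bounded_obj)

lemma holds_is_surjection:
  "x < d \<Longrightarrow> y < d \<Longrightarrow> z < d \<Longrightarrow> holds j w \<rho> d (is_surjection z x y) \<longleftrightarrow> surjection w (\<rho> z) (\<rho> x) (\<rho> y)"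
  unfolding surjection_def is_surjection_def
  by (simp add: holds_simps holds_is_function holds_pair_in bounded_obj)

lemma holds_is_inductive: "x < d \<Longrightarrow> holds j w \<rho> d (is_inductive x) \<longleftrightarrow> induc w (\<rho> x)"
  unfolding induc_def is_inductive_def
  by (simp add: holds_simps holds_vocabulary bounded_obj)

lemma induc_obj: "induc w x \<Longrightarrow> x \<in> obj w"
  unfolding induc_def using mem_obj by blast

lemma holds_is_omega: "x < d \<Longrightarrow> holds j w \<rho> d (is_omega x) \<longleftrightarrow> omega w (\<rho> x)"
  unfolding omega_def is_omega_def
  by (simp add: holds_simps holds_is_inductive holds_vocabulary bounded_obj)

lemma holds_is_nat: "x < d \<Longrightarrow> holds j w \<rho> d (is_nat x) \<longleftrightarrow> (\<exists>o'. omega w o' \<and> mem w (\<rho> x) o')"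
  unfolding is_nat_def using mem_obj by (simp add: holds_simps holds_is_omega) blast

lemma holds_finitely_enumerable: "x < d \<Longrightarrow> holds j w \<rho> d (finitely_enumerable x) \<longleftrightarrow> finen w (\<rho> x)"
  unfolding finen_def finitely_enumerable_def using mem_obj
  by (simp add: holds_simps holds_is_nat holds_is_surjection) blast

lemmas holds_set_theory = holds_simps holds_vocabulary holds_is_pair holds_pair_in holds_is_relation holds_is_function
  holds_is_surjection holds_is_omega holds_is_nat holds_finitely_enumerable bounded_obj

lemma holds_sentence: "sat w j (sentence P) \<longleftrightarrow> holds j w (\<lambda>_. 0) 0 P"
  by (simp add: holds_def env_def)

section \<open>The axioms of ECST and FPA at a world\<close>

lemma eql_iff_mem:
  assumes "x \<in> obj w" "y \<in> obj w"
  shows "eql w x y \<longleftrightarrow> (\<forall>w'\<ge>w. \<forall>z. mem w' z x \<longleftrightarrow> mem w' z y)"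
proof
  have "sat w (\<lambda>_. 0) extensionality" by (rule sat_theory_axioms) (simp add: ECST_def)
  then have "\<forall>w'\<ge>w. \<forall>x\<in>obj w'. \<forall>y\<in>obj w'. (\<forall>w''\<ge>w'. \<forall>z\<in>obj w''. mem w'' z x \<longleftrightarrow> mem w'' z y) \<longrightarrow> eql w' x y"
    unfolding extensionality_def holds_sentence by (simp add: holds_simps)
  with assms show "\<forall>w'\<ge>w. \<forall>z. mem w' z x \<longleftrightarrow> mem w' z y \<Longrightarrow> eql w x y" by blast
  show "eql w x y \<Longrightarrow> \<forall>w'\<ge>w. \<forall>z. mem w' z x \<longleftrightarrow> mem w' z y"
    using eql_mono eql_sym mem_eql2 by blast
qed

lemma upair_exists:
  assumes "a \<in> obj w" "b \<in> obj w"
  obtains z where "z \<in> obj w" "upair w z a b"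
proof -
  have "sat w (\<lambda>_. 0) pairing" by (rule sat_theory_axioms) (simp add: ECST_def)
  then have "\<forall>w'\<ge>w. \<forall>a\<in>obj w'. \<forall>b\<in>obj w'. \<exists>z\<in>obj w'. upair w' z a b"
    unfolding pairing_def holds_sentence by (simp add: holds_simps holds_vocabulary)
  with assms that show thesis by blast
qed

lemma union_exists:
  assumes "a \<in> obj w"
  obtains u where "u \<in> obj w" "\<And>w' x. w \<le> w' \<Longrightarrow> mem w' x u \<longleftrightarrow> (\<exists>y. mem w' y a \<and> mem w' x y)"
proof -
  have "sat w (\<lambda>_. 0) union_axiom" by (rule sat_theory_axioms) (simp add: ECST_def)
  then have "\<forall>w'\<ge>w. \<forall>a\<in>obj w'. \<exists>u\<in>obj w'. \<forall>w''\<ge>w'. \<forall>x\<in>obj w''. mem w'' x u \<longleftrightarrow> (\<exists>y. mem w'' y a \<and> mem w'' x y)"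
    unfolding union_axiom_def holds_sentence by (simp add: holds_simps bounded_obj)
  with assms obtain u where "u \<in> obj w" "\<forall>w''\<ge>w. \<forall>x\<in>obj w''. mem w'' x u \<longleftrightarrow> (\<exists>y. mem w'' y a \<and> mem w'' x y)"
    by blast
  with that mem_obj show thesis by meson
qed

lemma omega_exists: obtains n where "omega w n" "n \<in> obj w"
proof -
  have "sat w (\<lambda>_. 0) strong_infinity" by (rule sat_theory_axioms) (simp add: ECST_def)
  then have "\<exists>n\<in>obj w. omega w n"
    unfolding strong_infinity_def holds_sentence by (simp add: holds_simps holds_is_omega)
  with that show thesis by blast
qed

lemma function_set_exists:
  assumes "omega w o'" "mem w n o'" "S \<in> obj w"
  obtains F where "F \<in> obj w" "\<And>w' f. w \<le> w' \<Longrightarrow> f \<in> obj w' \<Longrightarrow> mem w' f F \<longleftrightarrow> isfun w' f n S"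
proof -
  have "sat w (\<lambda>_. 0) FPA" by (rule sat_theory_axioms) simp
  then have "\<forall>w'\<ge>w. \<forall>S\<in>obj w'. \<forall>n\<in>obj w'. (\<exists>o'. omega w' o' \<and> mem w' n o') \<longrightarrow>
      (\<exists>F\<in>obj w'. \<forall>w''\<ge>w'. \<forall>f\<in>obj w''. mem w'' f F \<longleftrightarrow> isfun w'' f n S)"
    unfolding FPA_def holds_sentence by (simp add: holds_simps holds_is_nat holds_is_function)
  with assms mem_obj that show thesis by (metis order_refl)
qed

text \<open>Index 0 belongs to the innermost quantifier, so the induction strips quantifiers from
  the inside and \<open>q 0\<close> is the value of the last one.\<close>

lemma sat_Forall_funpow:
  "sat w e ((Forall ^^ n) \<phi>) \<Longrightarrow> (\<And>i. q i \<in> obj w) \<Longrightarrow>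
    sat w (\<lambda>i. if i < n then q i else e (i - n)) \<phi>"
proof (induction n arbitrary: \<phi> q)
  case (Suc n)
  from Suc.prems(1) have "sat w e ((Forall ^^ n) (Forall \<phi>))" by (simp only: funpow_Suc_right o_apply)
  then have "sat w (\<lambda>i. if i < n then q (Suc i) else e (i - n)) (Forall \<phi>)"
    using Suc.IH[of "Forall \<phi>" "\<lambda>i. q (Suc i)"] Suc.prems(2) by blast
  then have "sat w (case_nat (q 0) (\<lambda>i. if i < n then q (Suc i) else e (i - n))) \<phi>"
    using Suc.prems(2) by simp
  moreover have "case_nat (q 0) (\<lambda>i. if i < n then q (Suc i) else e (i - n)) =
      (\<lambda>i. if i < Suc n then q i else e (i - Suc n))"
    by (auto simp: fun_eq_iff split: nat.split)
  ultimately show ?case by simp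
qed simp

lemma holds_universal_closure:
  assumes "sat w j (universal_closure n P)" "\<And>i. \<rho> i \<in> obj w"
  shows "holds j w \<rho> n P"
  \<comment> \<open>Levels count from the outermost quantifier and indices from the innermost, hence
    the reversal \<open>n - Suc i\<close>.\<close>
  using sat_Forall_funpow[of w j n "P n" "\<lambda>i. \<rho> (n - Suc i)"] assms
  by (simp add: holds_def env_def universal_closure_def)

lemma holds_schema:
  assumes "fv \<phi> \<subseteq> {..<n + length xs}" "n < d" "\<And>x. x \<in> set xs \<Longrightarrow> x < d"
  shows "holds j w \<rho> d (schema \<phi> xs) \<longleftrightarrow> sat w (\<lambda>i. \<rho> (if i < length xs then xs ! i else i - length xs)) \<phi>"
proof -
  have "(if i < length xs then xs ! i else i - length xs) < d" if "i \<in> fv \<phi>" for i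
    using that assms by (auto dest!: subsetD simp: less_diff_conv)
  then show ?thesis
    unfolding holds_def schema_def sat_rename by (intro sat_cong env_level)
qed

lemma holds_schema1:
  assumes "fv \<phi> \<subseteq> {..<n + 1}" "n < d" "x < d" "\<And>i. i < n \<Longrightarrow> \<rho> i = q i"
  shows "holds j w \<rho> d (schema \<phi> [x]) \<longleftrightarrow> sat w (case_nat (\<rho> x) q) \<phi>"
proof -
  have "holds j w \<rho> d (schema \<phi> [x]) \<longleftrightarrow> sat w (\<lambda>i. \<rho> (if i < length [x] then [x] ! i else i - length [x])) \<phi>"
    by (rule holds_schema[where n = n]) (use assms in auto)
  also have "\<dots> \<longleftrightarrow> sat w (case_nat (\<rho> x) q) \<phi>"
    using assms(1,4) by (intro sat_cong) (auto split: nat.split)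
  finally show ?thesis .
qed

lemma holds_schema2:
  assumes "fv \<phi> \<subseteq> {..<n + 2}" "n < d" "x < d" "y < d" "\<And>i. i < n \<Longrightarrow> \<rho> i = q i"
  shows "holds j w \<rho> d (schema \<phi> [x, y]) \<longleftrightarrow> sat w (case_nat (\<rho> x) (case_nat (\<rho> y) q)) \<phi>"
proof -
  have "holds j w \<rho> d (schema \<phi> [x, y]) \<longleftrightarrow> sat w (\<lambda>i. \<rho> (if i < length [x, y] then [x, y] ! i else i - length [x, y])) \<phi>"
    by (rule holds_schema[where n = n]) (use assms in auto)
  also have "\<dots> \<longleftrightarrow> sat w (case_nat (\<rho> x) (case_nat (\<rho> y) q)) \<phi>"
    using assms(1,5) by (intro sat_cong) (auto split: nat.split simp: nth_Cons)
  finally show ?thesis .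
qed

lemma fv_bound: obtains n where "fv \<phi> \<subseteq> {..<n + m}"
proof -
  obtain n where "\<forall>i\<in>fv \<phi>. i < n" using finite_fv finite_nat_set_iff_bounded by blast
  then have "fv \<phi> \<subseteq> {..<n + m}" by auto
  then show thesis by (rule that)
qed

lemma separation_sat:
  assumes "restricted \<phi>" "\<And>i. q i \<in> obj w" "a \<in> obj w"
  obtains b where "b \<in> obj w"
    "\<And>w' x. w \<le> w' \<Longrightarrow> mem w' x b \<longleftrightarrow> mem w' x a \<and> sat w' (case_nat x q) \<phi>"
proof -
  obtain n where n: "fv \<phi> \<subseteq> {..<n + 1}" by (rule fv_bound)
  have "sat w (\<lambda>_. 0) (separation n \<phi>)"
    by (rule sat_theory_axioms) (use assms(1) n in \<open>auto simp: ECST_def\<close>)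
  from holds_universal_closure[OF this[unfolded separation_def], of q] assms(2)
  have "\<forall>w'\<ge>w. \<forall>a\<in>obj w'. \<exists>b\<in>obj w'. \<forall>w''\<ge>w'. \<forall>x\<in>obj w''. mem w'' x b \<longleftrightarrow> mem w'' x a \<and> sat w'' (case_nat x q) \<phi>"
    by (simp add: holds_simps holds_schema1[OF n, where q = q])
  then obtain b where "b \<in> obj w" "\<forall>w'\<ge>w. \<forall>x\<in>obj w'. mem w' x b \<longleftrightarrow> mem w' x a \<and> sat w' (case_nat x q) \<phi>"
    using assms(3) by blast
  with that mem_obj show thesis by meson
qed

lemma replacement_sat:
  assumes "\<And>i. q i \<in> obj w" "a \<in> obj w"
    "\<And>w' x. w \<le> w' \<Longrightarrow> mem w' x a \<Longrightarrow> \<exists>y\<in>obj w'. sat w' (case_nat x (case_nat y q)) \<phi> \<and>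
       (\<forall>w''\<ge>w'. \<forall>y'\<in>obj w''. sat w'' (case_nat x (case_nat y' q)) \<phi> \<longrightarrow> eql w'' y' y)"
  obtains b where "b \<in> obj w"
    "\<And>w' y. w \<le> w' \<Longrightarrow> y \<in> obj w' \<Longrightarrow> mem w' y b \<longleftrightarrow> (\<exists>x. mem w' x a \<and> sat w' (case_nat x (case_nat y q)) \<phi>)"
proof -
  obtain n where n: "fv \<phi> \<subseteq> {..<n + 2}" by (rule fv_bound)
  have "sat w (\<lambda>_. 0) (replacement n \<phi>)"
    by (rule sat_theory_axioms) (use assms(1) n in \<open>auto simp: ECST_def\<close>)
  from holds_universal_closure[OF this[unfolded replacement_def], of q] assms(1)
  have "\<forall>w'\<ge>w. \<forall>a\<in>obj w'. (\<forall>w''\<ge>w'. \<forall>x. mem w'' x a \<longrightarrow> (\<exists>y\<in>obj w''. sat w'' (case_nat x (case_nat y q)) \<phi> \<and>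
       (\<forall>w3\<ge>w''. \<forall>y'\<in>obj w3. sat w3 (case_nat x (case_nat y' q)) \<phi> \<longrightarrow> eql w3 y' y))) \<longrightarrow>
    (\<exists>b\<in>obj w'. \<forall>w''\<ge>w'. \<forall>y\<in>obj w''. mem w'' y b \<longleftrightarrow> (\<exists>x. mem w'' x a \<and> sat w'' (case_nat x (case_nat y q)) \<phi>))"
    by (simp add: holds_simps holds_schema2[OF n, where q = q] bounded_obj)
  from this[THEN spec, THEN mp, OF order_refl, THEN bspec, OF assms(2), THEN mp]
  have "\<exists>b\<in>obj w. \<forall>w'\<ge>w. \<forall>y\<in>obj w'. mem w' y b \<longleftrightarrow> (\<exists>x. mem w' x a \<and> sat w' (case_nat x (case_nat y q)) \<phi>)"
    using assms(3) by simp
  then obtain b where "b \<in> obj w"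
    "\<forall>w'\<ge>w. \<forall>y\<in>obj w'. mem w' y b \<longleftrightarrow> (\<exists>x. mem w' x a \<and> sat w' (case_nat x (case_nat y q)) \<phi>)"
    by (elim bexE)
  then show thesis by (intro that) auto
qed

section \<open>Pairs and definable families\<close>

lemma forall_ge_mono: "\<forall>w'\<ge>w. P w' \<Longrightarrow> w \<le> w' \<Longrightarrow> \<forall>w''\<ge>w'. P w''"
  for w :: world
  using order_trans by auto

lemma incl_mono: "incl w x y \<Longrightarrow> w \<le> w' \<Longrightarrow> incl w' x y"
  and empt_mono: "empt w z \<Longrightarrow> w \<le> w' \<Longrightarrow> empt w' z"
  and upair_mono: "upair w p x y \<Longrightarrow> w \<le> w' \<Longrightarrow> upair w' p x y"
  and opair_mono: "opair w p x y \<Longrightarrow> w \<le> w' \<Longrightarrow> opair w' p x y"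
  and isrel_mono: "isrel w r A B \<Longrightarrow> w \<le> w' \<Longrightarrow> isrel w' r A B"
  unfolding incl_def empt_def upair_def opair_def isrel_def by (erule (1) forall_ge_mono)+

lemma rl_mono: "rl w r x y \<Longrightarrow> w \<le> w' \<Longrightarrow> rl w' r x y"
  unfolding rl_def using opair_mono mem_mono by blast

lemma isfun_mono: "isfun w f A B \<Longrightarrow> w \<le> w' \<Longrightarrow> isfun w' f A B"
  unfolding isfun_def by (elim conjE) (intro conjI, erule (1) isrel_mono, erule (1) forall_ge_mono)

lemma surjection_mono: "surjection w f A B \<Longrightarrow> w \<le> w' \<Longrightarrow> surjection w' f A B"
  unfolding surjection_def by (elim conjE) (intro conjI, erule (1) isfun_mono, erule (1) forall_ge_mono)

lemma induc_mono: "induc w n \<Longrightarrow> w \<le> w' \<Longrightarrow> induc w' n"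
  unfolding induc_def using mem_mono empt_mono
  by (elim conjE) (intro conjI, blast, erule (1) forall_ge_mono)

lemma omega_mono: "omega w n \<Longrightarrow> w \<le> w' \<Longrightarrow> omega w' n"
  unfolding omega_def by (elim conjE) (intro conjI, erule (1) induc_mono, erule (1) forall_ge_mono)

lemma finen_mono: "finen w A \<Longrightarrow> w \<le> w' \<Longrightarrow> finen w' A"
  unfolding finen_def using omega_mono surjection_mono mem_mono obj_mono by blast

lemma incl_mem: "incl w x y \<Longrightarrow> mem w z x \<Longrightarrow> mem w z y"
  unfolding incl_def by blast

lemma incl_trans: "incl w x y \<Longrightarrow> incl w y z \<Longrightarrow> incl w x z"
  unfolding incl_def by blast

lemma incl_refl: "incl w x x"
  unfolding incl_def by blast

lemma upair_eql:
  assumes "upair w z a b" "eql w a a'" "eql w b b'"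
  shows "upair w z a' b'"
  unfolding upair_def
proof (intro allI impI)
  fix w' u assume w': "w \<le> w'"
  have "eql w' a a'" "eql w' b b'" using assms w' eql_mono by blast+
  moreover have "mem w' u z \<longleftrightarrow> eql w' u a \<or> eql w' u b" using assms(1) w' unfolding upair_def by blast
  ultimately show "mem w' u z \<longleftrightarrow> eql w' u a' \<or> eql w' u b'" using eql_trans eql_sym by blast
qed

lemma upair_unique:
  assumes "upair w z a b" "upair w z' a b" "z \<in> obj w" "z' \<in> obj w"
  shows "eql w z z'"
  using assms unfolding upair_def by (simp add: eql_iff_mem)

lemma upair_eql0:
  assumes "upair w z a b" "eql w z z'"
  shows "upair w z' a b"
  using assms eql_iff_mem[of z w z'] eql_obj[of w z z'] unfolding upair_def by simp

lemma upair_mem: "upair w z a b \<Longrightarrow> a \<in> obj w \<Longrightarrow> b \<in> obj w \<Longrightarrow> mem w a z \<and> mem w b z"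
  unfolding upair_def using eql_refl by blast

lemma opair_eql:
  assumes "opair w p a b" "eql w a a'" "eql w b b'"
  shows "opair w p a' b'"
  unfolding opair_def
proof (intro allI impI ballI)
  fix w' z assume w': "w \<le> w'" "z \<in> obj w'"
  have *: "eql w' a a'" "eql w' b b'" using assms w' eql_mono by blast+
  then have "upair w' z a a \<longleftrightarrow> upair w' z a' a'" "upair w' z a b \<longleftrightarrow> upair w' z a' b'"
    using upair_eql eql_sym by blast+
  with w' assms(1) show "mem w' z p \<longleftrightarrow> upair w' z a' a' \<or> upair w' z a' b'" unfolding opair_def by simp
qed

lemma opair_unique:
  assumes "opair w p a b" "opair w p' a b" "p \<in> obj w" "p' \<in> obj w"
  shows "eql w p p'"
proof -
  have "mem w' z p \<longleftrightarrow> mem w' z p'" if "w \<le> w'" for w' z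
    using assms(1,2) that mem_obj[of w' z p] mem_obj[of w' z p'] unfolding opair_def by blast
  with assms(3,4) show ?thesis by (simp add: eql_iff_mem)
qed

lemma opair_exists:
  assumes "a \<in> obj w" "b \<in> obj w"
  obtains p where "p \<in> obj w" "opair w p a b"
proof -
  obtain s where s: "s \<in> obj w" "upair w s a a" using upair_exists assms by blast
  obtain t where t: "t \<in> obj w" "upair w t a b" using upair_exists assms by blast
  obtain p where p: "p \<in> obj w" "upair w p s t" using upair_exists s t by blast
  have "mem w' z p \<longleftrightarrow> upair w' z a a \<or> upair w' z a b" if "w \<le> w'" "z \<in> obj w'" for w' z
  proof -
    have st: "upair w' s a a" "upair w' t a b" "s \<in> obj w'" "t \<in> obj w'"
      using s t that upair_mono obj_mono by blast+
    have "mem w' z p \<longleftrightarrow> eql w' z s \<or> eql w' z t" using p that unfolding upair_def by blast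
    then show ?thesis using st that upair_unique upair_eql0 eql_sym by blast
  qed
  with p that show thesis unfolding opair_def by blast
qed

text \<open>No case distinction on whether \<open>a\<close> equals \<open>b\<close> is available at
  a world. Instead the singleton and the unordered pair of each presentation are read in the other
  one: \<open>{a}\<close> gives \<open>a = x\<close>, then \<open>{a, b}\<close> and
  \<open>{x, y}\<close> each give a disjunction, and all combinations lead to
  \<open>b = y\<close>.\<close>

lemma opair_inject:
  assumes "opair w p a b" "opair w p x y" "a \<in> obj w" "b \<in> obj w" "x \<in> obj w" "y \<in> obj w"
  shows "eql w a x \<and> eql w b y"
proof -
  obtain s where s: "s \<in> obj w" "upair w s a a" using upair_exists assms by blast
  obtain t where t: "t \<in> obj w" "upair w t a b" using upair_exists assms by blast
  obtain s' where s': "s' \<in> obj w" "upair w s' x x" using upair_exists assms by blast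
  obtain t' where t': "t' \<in> obj w" "upair w t' x y" using upair_exists assms by blast
  have p1: "mem w z p \<longleftrightarrow> upair w z a a \<or> upair w z a b" if "z \<in> obj w" for z
    using assms(1) that unfolding opair_def by blast
  have p2: "mem w z p \<longleftrightarrow> upair w z x x \<or> upair w z x y" if "z \<in> obj w" for z
    using assms(2) that unfolding opair_def by blast
  have u: "mem w u z \<longleftrightarrow> eql w u c \<or> eql w u d" if "upair w z c d" for u z c d
    using that unfolding upair_def by blast
  have ax: "eql w a x"
    using p1[OF s(1)] p2[OF s(1)] s(2) u[of s] eql_refl[OF assms(5)] eql_sym by blast
  have 1: "eql w b x \<or> eql w b y"
    using p1[OF t(1)] p2[OF t(1)] t(2) u[of t] eql_refl[OF assms(4)] by blast
  have 2: "eql w y a \<or> eql w y b"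
    using p1[OF t'(1)] p2[OF t'(1)] t'(2) u[of t'] eql_refl[OF assms(6)] by blast
  from 1 2 ax have "eql w b y" using eql_sym eql_trans by blast
  with ax show ?thesis by blast
qed

lemma rl_eql: "rl w r x y \<Longrightarrow> eql w x x' \<Longrightarrow> eql w y y' \<Longrightarrow> rl w r x' y'"
  unfolding rl_def using opair_eql by blast

lemma isrel_rl:
  assumes "isrel w r A B" "rl w r x y" "x \<in> obj w" "y \<in> obj w"
  shows "mem w x A" "mem w y B"
proof -
  obtain p where p: "opair w p x y" "mem w p r" using assms(2) unfolding rl_def by blast
  then obtain a b where ab: "mem w a A" "mem w b B" "opair w p a b" using assms(1) unfolding isrel_def by blast
  then have "eql w a x \<and> eql w b y" using p assms mem_obj by (intro opair_inject) blast+
  with ab show "mem w x A" "mem w y B" using mem_eql1 by blast+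
qed

section \<open>Definability with parameters\<close>

definition mix :: "(nat \<Rightarrow> nat) \<Rightarrow> (nat \<Rightarrow> nat) \<Rightarrow> nat \<Rightarrow> nat" where
  "mix e p i = (if even i then e (i div 2) else p (i div 2))"

text \<open>Formulas with parameter sequences \<open>p\<close> and \<open>q\<close> are brought to
  the single sequence \<open>mix p q\<close>: parameter \<open>k\<close> moves from index
  \<open>2 * k + 1\<close> to \<open>4 * k + 1\<close>, respectively \<open>4 * k + 3\<close>.
  \<open>mix_cons\<close> adjusts indices under a binder, where the bound variable precedes the
  whole interleaved environment.\<close>

definition mix_fst :: "nat \<Rightarrow> nat" where "mix_fst i = (if even i then i else 4 * (i div 2) + 1)"
definition mix_snd :: "nat \<Rightarrow> nat" where "mix_snd i = (if even i then i else 4 * (i div 2) + 3)"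
definition mix_cons :: "nat \<Rightarrow> nat" where
  "mix_cons i = (if i = 0 then 0 else if even i then i - 1 else i + 1)"

lemma mix_mix_fst: "mix e (mix p q) (mix_fst i) = mix e p i"
  by (auto simp: mix_def mix_fst_def elim!: oddE)

lemma mix_mix_snd: "mix e (mix p q) (mix_snd i) = mix e q i"
proof -
  have "(4 * k + 3) div 2 = 2 * k + 1" for k :: nat by presburger
  then show ?thesis by (auto simp: mix_def mix_snd_def)
qed

lemma mix_mix_cons: "case_nat x (mix e p) (mix_cons i) = mix (case_nat x e) p i"
proof (cases "even i")
  case True
  then obtain k where k: "i = 2 * k" by blast
  show ?thesis
  proof (cases k)
    case (Suc l)
    have "(2 * l) div 2 = l" by simp
    with Suc k show ?thesis by (simp add: mix_def mix_cons_def)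
  qed (simp add: k mix_def mix_cons_def)
next
  case False
  then have "i \<noteq> 0" by (metis even_zero)
  with False show ?thesis by (simp add: mix_def mix_cons_def)
qed

lemma mix_obj: "(\<And>i. p i \<in> obj w) \<Longrightarrow> (\<And>i. q i \<in> obj w) \<Longrightarrow> mix p q i \<in> obj w"
  by (simp add: mix_def)

lemma restricted_rename: "restricted \<phi> \<Longrightarrow> restricted (rename f \<phi>)"
  by (induction arbitrary: f rule: restricted.induct) (auto intro: restricted.intros)

text \<open>In \<open>mix e p\<close> the even indices are the variables of a definable class and the odd ones its
  parameters, which are objects of the world \<open>w\<close>. The flag \<open>b\<close> demands a restricted formula, as
  needed for separation; without it, quantifiers over all objects are allowed.\<close>

definition definable :: "bool \<Rightarrow> world \<Rightarrow> (world \<Rightarrow> (nat \<Rightarrow> nat) \<Rightarrow> bool) \<Rightarrow> bool" where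
  "definable b w Q \<longleftrightarrow> (\<exists>\<phi> p. (b \<longrightarrow> restricted \<phi>) \<and> (\<forall>i. p i \<in> obj w) \<and>
     (\<forall>w'\<ge>w. \<forall>e. (\<forall>i. e i \<in> obj w') \<longrightarrow> (sat w' (mix e p) \<phi> \<longleftrightarrow> Q w' e)))"

text \<open>The language has no terms but variables, so \<open>t e\<close> must be read off at one
  fixed index: it is either a variable of \<open>e\<close> or a parameter.\<close>

definition tm :: "world \<Rightarrow> ((nat \<Rightarrow> nat) \<Rightarrow> nat) \<Rightarrow> bool" where
  "tm w t \<longleftrightarrow> (\<exists>k p. (\<forall>i. p i \<in> obj w) \<and> (\<forall>e. mix e p k = t e))"

lemma definableI:
  assumes "b \<Longrightarrow> restricted \<phi>" "\<And>i. p i \<in> obj w"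
    "\<And>w' e. w \<le> w' \<Longrightarrow> (\<And>i. e i \<in> obj w') \<Longrightarrow> sat w' (mix e p) \<phi> \<longleftrightarrow> Q w' e"
  shows "definable b w Q"
  unfolding definable_def using assms by (intro exI[of _ \<phi>] exI[of _ p]) auto

lemma definable_mono: "definable b w Q \<Longrightarrow> w \<le> w' \<Longrightarrow> definable b w' Q"
  unfolding definable_def by (meson obj_mono order_trans)

lemma definable_cong:
  assumes "definable b w P" "\<And>w' e. w \<le> w' \<Longrightarrow> (\<And>i. e i \<in> obj w') \<Longrightarrow> P w' e \<longleftrightarrow> Q w' e"
  shows "definable b w Q"
proof -
  obtain \<phi> p where *: "b \<longrightarrow> restricted \<phi>" "\<forall>i. p i \<in> obj w"
    "\<forall>w'\<ge>w. \<forall>e. (\<forall>i. e i \<in> obj w') \<longrightarrow> (sat w' (mix e p) \<phi> \<longleftrightarrow> P w' e)"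
    using assms(1) unfolding definable_def by blast
  show ?thesis by (rule definableI[of b \<phi> p]) (use * assms(2) in simp_all)
qed

text \<open>Persistence of \<open>Q\<close> is inherited from the formula that defines it. Together
  with \<open>definable_eql\<close> this spares separate proofs for each predicate.\<close>

lemma definable_persistent:
  assumes "definable b w Q" "w \<le> w'" "w' \<le> w''" "\<And>i. e i \<in> obj w'" "Q w' e"
  shows "Q w'' e"
proof -
  obtain \<phi> p where *: "\<And>w' e. w \<le> w' \<Longrightarrow> (\<forall>i. e i \<in> obj w') \<Longrightarrow> sat w' (mix e p) \<phi> \<longleftrightarrow> Q w' e"
    using assms(1) unfolding definable_def by blast
  have "sat w' (mix e p) \<phi>" using * assms by blast
  then have "sat w'' (mix e p) \<phi>" using assms(3) by (rule sat_mono)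
  then show ?thesis using * assms obj_mono order_trans by meson
qed

lemma definable_eql:
  assumes "definable b w Q" "w \<le> w'" "\<And>i. eql w' (e i) (e' i)" "Q w' e"
  shows "Q w' e'"
proof -
  obtain \<phi> p where p: "\<forall>i. p i \<in> obj w"
    and *: "\<And>w' e. w \<le> w' \<Longrightarrow> (\<forall>i. e i \<in> obj w') \<Longrightarrow> sat w' (mix e p) \<phi> \<longleftrightarrow> Q w' e"
    using assms(1) unfolding definable_def by blast
  have o: "\<forall>i. e i \<in> obj w'" "\<forall>i. e' i \<in> obj w'" using assms(3) eql_obj by blast+
  have "sat w' (mix e p) \<phi> \<longleftrightarrow> sat w' (mix e' p) \<phi>"
    using p assms(2,3) by (intro sat_eql) (auto simp: mix_def intro: eql_refl obj_mono)
  then show ?thesis using * o assms(2,4) by blast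
qed

lemma definable_shared:
  assumes "definable b w P" "definable b w Q"
  obtains \<phi> \<psi> p where "b \<longrightarrow> restricted \<phi>" "b \<longrightarrow> restricted \<psi>" "\<forall>i. p i \<in> obj w"
    "\<forall>w'\<ge>w. \<forall>e. (\<forall>i. e i \<in> obj w') \<longrightarrow> (sat w' (mix e p) \<phi> \<longleftrightarrow> P w' e)"
    "\<forall>w'\<ge>w. \<forall>e. (\<forall>i. e i \<in> obj w') \<longrightarrow> (sat w' (mix e p) \<psi> \<longleftrightarrow> Q w' e)"
proof -
  from assms obtain \<phi> p \<psi> q where *: "b \<longrightarrow> restricted \<phi>" "b \<longrightarrow> restricted \<psi>"
    "\<forall>i. p i \<in> obj w" "\<forall>i. q i \<in> obj w"
    "\<forall>w'\<ge>w. \<forall>e. (\<forall>i. e i \<in> obj w') \<longrightarrow> (sat w' (mix e p) \<phi> \<longleftrightarrow> P w' e)"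
    "\<forall>w'\<ge>w. \<forall>e. (\<forall>i. e i \<in> obj w') \<longrightarrow> (sat w' (mix e q) \<psi> \<longleftrightarrow> Q w' e)"
    unfolding definable_def by blast
  show thesis
    by (rule that[of "rename mix_fst \<phi>" "rename mix_snd \<psi>" "mix p q"])
      (use * in \<open>auto simp: sat_rename mix_mix_fst mix_mix_snd restricted_rename intro: mix_obj\<close>)
qed

lemma tm_shared:
  assumes "tm w s" "tm w t"
  obtains k l p where "\<forall>i. p i \<in> obj w" "\<forall>e. mix e p k = s e" "\<forall>e. mix e p l = t e"
proof -
  from assms obtain k p l q where *: "\<forall>i. p i \<in> obj w" "\<forall>i. q i \<in> obj w" "\<forall>e. mix e p k = s e" "\<forall>e. mix e q l = t e"
    unfolding tm_def by blast
  show thesis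
    by (rule that[of "mix p q" "mix_fst k" "mix_snd l"])
      (use * in \<open>auto simp: mix_mix_fst mix_mix_snd intro: mix_obj\<close>)
qed

lemma tm_const: "c \<in> obj w \<Longrightarrow> tm w (\<lambda>e. c)"
  unfolding tm_def by (intro exI[of _ 1] exI[of _ "\<lambda>_. c"]) (simp add: mix_def)

lemma tm_var: "tm w (\<lambda>e. e n)"
proof -
  obtain c where "c \<in> obj w" using omega_exists by blast
  then show ?thesis unfolding tm_def by (intro exI[of _ "2 * n"] exI[of _ "\<lambda>_. c"]) (simp add: mix_def)
qed

lemma tm_obj: "tm w t \<Longrightarrow> w \<le> w' \<Longrightarrow> (\<And>i. e i \<in> obj w') \<Longrightarrow> t e \<in> obj w'"
  unfolding tm_def using mix_obj obj_mono by metis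

lemma tm_shift: "tm w t \<Longrightarrow> tm w (\<lambda>e. t (\<lambda>i. e (Suc i)))"
proof -
  assume "tm w t"
  then obtain k p where *: "\<forall>i. p i \<in> obj w" "\<And>e. mix e p k = t e" unfolding tm_def by blast
  have "mix e p (if even k then k + 2 else k) = t (\<lambda>i. e (Suc i))" for e
    unfolding *(2)[symmetric] by (simp add: mix_def)
  with *(1) show ?thesis unfolding tm_def by blast
qed

lemma definable_mem:
  assumes "tm w s" "tm w t"
  shows "definable b w (\<lambda>w e. mem w (s e) (t e))"
proof -
  obtain k l p where *: "\<forall>i. p i \<in> obj w" "\<forall>e. mix e p k = s e" "\<forall>e. mix e p l = t e"
    by (rule tm_shared[OF assms])
  show ?thesis by (rule definableI[of b "Member k l" p]) (use * in \<open>simp_all add: restricted.intros\<close>)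
qed

lemma definable_eq:
  assumes "tm w s" "tm w t"
  shows "definable b w (\<lambda>w e. eql w (s e) (t e))"
proof -
  obtain k l p where *: "\<forall>i. p i \<in> obj w" "\<forall>e. mix e p k = s e" "\<forall>e. mix e p l = t e"
    by (rule tm_shared[OF assms])
  show ?thesis by (rule definableI[of b "Equal k l" p]) (use * in \<open>simp_all add: restricted.intros\<close>)
qed

lemma definable_conj:
  assumes "definable b w P" "definable b w Q"
  shows "definable b w (\<lambda>w e. P w e \<and> Q w e)"
proof -
  obtain \<phi> \<psi> p where *: "b \<longrightarrow> restricted \<phi>" "b \<longrightarrow> restricted \<psi>" "\<forall>i. p i \<in> obj w"
    "\<forall>w'\<ge>w. \<forall>e. (\<forall>i. e i \<in> obj w') \<longrightarrow> (sat w' (mix e p) \<phi> \<longleftrightarrow> P w' e)"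
    "\<forall>w'\<ge>w. \<forall>e. (\<forall>i. e i \<in> obj w') \<longrightarrow> (sat w' (mix e p) \<psi> \<longleftrightarrow> Q w' e)"
    by (rule definable_shared[OF assms])
  show ?thesis by (rule definableI[of b "Conj \<phi> \<psi>" p]) (use * in \<open>simp_all add: restricted.intros\<close>)
qed

lemma definable_disj:
  assumes "definable b w P" "definable b w Q"
  shows "definable b w (\<lambda>w e. P w e \<or> Q w e)"
proof -
  obtain \<phi> \<psi> p where *: "b \<longrightarrow> restricted \<phi>" "b \<longrightarrow> restricted \<psi>" "\<forall>i. p i \<in> obj w"
    "\<forall>w'\<ge>w. \<forall>e. (\<forall>i. e i \<in> obj w') \<longrightarrow> (sat w' (mix e p) \<phi> \<longleftrightarrow> P w' e)"
    "\<forall>w'\<ge>w. \<forall>e. (\<forall>i. e i \<in> obj w') \<longrightarrow> (sat w' (mix e p) \<psi> \<longleftrightarrow> Q w' e)"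
    by (rule definable_shared[OF assms])
  show ?thesis by (rule definableI[of b "Disj \<phi> \<psi>" p]) (use * in \<open>simp_all add: restricted.intros\<close>)
qed

lemma definable_imp:
  assumes "definable b w P" "definable b w Q"
  shows "definable b w (\<lambda>w e. \<forall>w'\<ge>w. P w' e \<longrightarrow> Q w' e)"
proof -
  obtain \<phi> \<psi> p where *: "b \<longrightarrow> restricted \<phi>" "b \<longrightarrow> restricted \<psi>" "\<forall>i. p i \<in> obj w"
    "\<forall>w'\<ge>w. \<forall>e. (\<forall>i. e i \<in> obj w') \<longrightarrow> (sat w' (mix e p) \<phi> \<longleftrightarrow> P w' e)"
    "\<forall>w'\<ge>w. \<forall>e. (\<forall>i. e i \<in> obj w') \<longrightarrow> (sat w' (mix e p) \<psi> \<longleftrightarrow> Q w' e)"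
    by (rule definable_shared[OF assms])
  show ?thesis
  proof (rule definableI[where \<phi> = "Impl \<phi> \<psi>" and p = p])
    fix w' and e :: "nat \<Rightarrow> nat" assume w': "w \<le> w'" "\<And>i. e i \<in> obj w'"
    have "sat w'' (mix e p) \<phi> \<longleftrightarrow> P w'' e" "sat w'' (mix e p) \<psi> \<longleftrightarrow> Q w'' e" if "w' \<le> w''" for w''
      using *(4,5) w' that obj_mono order_trans by blast+
    then show "sat w' (mix e p) (Impl \<phi> \<psi>) \<longleftrightarrow> (\<forall>w''\<ge>w'. P w'' e \<longrightarrow> Q w'' e)" by simp
  qed (use * in \<open>auto intro: restricted.intros\<close>)
qed

lemma definable_iff:
  assumes "definable b w P" "definable b w Q"
  shows "definable b w (\<lambda>w e. \<forall>w'\<ge>w. P w' e \<longleftrightarrow> Q w' e)"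
  by (rule definable_cong[OF definable_conj[OF definable_imp[OF assms] definable_imp[OF assms(2,1)]]]) auto

text \<open>Common preparation for the quantifier lemmas: the formula of \<open>P\<close> is
  rearranged so that index 0 is the bound variable, and the bound \<open>t\<close> shares its
  parameter sequence.\<close>

lemma definable_bounded:
  assumes "definable b w (\<lambda>w e. P w (\<lambda>i. e (Suc i)) (e 0))" "tm w t"
  obtains \<phi> k p where "b \<longrightarrow> restricted \<phi>" "\<forall>i. p i \<in> obj w" "\<forall>e. mix e p k = t e"
    "\<forall>w'\<ge>w. \<forall>e x. (\<forall>i. e i \<in> obj w') \<longrightarrow> x \<in> obj w' \<longrightarrow> (sat w' (case_nat x (mix e p)) \<phi> \<longleftrightarrow> P w' e x)"
proof -
  from assms obtain \<phi> p k q where *: "b \<longrightarrow> restricted \<phi>"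
    "\<forall>i. p i \<in> obj w" "\<forall>i. q i \<in> obj w" "\<forall>e. mix e q k = t e"
    "\<forall>w'\<ge>w. \<forall>e. (\<forall>i. e i \<in> obj w') \<longrightarrow> (sat w' (mix e p) \<phi> \<longleftrightarrow> P w' (\<lambda>i. e (Suc i)) (e 0))"
    unfolding definable_def tm_def by blast
  have "sat w' (case_nat x (mix e (mix p q))) (rename mix_cons (rename mix_fst \<phi>)) \<longleftrightarrow> P w' e x"
    if "w \<le> w'" "\<And>i. e i \<in> obj w'" "x \<in> obj w'" for w' e x
    using *(5)[rule_format, of w' "case_nat x e"] that
    by (simp add: sat_rename mix_mix_cons mix_mix_fst split: nat.splits)
  with * that[of "rename mix_cons (rename mix_fst \<phi>)" "mix p q" "mix_snd k"] show thesis
    by (simp add: restricted_rename mix_obj mix_mix_snd)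
qed

lemma definable_bex:
  assumes "definable b w (\<lambda>w e. P w (\<lambda>i. e (Suc i)) (e 0))" "tm w t"
  shows "definable b w (\<lambda>w e. \<exists>x. mem w x (t e) \<and> P w e x)"
proof -
  obtain \<phi> k p where *: "b \<longrightarrow> restricted \<phi>" "\<forall>i. p i \<in> obj w" "\<forall>e. mix e p k = t e"
    "\<forall>w'\<ge>w. \<forall>e x. (\<forall>i. e i \<in> obj w') \<longrightarrow> x \<in> obj w' \<longrightarrow> (sat w' (case_nat x (mix e p)) \<phi> \<longleftrightarrow> P w' e x)"
    by (rule definable_bounded[OF assms])
  show ?thesis
  proof (rule definableI[where \<phi> = "Exists (Conj (Member 0 (Suc k)) \<phi>)" and p = p])
    fix w' and e :: "nat \<Rightarrow> nat" assume w': "w \<le> w'" "\<And>i. e i \<in> obj w'"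
    then show "sat w' (mix e p) (Exists (Conj (Member 0 (Suc k)) \<phi>)) \<longleftrightarrow> (\<exists>x. mem w' x (t e) \<and> P w' e x)"
      using *(3,4) mem_obj by auto
  qed (use * in \<open>auto intro: restricted.intros\<close>)
qed

lemma definable_ball:
  assumes "definable b w (\<lambda>w e. P w (\<lambda>i. e (Suc i)) (e 0))" "tm w t"
  shows "definable b w (\<lambda>w e. \<forall>w'\<ge>w. \<forall>x. mem w' x (t e) \<longrightarrow> P w' e x)"
proof -
  obtain \<phi> k p where *: "b \<longrightarrow> restricted \<phi>" "\<forall>i. p i \<in> obj w" "\<forall>e. mix e p k = t e"
    "\<forall>w'\<ge>w. \<forall>e x. (\<forall>i. e i \<in> obj w') \<longrightarrow> x \<in> obj w' \<longrightarrow> (sat w' (case_nat x (mix e p)) \<phi> \<longleftrightarrow> P w' e x)"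
    by (rule definable_bounded[OF assms])
  show ?thesis
  proof (rule definableI[where \<phi> = "Forall (Impl (Member 0 (Suc k)) \<phi>)" and p = p])
    fix w' and e :: "nat \<Rightarrow> nat" assume w': "w \<le> w'" "\<And>i. e i \<in> obj w'"
    have "sat w'' (case_nat x (mix e p)) \<phi> \<longleftrightarrow> P w'' e x" if "w' \<le> w''" "mem w'' x (t e)" for w'' x
      using *(4) w' that mem_obj obj_mono order_trans by meson
    then show "sat w' (mix e p) (Forall (Impl (Member 0 (Suc k)) \<phi>)) \<longleftrightarrow> (\<forall>w''\<ge>w'. \<forall>x. mem w'' x (t e) \<longrightarrow> P w'' e x)"
      by (simp add: collapse_forcing *(3) bounded_obj cong: imp_cong)
  qed (use * in \<open>auto intro: restricted.intros\<close>)
qed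

lemma definable_all:
  assumes "definable False w (\<lambda>w e. P w (\<lambda>i. e (Suc i)) (e 0))"
  shows "definable False w (\<lambda>w e. \<forall>w'\<ge>w. \<forall>x\<in>obj w'. P w' e x)"
proof -
  from definable_bounded[OF assms tm_var] obtain \<phi> p where *: "\<forall>i. p i \<in> obj w"
    "\<forall>w'\<ge>w. \<forall>e x. (\<forall>i. e i \<in> obj w') \<longrightarrow> x \<in> obj w' \<longrightarrow> (sat w' (case_nat x (mix e p)) \<phi> \<longleftrightarrow> P w' e x)"
    by metis
  show ?thesis
  proof (rule definableI[where \<phi> = "Forall \<phi>" and p = p])
    fix w' and e :: "nat \<Rightarrow> nat" assume w': "w \<le> w'" "\<And>i. e i \<in> obj w'"
    have "sat w'' (case_nat x (mix e p)) \<phi> \<longleftrightarrow> P w'' e x" if "w' \<le> w''" "x \<in> obj w''" for w'' x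
      using *(2) w' that obj_mono order_trans by meson
    then show "sat w' (mix e p) (Forall \<phi>) \<longleftrightarrow> (\<forall>w''\<ge>w'. \<forall>x\<in>obj w''. P w'' e x)" by simp
  qed (use * in auto)
qed

lemma definable_incl: "tm w s \<Longrightarrow> tm w t \<Longrightarrow> definable b w (\<lambda>w e. incl w (s e) (t e))"
  unfolding incl_def by (intro definable_ball definable_mem tm_var tm_shift)

text \<open>In \<open>upair\<close> the element \<open>u\<close> ranges over everything. A
  restricted formula is obtained by asking that both components are elements and that every element
  is one of them.\<close>

lemma definable_upair:
  assumes "tm w r" "tm w s" "tm w t"
  shows "definable b w (\<lambda>w e. upair w (r e) (s e) (t e))"
proof (rule definable_cong)
  show "definable b w (\<lambda>w e. mem w (s e) (r e) \<and> mem w (t e) (r e) \<and>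
      (\<forall>w'\<ge>w. \<forall>u. mem w' u (r e) \<longrightarrow> eql w' u (s e) \<or> eql w' u (t e)))"
    by (intro definable_conj definable_ball definable_disj definable_mem definable_eq tm_var tm_shift assms)
  fix w' and e :: "nat \<Rightarrow> nat" assume *: "w \<le> w'" "\<And>i. e i \<in> obj w'"
  then have "s e \<in> obj w'" "t e \<in> obj w'" using assms tm_obj by blast+
  then show "mem w' (s e) (r e) \<and> mem w' (t e) (r e) \<and>
      (\<forall>w''\<ge>w'. \<forall>u. mem w'' u (r e) \<longrightarrow> eql w'' u (s e) \<or> eql w'' u (t e)) \<longleftrightarrow> upair w' (r e) (s e) (t e)"
    unfolding upair_def using eql_refl mem_mono mem_eql1 eql_sym by (meson order_refl)
qed

text \<open>The same idea one level up: the singleton and the unordered pair occur among the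
  elements of the ordered pair, and every element is one of the two.\<close>

lemma definable_opair:
  assumes "tm w r" "tm w s" "tm w t"
  shows "definable b w (\<lambda>w e. opair w (r e) (s e) (t e))"
proof (rule definable_cong)
  show "definable b w (\<lambda>w e. (\<exists>z. mem w z (r e) \<and> upair w z (s e) (s e)) \<and> (\<exists>z. mem w z (r e) \<and> upair w z (s e) (t e)) \<and>
      (\<forall>w'\<ge>w. \<forall>z. mem w' z (r e) \<longrightarrow> upair w' z (s e) (s e) \<or> upair w' z (s e) (t e)))"
    by (intro definable_conj definable_ball definable_bex definable_disj definable_upair tm_var tm_shift assms)
  fix w' and e :: "nat \<Rightarrow> nat" assume *: "w \<le> w'" "\<And>i. e i \<in> obj w'"
  then have o: "s e \<in> obj w'" "t e \<in> obj w'" using assms tm_obj by blast+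
  show "(\<exists>z. mem w' z (r e) \<and> upair w' z (s e) (s e)) \<and> (\<exists>z. mem w' z (r e) \<and> upair w' z (s e) (t e)) \<and>
      (\<forall>w''\<ge>w'. \<forall>z. mem w'' z (r e) \<longrightarrow> upair w'' z (s e) (s e) \<or> upair w'' z (s e) (t e)) \<longleftrightarrow> opair w' (r e) (s e) (t e)"
    (is "?L \<longleftrightarrow> ?R")
  proof
    assume L: ?L
    then obtain y z where yz: "mem w' y (r e)" "upair w' y (s e) (s e)" "mem w' z (r e)" "upair w' z (s e) (t e)" by blast
    have "mem w'' u (r e)" if "w' \<le> w''" "u \<in> obj w''" "upair w'' u (s e) (s e) \<or> upair w'' u (s e) (t e)" for w'' u
      using yz that upair_mono mem_mono mem_obj upair_unique mem_eql1 by metis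
    with L show ?R unfolding opair_def by blast
  next
    assume R: ?R
    obtain y z where "y \<in> obj w'" "upair w' y (s e) (s e)" "z \<in> obj w'" "upair w' z (s e) (t e)"
      using upair_exists o by metis
    with R show ?L unfolding opair_def using mem_obj by blast
  qed
qed

lemma definable_rl:
  assumes "tm w r" "tm w s" "tm w t"
  shows "definable b w (\<lambda>w e. rl w (r e) (s e) (t e))"
proof (rule definable_cong)
  show "definable b w (\<lambda>w e. \<exists>p. mem w p (r e) \<and> opair w p (s e) (t e))"
    by (intro definable_bex definable_opair tm_var tm_shift assms)
qed (auto simp: rl_def)

lemmas definable_intros = definable_conj definable_disj definable_imp definable_bex definable_ball
  definable_mem definable_eq definable_incl definable_opair definable_rl tm_var tm_const tm_shift

lemma definable_rename: "definable b w P \<Longrightarrow> definable b w (\<lambda>w e. P w (\<lambda>n. e (f n)))"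
proof -
  assume "definable b w P"
  then obtain \<phi> p where *: "b \<longrightarrow> restricted \<phi>" "\<forall>i. p i \<in> obj w"
    "\<forall>w'\<ge>w. \<forall>e. (\<forall>i. e i \<in> obj w') \<longrightarrow> (sat w' (mix e p) \<phi> \<longleftrightarrow> P w' e)"
    unfolding definable_def by blast
  let ?h = "\<lambda>i. if even i then 2 * f (i div 2) else i"
  have "mix e p (?h i) = mix (\<lambda>n. e (f n)) p i" for e i by (simp add: mix_def)
  with * show ?thesis
    by (intro definableI[of b "rename ?h \<phi>" p]) (simp_all add: restricted_rename sat_rename)
qed

section \<open>Separation, Replacement and the sets obtained from them\<close>

lemma separation_exists:
  assumes "definable True w (\<lambda>w e. Q w (e 0))" "a \<in> obj w"
  obtains b where "b \<in> obj w" "\<And>w' x. w \<le> w' \<Longrightarrow> mem w' x b \<longleftrightarrow> mem w' x a \<and> Q w' x"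
proof -
  from assms(1) obtain \<phi> p where *: "restricted \<phi>" "\<forall>i. p i \<in> obj w"
    "\<forall>w'\<ge>w. \<forall>e. (\<forall>i. e i \<in> obj w') \<longrightarrow> (sat w' (mix e p) \<phi> \<longleftrightarrow> Q w' (e 0))"
    unfolding definable_def by blast
  \<comment> \<open>\<open>Q\<close> depends on \<open>e 0\<close> alone, so all variables may be
    identified with the separated element at index 0; the parameters follow it.\<close>
  let ?h = "\<lambda>i. if even i then 0 else Suc (i div 2)"
  have h: "(\<lambda>i. case_nat x p (?h i)) = mix (\<lambda>_. x) p" for x by (auto simp: mix_def fun_eq_iff)
  have eq: "sat w' (case_nat x p) (rename ?h \<phi>) \<longleftrightarrow> Q w' x" if "w \<le> w'" "x \<in> obj w'" for w' x
    using *(3) that by (simp add: sat_rename h)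
  have q: "p i \<in> obj w" for i using *(2) by blast
  obtain b where b: "b \<in> obj w"
    "\<And>w' x. w \<le> w' \<Longrightarrow> mem w' x b \<longleftrightarrow> mem w' x a \<and> sat w' (case_nat x p) (rename ?h \<phi>)"
    by (rule separation_sat[OF restricted_rename[OF *(1)] q assms(2)]) (rule that)
  show thesis
    by (rule that[OF b(1)]) (use b(2) eq mem_obj in blast)
qed

lemma replacement_exists:
  assumes "definable False w (\<lambda>w e. Q w (e 0) (e 1))" "a \<in> obj w"
    "\<And>w' x. w \<le> w' \<Longrightarrow> mem w' x a \<Longrightarrow> \<exists>y\<in>obj w'. Q w' x y \<and> (\<forall>w''\<ge>w'. \<forall>y'\<in>obj w''. Q w'' x y' \<longrightarrow> eql w'' y' y)"
  obtains b where "b \<in> obj w"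
    "\<And>w' y. w \<le> w' \<Longrightarrow> y \<in> obj w' \<Longrightarrow> mem w' y b \<longleftrightarrow> (\<exists>x. mem w' x a \<and> Q w' x y)"
proof -
  from assms(1) obtain \<phi> p where *: "\<forall>i. p i \<in> obj w"
    "\<forall>w'\<ge>w. \<forall>e. (\<forall>i. e i \<in> obj w') \<longrightarrow> (sat w' (mix e p) \<phi> \<longleftrightarrow> Q w' (e 0) (e 1))"
    unfolding definable_def by blast
  \<comment> \<open>Index 2 is the variable \<open>e 1\<close>, that is the value \<open>y\<close>;
    every other even index may read the argument \<open>x\<close>.\<close>
  let ?h = "\<lambda>i. if even i then (if i = 2 then 1 else 0) else i div 2 + 2"
  have h: "(\<lambda>i. case_nat x (case_nat y p) (?h i)) = mix (\<lambda>n. if n = 1 then y else x) p" for x y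
    by (auto simp: mix_def fun_eq_iff elim!: evenE)
  have eq: "sat w' (case_nat x (case_nat y p)) (rename ?h \<phi>) \<longleftrightarrow> Q w' x y"
    if "w \<le> w'" "x \<in> obj w'" "y \<in> obj w'" for w' x y
    using *(2) that unfolding sat_rename h by simp
  have ex: "\<exists>y\<in>obj w'. sat w' (case_nat x (case_nat y p)) (rename ?h \<phi>) \<and>
      (\<forall>w''\<ge>w'. \<forall>y'\<in>obj w''. sat w'' (case_nat x (case_nat y' p)) (rename ?h \<phi>) \<longrightarrow> eql w'' y' y)"
    if w': "w \<le> w'" "mem w' x a" for w' x
  proof -
    have x: "x \<in> obj w''" if "w' \<le> w''" for w'' using w' that mem_obj obj_mono by blast
    from assms(3)[OF w'] obtain y where y: "y \<in> obj w'" "Q w' x y" "\<forall>w''\<ge>w'. \<forall>y'\<in>obj w''. Q w'' x y' \<longrightarrow> eql w'' y' y"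
      by blast
    have "sat w'' (case_nat x (case_nat y' p)) (rename ?h \<phi>) \<longleftrightarrow> Q w'' x y'" if "w' \<le> w''" "y' \<in> obj w''" for w'' y'
      using eq[OF order_trans[OF w'(1) that(1)] x[OF that(1)] that(2)] .
    with y show ?thesis by (intro bexI[of _ y]) auto
  qed
  have q: "p i \<in> obj w" for i using *(1) by blast
  obtain b where b: "b \<in> obj w" "\<And>w' y. w \<le> w' \<Longrightarrow> y \<in> obj w' \<Longrightarrow>
      mem w' y b \<longleftrightarrow> (\<exists>x. mem w' x a \<and> sat w' (case_nat x (case_nat y p)) (rename ?h \<phi>))"
    by (rule replacement_sat[OF q assms(2) ex]) (assumption, assumption, rule that)
  show thesis
    by (rule that[OF b(1)]) (use b(2) eq mem_obj in blast)
qed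

text \<open>Extensionality makes the set of all \<open>z\<close> with \<open>Q i z\<close> unique
  once it exists, so Replacement applies to the assignment of this set to \<open>i\<close>. The
  formula describing the set quantifies over all \<open>z\<close>, hence the flag
  \<open>False\<close>.\<close>

lemma family_exists:
  assumes "definable False w (\<lambda>w e. Q w (e 0) (e 1))" "I \<in> obj w"
    "\<And>w' i. w \<le> w' \<Longrightarrow> mem w' i I \<Longrightarrow> \<exists>y\<in>obj w'. \<forall>w''\<ge>w'. \<forall>z\<in>obj w''. mem w'' z y \<longleftrightarrow> Q w'' i z"
  obtains G where "G \<in> obj w"
    "\<And>w' y. w \<le> w' \<Longrightarrow> y \<in> obj w' \<Longrightarrow> mem w' y G \<longleftrightarrow>
      (\<exists>i. mem w' i I \<and> (\<forall>w''\<ge>w'. \<forall>z\<in>obj w''. mem w'' z y \<longleftrightarrow> Q w'' i z))"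
proof (rule replacement_exists[where Q = "\<lambda>w i y. \<forall>w'\<ge>w. \<forall>z\<in>obj w'. mem w' z y \<longleftrightarrow> Q w' i z" and w = w and a = I])
  have "definable False w (\<lambda>w e. Q w (e 1) (e 0))"
    using definable_rename[OF assms(1), of "\<lambda>n. if n = 0 then 1 else 0"] by simp
  then have "definable False w (\<lambda>w e. \<forall>w'\<ge>w. mem w' (e 0) (e 2) \<longleftrightarrow> Q w' (e 1) (e 0))"
    by (intro definable_iff definable_mem tm_var)
  then have "definable False w (\<lambda>w e. \<forall>w'\<ge>w. \<forall>z\<in>obj w'. \<forall>w''\<ge>w'. mem w'' z (e 1) \<longleftrightarrow> Q w'' (e 0) z)"
    by (intro definable_all) (simp add: numeral_2_eq_2)
  then show "definable False w (\<lambda>w e. \<forall>w'\<ge>w. \<forall>z\<in>obj w'. mem w' z (e 1) \<longleftrightarrow> Q w' (e 0) z)"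
    by (simp only: collapse_forcing)
  show "\<exists>y\<in>obj w'. (\<forall>w''\<ge>w'. \<forall>z\<in>obj w''. mem w'' z y \<longleftrightarrow> Q w'' i z) \<and>
      (\<forall>w''\<ge>w'. \<forall>y'\<in>obj w''. (\<forall>w'''\<ge>w''. \<forall>z\<in>obj w'''. mem w''' z y' \<longleftrightarrow> Q w''' i z) \<longrightarrow> eql w'' y' y)"
    if w': "w \<le> w'" "mem w' i I" for w' i
  proof -
    obtain y where y: "y \<in> obj w'" "\<forall>w''\<ge>w'. \<forall>z\<in>obj w''. mem w'' z y \<longleftrightarrow> Q w'' i z"
      using assms(3)[OF w'] by blast
    have "eql w'' y' y" if w'': "w' \<le> w''" "y' \<in> obj w''" "\<forall>w'''\<ge>w''. \<forall>z\<in>obj w'''. mem w''' z y' \<longleftrightarrow> Q w''' i z" for w'' y'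
    proof -
      have "mem v z y' \<longleftrightarrow> mem v z y" if "w'' \<le> v" for v z
        using y(2) w'' that order_trans[OF w''(1) that] mem_obj by blast
      with w'' y(1) obj_mono show ?thesis by (simp add: eql_iff_mem)
    qed
    with y show ?thesis by blast
  qed
qed (use assms(2) that in auto)

text \<open>Without power sets there is no larger set from which to separate the product.
  Replacement on \<open>B\<close> gives the pairs with a fixed first component, Replacement on
  \<open>A\<close> the family of these sets, and Union the product.\<close>

lemma product_exists:
  assumes "A \<in> obj w" "B \<in> obj w"
  obtains P where "P \<in> obj w"
    "\<And>w' p. w \<le> w' \<Longrightarrow> p \<in> obj w' \<Longrightarrow> mem w' p P \<longleftrightarrow> (\<exists>a b. mem w' a A \<and> mem w' b B \<and> opair w' p a b)"
proof -
  have "\<exists>y\<in>obj w'. \<forall>w''\<ge>w'. \<forall>p\<in>obj w''. mem w'' p y \<longleftrightarrow> (\<exists>b. mem w'' b B \<and> opair w'' p a b)"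
    if w': "w \<le> w'" "mem w' a A" for w' a
  proof -
    have a: "a \<in> obj w''" if "w' \<le> w''" for w'' using w' that mem_obj obj_mono by blast
    have B: "B \<in> obj w'" using assms w' obj_mono by blast
    have 1: "definable False w' (\<lambda>w e. opair w (e 1) a (e 0))"
      using a by (intro definable_intros) simp
    have 2: "\<exists>p\<in>obj v. opair v p a b \<and> (\<forall>v'\<ge>v. \<forall>p'\<in>obj v'. opair v' p' a b \<longrightarrow> eql v' p' p)"
      if vb: "w' \<le> v" "mem v b B" for v b
    proof -
      obtain p where "p \<in> obj v" "opair v p a b"
        by (rule opair_exists[OF a[OF vb(1)] mem_obj(1)[OF vb(2)]])
      then show ?thesis using opair_unique opair_mono obj_mono by blast
    qed
    obtain y where "y \<in> obj w'" "\<And>v p. w' \<le> v \<Longrightarrow> p \<in> obj v \<Longrightarrow> mem v p y \<longleftrightarrow> (\<exists>b. mem v b B \<and> opair v p a b)"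
      by (rule replacement_exists[where Q = "\<lambda>w b p. opair w p a b", OF 1 B 2]) (assumption, assumption, rule that)
    then show ?thesis by blast
  qed
  note inner = this
  have "definable False w (\<lambda>w e. \<exists>b. mem w b B \<and> opair w (e 1) (e 0) b)"
    using assms by (intro definable_intros)
  note outer = family_exists[where Q = "\<lambda>w a p. \<exists>b. mem w b B \<and> opair w p a b", OF this assms(1) inner]
  obtain G where G: "G \<in> obj w" "\<And>w' y. w \<le> w' \<Longrightarrow> y \<in> obj w' \<Longrightarrow> mem w' y G \<longleftrightarrow>
      (\<exists>a. mem w' a A \<and> (\<forall>w''\<ge>w'. \<forall>p\<in>obj w''. mem w'' p y \<longleftrightarrow> (\<exists>b. mem w'' b B \<and> opair w'' p a b)))"
    by (rule outer) (assumption, assumption, rule that)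
  obtain P where P: "P \<in> obj w" "\<And>w' x. w \<le> w' \<Longrightarrow> mem w' x P \<longleftrightarrow> (\<exists>y. mem w' y G \<and> mem w' x y)"
    by (rule union_exists[OF G(1)]) (rule that)
  show thesis
  proof (rule that[OF P(1)])
    fix w' p assume w': "w \<le> w'" "p \<in> obj w'"
    show "mem w' p P \<longleftrightarrow> (\<exists>a b. mem w' a A \<and> mem w' b B \<and> opair w' p a b)"
    proof
      assume "mem w' p P"
      then obtain y where "mem w' y G" "mem w' p y" using P w' by blast
      moreover from this have "y \<in> obj w'" using mem_obj by blast
      ultimately show "\<exists>a b. mem w' a A \<and> mem w' b B \<and> opair w' p a b" using G(2) w' by blast
    next
      assume "\<exists>a b. mem w' a A \<and> mem w' b B \<and> opair w' p a b"
      then obtain a b where ab: "mem w' a A" "mem w' b B" "opair w' p a b" by blast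
      from inner[OF w'(1) ab(1)]
      obtain y where y: "y \<in> obj w'" "\<forall>w''\<ge>w'. \<forall>p\<in>obj w''. mem w'' p y \<longleftrightarrow> (\<exists>b. mem w'' b B \<and> opair w'' p a b)"
        by blast
      have "mem w' y G" using G(2)[OF w'(1) y(1)] ab(1) y(2) by blast
      moreover have "mem w' p y" using y(2) w'(2) ab by blast
      ultimately show "mem w' p P" using P w' by blast
    qed
  qed
qed

lemma relation_exists:
  assumes "definable True w (\<lambda>w e. Q w (e 0) (e 1))" "A \<in> obj w" "B \<in> obj w"
  obtains r where "r \<in> obj w" "isrel w r A B"
    "\<And>w' x y. w \<le> w' \<Longrightarrow> x \<in> obj w' \<Longrightarrow> y \<in> obj w' \<Longrightarrow> rl w' r x y \<longleftrightarrow> mem w' x A \<and> mem w' y B \<and> Q w' x y"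
proof -
  obtain P where P: "P \<in> obj w"
    "\<And>w' p. w \<le> w' \<Longrightarrow> p \<in> obj w' \<Longrightarrow> mem w' p P \<longleftrightarrow> (\<exists>a b. mem w' a A \<and> mem w' b B \<and> opair w' p a b)"
    by (rule product_exists[OF assms(2,3)]) (rule that)
  have "definable True w (\<lambda>w e. Q w (e 1) (e 0))"
    using definable_rename[OF assms(1), of "\<lambda>n. if n = 0 then 1 else 0"] by simp
  then have "definable True w (\<lambda>w e. \<exists>x. mem w x A \<and> (\<exists>y. mem w y B \<and> opair w (e 0) x y \<and> Q w x y))"
    using assms(2,3) by (intro definable_intros) (simp_all)
  note sep = separation_exists[OF this P(1)]
  obtain r where r: "r \<in> obj w"
    "\<And>w' p. w \<le> w' \<Longrightarrow> mem w' p r \<longleftrightarrow> mem w' p P \<and> (\<exists>x. mem w' x A \<and> (\<exists>y. mem w' y B \<and> opair w' p x y \<and> Q w' x y))"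
    by (rule sep) (rule that)
  have Qeql: "Q w' x' y'" if "w \<le> w'" "eql w' x x'" "eql w' y y'" "Q w' x y" for w' x x' y y'
    using definable_eql[OF assms(1) that(1), of "\<lambda>n. if n = 0 then x else y" "\<lambda>n. if n = 0 then x' else y'"] that
    by simp
  show thesis
  proof (rule that[OF r(1)])
    show "isrel w r A B" unfolding isrel_def using r(2) by blast
    fix w' x y assume w': "w \<le> w'" "x \<in> obj w'" "y \<in> obj w'"
    show "rl w' r x y \<longleftrightarrow> mem w' x A \<and> mem w' y B \<and> Q w' x y"
    proof
      assume "rl w' r x y"
      then obtain p where p: "opair w' p x y" "mem w' p r" unfolding rl_def by blast
      then obtain a b where ab: "mem w' a A" "mem w' b B" "opair w' p a b" "Q w' a b" using r(2) w' by blast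
      then have "eql w' a x" "eql w' b y" using p w' opair_inject mem_obj by metis+
      with ab Qeql w' mem_eql1 show "mem w' x A \<and> mem w' y B \<and> Q w' x y" by blast
    next
      assume *: "mem w' x A \<and> mem w' y B \<and> Q w' x y"
      obtain p where p: "p \<in> obj w'" "opair w' p x y" using opair_exists[OF w'(2,3)] .
      then show "rl w' r x y" unfolding rl_def using * P(2) r(2) w' by blast
    qed
  qed
qed

section \<open>Finitely enumerable sets\<close>

text \<open>Deductive closure puts every atomic formula over its variables into an inconsistent
  theory.\<close>

lemma absurd_atoms:
  assumes "absurd w" "x \<in> obj w" "y \<in> obj w"
  shows "mem w x y" "eql w x y"
  using assms Rep_world_closed[of w "Member x y"] Rep_world_closed[of w "Equal x y"]
  by (auto simp: absurd_def mem_def eql_def intro: proves.FalsumE proves.assumption)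

lemma absurd_upair: "absurd w \<Longrightarrow> p \<in> obj w \<Longrightarrow> a \<in> obj w \<Longrightarrow> upair w p a b"
  unfolding upair_def by (meson absurd_atoms absurd_mono eql_obj mem_obj obj_mono)

lemma absurd_opair:
  assumes "absurd w" "p \<in> obj w" "a \<in> obj w"
  shows "opair w p a b"
  unfolding opair_def
proof (intro allI impI ballI)
  fix w' z assume w': "w \<le> w'" "z \<in> obj w'"
  then have "absurd w'" "p \<in> obj w'" "a \<in> obj w'" using assms absurd_mono obj_mono by blast+
  with w' show "mem w' z p \<longleftrightarrow> upair w' z a a \<or> upair w' z a b" using absurd_atoms absurd_upair by blast
qed

lemma absurd_incl:
  assumes "absurd w" "y \<in> obj w"
  shows "incl w x y"
  unfolding incl_def
proof (intro allI impI)
  fix w' z assume *: "w \<le> w'" "mem w' z x"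
  show "mem w' z y"
    by (rule absurd_atoms(1)[OF absurd_mono[OF assms(1) *(1)] mem_obj(1)[OF *(2)] obj_mono[OF assms(2) *(1)]])
qed

lemma definable_absurd: "definable b w (\<lambda>w e. absurd w)"
proof -
  obtain c where "c \<in> obj w" using omega_exists by blast
  then show ?thesis by (intro definableI[of b Falsum "\<lambda>_. c"]) (simp_all add: restricted.intros)
qed

lemma definable_ex:
  assumes "definable False w (\<lambda>w e. P w (\<lambda>i. e (Suc i)) (e 0))"
  shows "definable False w (\<lambda>w e. \<exists>x\<in>obj w. P w e x)"
proof -
  from definable_bounded[OF assms tm_var] obtain \<phi> p where *: "\<forall>i. p i \<in> obj w"
    "\<forall>w'\<ge>w. \<forall>e x. (\<forall>i. e i \<in> obj w') \<longrightarrow> x \<in> obj w' \<longrightarrow> (sat w' (case_nat x (mix e p)) \<phi> \<longleftrightarrow> P w' e x)"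
    by metis
  show ?thesis by (rule definableI[of False "Exists \<phi>" p]) (use * in auto)
qed

lemma definable_isrel:
  assumes "tm w r" "tm w s" "tm w t"
  shows "definable b w (\<lambda>w e. isrel w (r e) (s e) (t e))"
proof (rule definable_cong)
  show "definable b w (\<lambda>w e. \<forall>w'\<ge>w. \<forall>p. mem w' p (r e) \<longrightarrow>
      (\<exists>x. mem w' x (s e) \<and> (\<exists>y. mem w' y (t e) \<and> opair w' p x y)))"
    by (intro definable_intros assms)
qed (auto simp: isrel_def)

lemma definable_isfun:
  assumes "tm w r" "tm w s" "tm w t"
  shows "definable False w (\<lambda>w e. isfun w (r e) (s e) (t e))"
proof -
  have "definable False w (\<lambda>w e. isrel w (r e) (s e) (t e) \<and> (\<forall>w'\<ge>w. \<forall>x. mem w' x (s e) \<longrightarrow>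
     (\<exists>y\<in>obj w'. rl w' (r e) x y \<and> (\<forall>w''\<ge>w'. \<forall>y'\<in>obj w''. \<forall>w'''\<ge>w''. rl w''' (r e) x y' \<longrightarrow> eql w''' y' y))))"
    by (intro definable_intros definable_isrel definable_ex definable_all assms)
  then show ?thesis unfolding isfun_def collapse_forcing .
qed

text \<open>The elements of \<open>o'\<close> satisfying \<open>Q\<close> form an inductive set, to
  which leastness of \<open>o'\<close> applies. This set comes from Separation, hence the restricted
  definability of \<open>Q\<close>.\<close>

lemma omega_induct:
  assumes "omega w o'" "o' \<in> obj w" "definable True w (\<lambda>w e. Q w (e 0))"
    "\<And>w' z. w \<le> w' \<Longrightarrow> mem w' z o' \<Longrightarrow> empt w' z \<Longrightarrow> Q w' z"
    "\<And>w' n m. w \<le> w' \<Longrightarrow> mem w' n o' \<Longrightarrow> mem w' m o' \<Longrightarrow> Q w' n \<Longrightarrow> succ w' m n \<Longrightarrow> Q w' m"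
    "w \<le> w'" "mem w' n o'"
  shows "Q w' n"
proof -
  obtain b where b: "b \<in> obj w" "\<And>w' x. w \<le> w' \<Longrightarrow> mem w' x b \<longleftrightarrow> mem w' x o' \<and> Q w' x"
    by (rule separation_exists[OF assms(3,2)]) (rule that)
  have o: "induc w o'" using assms(1) by (simp add: omega_def)
  have "induc w b"
    unfolding induc_def
  proof (intro conjI allI impI)
    from o obtain z where "mem w z o'" "empt w z" unfolding induc_def by blast
    then show "\<exists>z. mem w z b \<and> empt w z" using b assms(4) by blast
    fix w' n assume *: "w \<le> w'" "mem w' n b"
    then have n: "mem w' n o'" "Q w' n" using b by blast+
    with o * obtain m where "mem w' m o'" "succ w' m n" unfolding induc_def by blast
    with n * b assms(5) show "\<exists>m. mem w' m b \<and> succ w' m n" by blast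
  qed
  then have "incl w o' b" using assms(1) b(1) unfolding omega_def by blast
  then show ?thesis using assms(6,7) b(2) unfolding incl_def by blast
qed

lemma omega_unique: "omega w m \<Longrightarrow> omega w n \<Longrightarrow> m \<in> obj w \<Longrightarrow> n \<in> obj w \<Longrightarrow> incl w m n"
  unfolding omega_def by blast

lemma omega_obj: "omega w n \<Longrightarrow> n \<in> obj w"
  unfolding omega_def using induc_obj by blast

text \<open>There is no foundation axiom, so \<open>n \<notin> n\<close> is proved by induction,
  strengthened by transitivity of \<open>n\<close>: if the successor \<open>m\<close> of
  \<open>n\<close> is in itself, then \<open>m \<in> n\<close> or \<open>m = n\<close>, and either
  way \<open>n \<in> n\<close>.\<close>

lemma omega_mem_irrefl:
  assumes "omega w o'" "mem w n o'" "w \<le> w'" "mem w' n n"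
  shows "absurd w'"
proof -
  let ?Q = "\<lambda>w n. (\<forall>w'\<ge>w. \<forall>i. mem w' i n \<longrightarrow> incl w' i n) \<and> (\<forall>w'\<ge>w. mem w' n n \<longrightarrow> absurd w')"
  have "?Q w n"
  proof (rule omega_induct[where Q = ?Q, OF assms(1) omega_obj[OF assms(1)] _ _ _ order_refl assms(2)])
    show "definable True w (\<lambda>w e. ?Q w (e 0))" by (intro definable_intros definable_absurd)
  next
    fix v z assume z: "w \<le> v" "mem v z o'" "empt v z"
    have "incl v' i z" if "v \<le> v'" "mem v' i z" for v' i
    proof -
      have "absurd v'" using z that unfolding empt_def by blast
      then show ?thesis using that mem_obj(2) by (intro absurd_incl)
    qed
    with z show "?Q v z" unfolding empt_def by blast
  next
    fix v n m assume n: "w \<le> v" "mem v n o'" "?Q v n" and m: "succ v m n"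
    have m': "mem v' u m \<longleftrightarrow> mem v' u n \<or> eql v' u n" if "v \<le> v'" for v' u
      using m that unfolding succ_def by blast
    have nm: "mem v' n m" if "v \<le> v'" for v'
      using m'[OF that] eql_refl mem_obj(1)[OF mem_mono[OF n(2) that]] by blast
    have "incl v' i m" if v': "v \<le> v'" "mem v' i m" for v' i
      unfolding incl_def
    proof (intro allI impI)
      fix v'' u assume u: "v' \<le> v''" "mem v'' u i"
      then have v'': "v \<le> v''" and i: "mem v'' i m" using v' mem_mono order_trans by blast+
      then have "mem v'' i n \<or> eql v'' i n" using m' by blast
      then have "mem v'' u n" using n(3) v'' u(2) incl_mem mem_eql2 by blast
      then show "mem v'' u m" using m' v'' by blast
    qed
    moreover have "absurd v'" if v': "v \<le> v'" "mem v' m m" for v'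
    proof -
      have "mem v' m n \<or> eql v' m n" using m' v' by blast
      then have "mem v' n n" using n(3) v'(1) nm[OF v'(1)] incl_mem mem_eql2 by blast
      then show ?thesis using n(3) v' by blast
    qed
    ultimately show "?Q v m" by blast
  qed
  with assms show ?thesis by blast
qed

lemma finen_empty:
  assumes "empt w a" "a \<in> obj w"
  shows "finen w a"
proof -
  obtain o' where o: "omega w o'" "o' \<in> obj w" by (rule omega_exists)
  then obtain z where z: "mem w z o'" "empt w z" unfolding omega_def induc_def by blast
  have zo: "z \<in> obj w" using z mem_obj by blast
  have ab: "absurd w'" if "w \<le> w'" "mem w' p z" for w' p using z that unfolding empt_def by blast
  have "isrel w z z a"
    unfolding isrel_def
  proof (intro allI impI)
    fix w' p assume *: "w \<le> w'" "mem w' p z"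
    then have "absurd w'" "p \<in> obj w'" "a \<in> obj w'" using ab mem_obj obj_mono assms by blast+
    then show "\<exists>x y. mem w' x z \<and> mem w' y a \<and> opair w' p x y"
      using * absurd_atoms absurd_opair by (intro exI[of _ p]) blast
  qed
  moreover have "\<exists>y\<in>obj w'. rl w' z x y \<and> (\<forall>w''\<ge>w'. \<forall>y'\<in>obj w''. rl w'' z x y' \<longrightarrow> eql w'' y' y)"
    if *: "w \<le> w'" "mem w' x z" for w' x
  proof -
    have "absurd w'" "x \<in> obj w'" using ab * mem_obj by blast+
    then have "rl w' z x x" unfolding rl_def using * absurd_opair by blast
    moreover have "eql w'' y' x" if "w' \<le> w''" "y' \<in> obj w''" for w'' y'
      using that \<open>absurd w'\<close> \<open>x \<in> obj w'\<close> absurd_mono obj_mono absurd_atoms by blast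
    ultimately show ?thesis using \<open>x \<in> obj w'\<close> by blast
  qed
  moreover have "\<exists>x. mem w' x z \<and> rl w' z x y" if *: "w \<le> w'" "mem w' y a" for w' y
  proof -
    have "absurd w'" "y \<in> obj w'" "z \<in> obj w'" using assms * mem_obj obj_mono zo unfolding empt_def by blast+
    then have "mem w' y z" "opair w' y y y" using absurd_atoms absurd_opair by blast+
    then show ?thesis unfolding rl_def by blast
  qed
  \<comment> \<open>Zero serves both as the number of elements and as the empty function onto
    \<open>a\<close>.\<close>
  ultimately have "surjection w z z a" unfolding surjection_def isfun_def by blast
  with o z zo show ?thesis unfolding finen_def by blast
qed

section \<open>Adjoining elements, and finite choice\<close>

definition adjoin :: "world \<Rightarrow> nat \<Rightarrow> nat \<Rightarrow> nat \<Rightarrow> bool" where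
  "adjoin w b a x \<longleftrightarrow> (\<forall>w'\<ge>w. \<forall>z. mem w' z b \<longleftrightarrow> mem w' z a \<or> eql w' z x)"

lemma adjoin_exists:
  assumes "a \<in> obj w" "x \<in> obj w"
  obtains b where "b \<in> obj w" "adjoin w b a x"
proof -
  obtain s where s: "s \<in> obj w" "upair w s x x" by (rule upair_exists[OF assms(2,2)])
  obtain t where t: "t \<in> obj w" "upair w t a s" by (rule upair_exists[OF assms(1) s(1)])
  obtain b where b: "b \<in> obj w" "\<And>w' z. w \<le> w' \<Longrightarrow> mem w' z b \<longleftrightarrow> (\<exists>y. mem w' y t \<and> mem w' z y)"
    by (rule union_exists[OF t(1)]) (rule that)
  have "mem w' z b \<longleftrightarrow> mem w' z a \<or> eql w' z x" if w': "w \<le> w'" for w' z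
  proof -
    have "mem w' y t \<longleftrightarrow> eql w' y a \<or> eql w' y s" for y using t(2) w' unfolding upair_def by blast
    moreover have "mem w' z s \<longleftrightarrow> eql w' z x" using s(2) w' unfolding upair_def by blast
    moreover have "eql w' a a" "eql w' s s" using assms s obj_mono[OF _ w'] eql_refl by blast+
    ultimately show ?thesis using b(2)[OF w'] mem_eql2 by blast
  qed
  with b(1) that show thesis unfolding adjoin_def by blast
qed

text \<open>The enumeration \<open>f\<close> is extended by the new argument \<open>n\<close>, the
  last element of the successor \<open>m\<close>. The delicate point is functionality: an argument
  of \<open>f\<close> could equal the new one only if \<open>n \<in> n\<close>, hence only at an
  absurd world.\<close>

lemma finen_adjoin:
  assumes "finen w a" "adjoin w b a x" "b \<in> obj w" "x \<in> obj w"
  shows "finen w b"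
proof -
  from assms(1) obtain n o' f where n: "omega w o'" "mem w n o'" "f \<in> obj w" "surjection w f n a"
    unfolding finen_def by blast
  then obtain m where m: "mem w m o'" "succ w m n" unfolding omega_def induc_def by blast
  have mo: "m \<in> obj w" "n \<in> obj w" using m n mem_obj by blast+
  have m': "mem w' i m \<longleftrightarrow> mem w' i n \<or> eql w' i n" if "w \<le> w'" for w' i
    using m that unfolding succ_def by blast
  have b': "mem w' z b \<longleftrightarrow> mem w' z a \<or> eql w' z x" if "w \<le> w'" for w' z
    using assms(2) that unfolding adjoin_def by blast
  have f: "isfun w f n a" "isrel w f n a" using n(4) unfolding surjection_def isfun_def by blast+
  have "definable True w (\<lambda>w e. rl w f (e 0) (e 1) \<or> eql w (e 0) n \<and> eql w (e 1) x)"
    using mo n(3) assms(4) by (intro definable_intros)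
  from relation_exists[where Q = "\<lambda>w i z. rl w f i z \<or> eql w i n \<and> eql w z x", OF this mo(1) assms(3)]
  obtain g where g: "g \<in> obj w" "isrel w g m b" and
    g': "\<And>w' i z. w \<le> w' \<Longrightarrow> i \<in> obj w' \<Longrightarrow> z \<in> obj w' \<Longrightarrow>
      rl w' g i z \<longleftrightarrow> mem w' i m \<and> mem w' z b \<and> (rl w' f i z \<or> eql w' i n \<and> eql w' z x)" by metis
  have fg: "rl w' g i z" if "w \<le> w'" "rl w' f i z" "i \<in> obj w'" "z \<in> obj w'" for w' i z
    using g' m' b' that isrel_rl[OF isrel_mono[OF f(2) that(1)] that(2,3,4)] by blast
  have ng: "rl w' g i x" if "w \<le> w'" "eql w' i n" for w' i
    using g'[of w' i x] m' b' that eql_obj obj_mono[OF assms(4)] eql_refl by blast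
  have "\<exists>y\<in>obj w'. rl w' g i y \<and> (\<forall>w''\<ge>w'. \<forall>y'\<in>obj w''. rl w'' g i y' \<longrightarrow> eql w'' y' y)"
    if i: "w \<le> w'" "mem w' i m" for w' i
  proof -
    from i m' consider "mem w' i n" | "eql w' i n" by blast
    then show ?thesis
    proof cases
      case 1
      then obtain y where y: "y \<in> obj w'" "rl w' f i y" "\<forall>w''\<ge>w'. \<forall>y'\<in>obj w''. rl w'' f i y' \<longrightarrow> eql w'' y' y"
        using f(1) i unfolding isfun_def by blast
      have "eql w'' y' y" if w'': "w' \<le> w''" "y' \<in> obj w''" "rl w'' g i y'" for w'' y'
      proof -
        have ww: "w \<le> w''" using i w'' order_trans by blast
        have io: "i \<in> obj w''" using 1 w'' mem_obj obj_mono by blast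
        from g'[OF ww io w''(2)] w''(3) consider "rl w'' f i y'" | "eql w'' i n" by blast
        then show ?thesis
        proof cases
          case 1
          then show ?thesis using y w'' by blast
        next
          case 2
          have "mem w'' i n" using \<open>mem w' i n\<close> w''(1) by (rule mem_mono)
          then have "mem w'' n n" using 2 by (rule mem_eql1)
          then have "absurd w''" using omega_mem_irrefl n ww by blast
          then show ?thesis using absurd_atoms w'' obj_mono[OF y(1)] by blast
        qed
      qed
      then show ?thesis using y fg i mem_obj by blast
    next
      case 2
      have "eql w'' y' x" if w'': "w' \<le> w''" "y' \<in> obj w''" "rl w'' g i y'" for w'' y'
      proof -
        have ww: "w \<le> w''" using i w'' order_trans by blast
        have io: "i \<in> obj w''" using 2 w'' eql_obj obj_mono by blast
        from g'[OF ww io w''(2)] w''(3) consider "rl w'' f i y'" | "eql w'' y' x" by blast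
        then show ?thesis
        proof cases
          case 1
          then have "mem w'' i n" using isrel_rl isrel_mono[OF f(2) ww] io w''(2) by blast
          then have "mem w'' n n" using eql_mono[OF 2 w''(1)] by (rule mem_eql1)
          then have "absurd w''" using omega_mem_irrefl n ww by blast
          then show ?thesis using absurd_atoms w'' obj_mono[OF assms(4) ww] by blast
        qed
      qed
      then show ?thesis using ng[OF i(1) 2] obj_mono[OF assms(4) i(1)] by blast
    qed
  qed
  moreover have "\<exists>i. mem w' i m \<and> rl w' g i z" if z: "w \<le> w'" "mem w' z b" for w' z
  proof -
    from z b' consider "mem w' z a" | "eql w' z x" by blast
    then show ?thesis
    proof cases
      case 1
      then obtain i where "mem w' i n" "rl w' f i z" using n(4) z unfolding surjection_def by blast
      then show ?thesis using fg m' z mem_obj by blast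
    next
      case 2
      have nn: "eql w' n n" using obj_mono[OF mo(2) z(1)] by (rule eql_refl)
      then have "mem w' n m" "rl w' g n x" using m' z ng by blast+
      then show ?thesis using rl_eql[OF _ nn eql_sym[OF 2]] by blast
    qed
  qed
  ultimately have "surjection w g m b" using g(2) unfolding surjection_def isfun_def by blast
  with n(1) m(1) g(1) show ?thesis unfolding finen_def by blast
qed

text \<open>Finite choice without an axiom of choice. The elements of \<open>a\<close> are treated
  one at a time along an enumeration \<open>f\<close>, each step replacing \<open>D\<close> by a
  member of \<open>H\<close> that keeps what was achieved. As \<open>H\<close> is a set and
  \<open>T\<close> is restricted, the existence of a suitable \<open>D\<close> is a restricted
  statement, to which \<open>omega_induct\<close> applies.\<close>

lemma finen_directed:
  assumes "finen w a" "a \<in> obj w" "H \<in> obj w" "definable True w (\<lambda>w e. T w (e 0) (e 1))"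
    "mem w D0 H"
    "\<And>w' D x. w \<le> w' \<Longrightarrow> mem w' D H \<Longrightarrow> mem w' x a \<Longrightarrow>
       \<exists>D'. mem w' D' H \<and> T w' D' x \<and> (\<forall>w''\<ge>w'. \<forall>z. mem w'' z a \<longrightarrow> T w'' D z \<longrightarrow> T w'' D' z)"
  shows "\<exists>D. mem w D H \<and> (\<forall>w'\<ge>w. \<forall>z. mem w' z a \<longrightarrow> T w' D z)"
proof -
  from assms(1) obtain n o' f where n: "omega w o'" "mem w n o'" "f \<in> obj w" "surjection w f n a"
    unfolding finen_def by blast
  have no: "n \<in> obj w" using n mem_obj by blast
  have f: "isfun w f n a" "isrel w f n a" using n(4) unfolding surjection_def isfun_def by blast+
  let ?G = "\<lambda>w k D. \<forall>w'\<ge>w. \<forall>i. mem w' i k \<longrightarrow> (\<forall>w''\<ge>w'. \<forall>z. mem w'' z a \<longrightarrow> (\<forall>w3\<ge>w''. rl w3 f i z \<longrightarrow> T w3 D z))"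
  \<comment> \<open>The induction runs over all of \<open>omega\<close> while \<open>f\<close> is
    defined on \<open>n\<close> only; hence the guard \<open>k \<subseteq> n\<close>, which is
    trivial for \<open>k = n\<close> at the end.\<close>
  let ?Q = "\<lambda>w k. \<forall>w'\<ge>w. incl w' k n \<longrightarrow> (\<exists>D. mem w' D H \<and> ?G w' k D)"
  have Tmono: "T w'' D z" if "w \<le> w'" "w' \<le> w''" "D \<in> obj w'" "z \<in> obj w'" "T w' D z" for w' w'' D z
    using definable_persistent[OF assms(4) that(1,2), of "\<lambda>i. if i = 0 then D else z"] that by simp
  have Teql: "T w' D z'" if "w \<le> w'" "D \<in> obj w'" "eql w' z z'" "T w' D z" for w' D z z'
    using definable_eql[OF assms(4) that(1), of "\<lambda>i. if i = 0 then D else z" "\<lambda>i. if i = 0 then D else z'"] that eql_refl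
    by simp
  have "?Q w n"
  proof (rule omega_induct[where Q = ?Q, OF n(1) omega_obj[OF n(1)] _ _ _ order_refl n(2)])
    have "definable True w (\<lambda>w e. T w (e 2) (e 0))"
      using definable_rename[OF assms(4), of "\<lambda>i. if i = 0 then 2 else 0"] by simp
    then show "definable True w (\<lambda>w e. ?Q w (e 0))"
      using assms(2,3) n(3) no by (intro definable_intros) (simp_all add: numeral_2_eq_2)
  next
    fix v z assume z: "w \<le> v" "mem v z o'" "empt v z"
    have "mem v' D0 H \<and> ?G v' z D0" if v': "v \<le> v'" for v'
    proof (intro conjI allI impI)
      show "mem v' D0 H" using assms(5) order_trans[OF z(1) v'] by (rule mem_mono)
      fix w1 i w2 y w3 assume *: "v' \<le> w1" "mem w1 i z" "w1 \<le> w2" "mem w2 y a" "w2 \<le> w3"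
      have w: "v \<le> w1" "v \<le> w3" "w \<le> w3" "w1 \<le> w3" using * v' z(1) by (meson order_trans)+
      have "absurd w1" using z(3) w(1) *(2) unfolding empt_def by blast
      then have "absurd w3" using w(4) by (rule absurd_mono)
      have D0: "D0 \<in> obj w3" by (rule obj_mono[OF mem_obj(1)[OF assms(5)] w(3)])
      have y: "mem w3 y a" using *(4,5) by (rule mem_mono)
      then have yo: "y \<in> obj w3" by (rule mem_obj)
      \<comment> \<open>At an absurd world \<open>D0\<close> equals every object, in particular the
        member of \<open>H\<close> that serves \<open>y\<close>.\<close>
      obtain D' where D': "mem w3 D' H" "T w3 D' y"
        using assms(6)[OF w(3) mem_mono[OF assms(5) w(3)] y] by blast
      have "eql w3 D' D0" using absurd_atoms(2)[OF \<open>absurd w3\<close> mem_obj(1)[OF D'(1)] D0] .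
      then show "T w3 D0 y"
        using definable_eql[OF assms(4) w(3), of "\<lambda>i. if i = 0 then D' else y" "\<lambda>i. if i = 0 then D0 else y"]
          D' eql_refl[OF yo] by simp
    qed
    then show "?Q v z" by blast
  next
    fix v k m assume k: "w \<le> v" "mem v k o'" "mem v m o'" "?Q v k" and m: "succ v m k"
    have m': "mem v' i m \<longleftrightarrow> mem v' i k \<or> eql v' i k" if "v \<le> v'" for v' i
      using m that unfolding succ_def by blast
    have "\<exists>D. mem v' D H \<and> ?G v' m D" if v': "v \<le> v'" and mn: "incl v' m n" for v'
    proof -
      have wv': "w \<le> v'" using k(1) v' by (rule order_trans)
      have ko: "k \<in> obj v'" by (rule obj_mono[OF mem_obj(1)[OF k(2)] v'])
      have km: "mem v' k m" using m'[OF v'] eql_refl[OF ko] by blast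
      have "incl v' k n"
        unfolding incl_def
      proof (intro allI impI)
        fix v'' z assume *: "v' \<le> v''" "mem v'' z k"
        then have "mem v'' z m" using m'[OF order_trans[OF v' *(1)]] by blast
        then show "mem v'' z n" using mn *(1) unfolding incl_def by blast
      qed
      then obtain D where D: "mem v' D H" "?G v' k D" using k(4) v' by blast
      have kn: "mem v' k n" using incl_mem[OF mn km] .
      then obtain y where y: "y \<in> obj v'" "rl v' f k y" "\<forall>w''\<ge>v'. \<forall>y'\<in>obj w''. rl w'' f k y' \<longrightarrow> eql w'' y' y"
        using f(1) wv' unfolding isfun_def by blast
      have "mem v' y a" using isrel_rl(2)[OF isrel_mono[OF f(2) wv'] y(2) ko y(1)] .
      from assms(6)[OF wv' D(1) this] obtain D' where D': "mem v' D' H" "T v' D' y"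
        "\<forall>w''\<ge>v'. \<forall>z. mem w'' z a \<longrightarrow> T w'' D z \<longrightarrow> T w'' D' z" by blast
      have D'o: "D' \<in> obj v'" using D'(1) by (rule mem_obj)
      have "T w3 D' z" if *: "v' \<le> w1" "mem w1 i m" "w1 \<le> w2" "mem w2 z a" "w2 \<le> w3" "rl w3 f i z" for w1 i w2 z w3
      proof -
        have le: "v' \<le> w3" "v \<le> w1" "w \<le> w3" "w1 \<le> w3" using * v' wv' order_trans by meson+
        have z: "mem w3 z a" using *(4,5) by (rule mem_mono)
        have zo: "z \<in> obj w3" using z by (rule mem_obj)
        from m'[OF le(2)] *(2) consider "mem w1 i k" | "eql w1 i k" by blast
        then show ?thesis
        proof cases
          case 1
          then have "T w3 D z" using D(2)[rule_format, OF *(1) _ *(3,4,5,6)] by blast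
          then show ?thesis using D'(3) le(1) z by blast
        next
          case 2
          have "rl w3 f k z" using rl_eql[OF *(6) eql_mono[OF 2 le(4)] eql_refl[OF zo]] .
          then have "eql w3 z y" using y(3) le(1) zo by blast
          moreover have "T w3 D' y" using Tmono[OF wv' le(1) D'o y(1) D'(2)] .
          ultimately show ?thesis using Teql[OF le(3) obj_mono[OF D'o le(1)] eql_sym] by blast
        qed
      qed
      with D'(1) show ?thesis by blast
    qed
    then show "?Q v m" by blast
  qed
  then obtain D where D: "mem w D H" "?G w n D" using incl_refl by blast
  have "T w' D z" if z: "w \<le> w'" "mem w' z a" for w' z
  proof -
    obtain i where "mem w' i n" "rl w' f i z" using n(4) z unfolding surjection_def by blast
    with D(2) z show ?thesis by blast
  qed
  with D(1) show ?thesis by blast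
qed

section \<open>The set of finitely enumerable subsets\<close>

definition finsets :: "world \<Rightarrow> nat \<Rightarrow> nat \<Rightarrow> bool" where
  "finsets w F S \<longleftrightarrow> (\<forall>w'\<ge>w. \<forall>u\<in>obj w'. mem w' u F \<longleftrightarrow> incl w' u S \<and> finen w' u)"

text \<open>This is where \<open>FPA\<close> enters: for each \<open>n\<close> the functions from
  \<open>n\<close> to \<open>S\<close> form a set, Replacement and Union over \<open>omega\<close>
  collect all these finite sequences in \<open>U\<close>, and Replacement sends each of them to its
  set of values.\<close>

lemma finsets_exists:
  assumes S: "S \<in> obj w"
  obtains F where "F \<in> obj w" "finsets w F S"
proof -
  obtain o' where o: "omega w o'" "o' \<in> obj w" by (rule omega_exists)
  have 1: "definable False w (\<lambda>w e. isfun w (e 1) (e 0) S)"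
    using S by (intro definable_isfun tm_var tm_const)
  have 2: "\<exists>y\<in>obj w'. \<forall>w''\<ge>w'. \<forall>f\<in>obj w''. mem w'' f y \<longleftrightarrow> isfun w'' f n S" if w': "w \<le> w'" "mem w' n o'" for w' n
  proof -
    obtain y where "y \<in> obj w'" "\<And>w'' f. w' \<le> w'' \<Longrightarrow> f \<in> obj w'' \<Longrightarrow> mem w'' f y \<longleftrightarrow> isfun w'' f n S"
      by (rule function_set_exists[OF omega_mono[OF o(1) w'(1)] w'(2) obj_mono[OF S w'(1)]]) (rule that)
    then show ?thesis by blast
  qed
  note fam = family_exists[where Q = "\<lambda>w n f. isfun w f n S", OF 1 o(2) 2]
  obtain G where G: "G \<in> obj w" "\<And>w' y. w \<le> w' \<Longrightarrow> y \<in> obj w' \<Longrightarrow> mem w' y G \<longleftrightarrow>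
      (\<exists>n. mem w' n o' \<and> (\<forall>w''\<ge>w'. \<forall>f\<in>obj w''. mem w'' f y \<longleftrightarrow> isfun w'' f n S))"
    by (rule fam) (assumption, assumption, rule that)
  obtain U where U: "U \<in> obj w" "\<And>w' f. w \<le> w' \<Longrightarrow> mem w' f U \<longleftrightarrow> (\<exists>y. mem w' y G \<and> mem w' f y)"
    by (rule union_exists[OF G(1)]) (rule that)
  have U': "mem w' f U \<longleftrightarrow> (\<exists>n. mem w' n o' \<and> isfun w' f n S)" if w': "w \<le> w'" "f \<in> obj w'" for w' f
  proof
    assume "mem w' f U"
    then obtain y where y: "mem w' y G" "mem w' f y" using U w' by blast
    then have "y \<in> obj w'" using mem_obj by blast
    with y G(2) w' show "\<exists>n. mem w' n o' \<and> isfun w' f n S" by blast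
  next
    assume "\<exists>n. mem w' n o' \<and> isfun w' f n S"
    then obtain n where n: "mem w' n o'" "isfun w' f n S" by blast
    obtain y where y: "y \<in> obj w'" "\<forall>w''\<ge>w'. \<forall>f\<in>obj w''. mem w'' f y \<longleftrightarrow> isfun w'' f n S"
      using 2[OF w'(1) n(1)] by blast
    have "mem w' y G" using G(2)[OF w'(1) y(1)] y(2) n(1) by blast
    moreover have "mem w' f y" using y n w' by blast
    ultimately show "mem w' f U" using U w' by blast
  qed
  \<comment> \<open>The formula sees only the sequence \<open>f\<close>, so the index of a value is
    sought below an arbitrary number; the pairs in \<open>f\<close> force it into the actual
    domain.\<close>
  let ?R = "\<lambda>w f z. mem w z S \<and> (\<exists>n. mem w n o' \<and> (\<exists>i. mem w i n \<and> rl w f i z))"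
  have 3: "definable False w (\<lambda>w e. ?R w (e 0) (e 1))"
    using S o by (intro definable_intros)
  have 4: "\<exists>y\<in>obj w'. \<forall>w''\<ge>w'. \<forall>z\<in>obj w''. mem w'' z y \<longleftrightarrow> ?R w'' f z" if w': "w \<le> w'" "mem w' f U" for w' f
  proof -
    have f: "f \<in> obj w'" "S \<in> obj w'" "o' \<in> obj w'" using w' mem_obj obj_mono S o by blast+
    then have "definable True w' (\<lambda>w e. ?R w f (e 0))" by (intro definable_intros)
    note sep = separation_exists[where Q = "\<lambda>w. ?R w f", OF this f(2)]
    obtain y where "y \<in> obj w'" "\<And>w'' z. w' \<le> w'' \<Longrightarrow> mem w'' z y \<longleftrightarrow> mem w'' z S \<and> ?R w'' f z"
      by (rule sep) (rule that)
    then show ?thesis by blast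
  qed
  note fam = family_exists[where Q = ?R, OF 3 U(1) 4]
  obtain F where F: "F \<in> obj w" "\<And>w' y. w \<le> w' \<Longrightarrow> y \<in> obj w' \<Longrightarrow> mem w' y F \<longleftrightarrow>
      (\<exists>f. mem w' f U \<and> (\<forall>w''\<ge>w'. \<forall>z\<in>obj w''. mem w'' z y \<longleftrightarrow> ?R w'' f z))"
    by (rule fam) (assumption, assumption, rule that)
  have "mem w' u F \<longleftrightarrow> incl w' u S \<and> finen w' u" if w': "w \<le> w'" "u \<in> obj w'" for w' u
  proof
    assume "mem w' u F"
    then obtain f where f: "mem w' f U" "\<forall>w''\<ge>w'. \<forall>z\<in>obj w''. mem w'' z u \<longleftrightarrow> ?R w'' f z" using F w' by blast
    have fo: "f \<in> obj w'" using f mem_obj by blast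
    then obtain n where n: "mem w' n o'" "isfun w' f n S" using U' f w' by blast
    have u: "mem w'' z u \<longleftrightarrow> ?R w'' f z" if "w' \<le> w''" for w'' z using f(2) that mem_obj by blast
    have fn: "isrel w' f n S" using n unfolding isfun_def by blast
    have "incl w' u S" unfolding incl_def using u by blast
    moreover have "surjection w' f n u"
      unfolding surjection_def isfun_def
    proof (intro conjI)
      show "isrel w' f n u"
        unfolding isrel_def
      proof (intro allI impI)
        fix v p assume v: "w' \<le> v" "mem v p f"
        then obtain i z where iz: "mem v i n" "mem v z S" "opair v p i z" using fn unfolding isrel_def by blast
        moreover have "mem v n o'" using n v mem_mono by blast
        ultimately have "mem v z u" using u v unfolding rl_def by blast
        with iz show "\<exists>a b. mem v a n \<and> mem v b u \<and> opair v p a b" by blast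
      qed
      show "\<forall>w''\<ge>w'. \<forall>x. mem w'' x n \<longrightarrow> (\<exists>y\<in>obj w''. rl w'' f x y \<and> (\<forall>v\<ge>w''. \<forall>y'\<in>obj v. rl v f x y' \<longrightarrow> eql v y' y))"
        using n unfolding isfun_def by blast
      show "\<forall>w''\<ge>w'. \<forall>y. mem w'' y u \<longrightarrow> (\<exists>x. mem w'' x n \<and> rl w'' f x y)"
      proof (intro allI impI)
        fix v y assume v: "w' \<le> v" "mem v y u"
        then obtain m i where "mem v i m" "rl v f i y" using u by blast
        moreover from this have "mem v i n" using isrel_rl[OF isrel_mono[OF fn v(1)]] mem_obj v by blast
        ultimately show "\<exists>x. mem v x n \<and> rl v f x y" by blast
      qed
    qed
    ultimately show "incl w' u S \<and> finen w' u"
      unfolding finen_def using omega_mono[OF o(1) w'(1)] n fo by blast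
  next
    assume *: "incl w' u S \<and> finen w' u"
    then obtain n q f where n: "omega w' q" "mem w' n q" "f \<in> obj w'" "surjection w' f n u"
      unfolding finen_def by blast
    have "incl w' q o'" using omega_unique n omega_mono[OF o(1) w'(1)] mem_obj obj_mono[OF o(2) w'(1)] by blast
    then have no: "mem w' n o'" using n incl_mem by blast
    have fn: "isrel w' f n u" "isfun w' f n u" using n unfolding surjection_def isfun_def by blast+
    have "isrel w' f n S" using fn(1) * unfolding isrel_def incl_def by blast
    then have "isfun w' f n S" using fn(2) unfolding isfun_def by blast
    then have "mem w' f U" using U' w' n no by blast
    moreover have "mem w'' z u \<longleftrightarrow> ?R w'' f z" if v: "w' \<le> w''" "z \<in> obj w''" for w'' z
    proof
      assume z: "mem w'' z u"
      then obtain i where "mem w'' i n" "rl w'' f i z" using n v unfolding surjection_def by blast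
      moreover have "mem w'' z S" using z * v unfolding incl_def by blast
      moreover have "mem w'' n o'" using no v mem_mono by blast
      ultimately show "?R w'' f z" by blast
    next
      assume "?R w'' f z"
      then show "mem w'' z u" using isrel_rl[OF isrel_mono[OF fn(1) v(1)]] mem_obj v by blast
    qed
    ultimately show "mem w' u F" using F(2)[OF w'] by blast
  qed
  with F(1) that show thesis unfolding finsets_def by blast
qed

lemma finsets_mono: "finsets w F S \<Longrightarrow> w \<le> w' \<Longrightarrow> finsets w' F S"
  unfolding finsets_def by (erule (1) forall_ge_mono)

lemma finsets_mem: "finsets w F S \<Longrightarrow> w \<le> w' \<Longrightarrow> mem w' u F \<Longrightarrow> incl w' u S \<and> finen w' u"
  unfolding finsets_def using mem_obj by blast

lemma finsets_empty:
  assumes "finsets w F S" "S \<in> obj w"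
  obtains u where "mem w u F" "empt w u"
proof -
  obtain o' where o: "omega w o'" "o' \<in> obj w" by (rule omega_exists)
  then obtain z where z: "mem w z o'" "empt w z" unfolding omega_def induc_def by blast
  have "z \<in> obj w" using z mem_obj by blast
  moreover have "incl w z S"
    unfolding incl_def using z(2) absurd_incl[OF _ obj_mono[OF assms(2)]] incl_mem unfolding empt_def by blast
  ultimately show thesis using that assms finen_empty z unfolding finsets_def by blast
qed

lemma finsets_adjoin:
  assumes "finsets w F S" "mem w u F" "mem w x S"
  obtains v where "mem w v F" "adjoin w v u x"
proof -
  obtain v where v: "v \<in> obj w" "adjoin w v u x"
    using adjoin_exists[OF mem_obj(1)[OF assms(2)] mem_obj(1)[OF assms(3)]] .
  have u: "incl w u S" "finen w u" using assms finsets_mem by blast+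
  have "finen w v" using finen_adjoin[OF u(2) v(2,1)] assms mem_obj by blast
  moreover have "incl w v S"
    unfolding incl_def
  proof (intro allI impI)
    fix w' z assume w': "w \<le> w'" "mem w' z v"
    then consider "mem w' z u" | "eql w' z x" using v unfolding adjoin_def by blast
    then show "mem w' z S"
    proof cases
      case 1
      then show ?thesis using u w' unfolding incl_def by blast
    next
      case 2
      then show ?thesis using mem_eql1[OF mem_mono[OF assms(3) w'(1)] eql_sym] by blast
    qed
  qed
  ultimately show thesis using that v assms(1) unfolding finsets_def by blast
qed

text \<open>The elements of \<open>a\<close> are adjoined to \<open>u\<close> one by one, the
  candidates being the finitely enumerable \<open>D\<close> with
  \<open>u \<subseteq> D \<subseteq> \<alpha>\<close>. Directedness of the finitely enumerable
  subsets of \<open>\<alpha>\<close> is the filter condition for \<open>\<alpha>\<close> as an ideal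
  point.\<close>

lemma finsets_directed:
  assumes F: "finsets w F S" "F \<in> obj w" and a: "a \<in> obj w" "finen w a" "incl w a \<alpha>"
    and \<alpha>: "\<alpha> \<in> obj w" "incl w \<alpha> S" and u: "mem w u F" "incl w u \<alpha>"
  shows "\<exists>v. mem w v F \<and> incl w u v \<and> incl w a v \<and> incl w v \<alpha>"
proof -
  have uo: "u \<in> obj w" using u mem_obj by blast
  have "definable True w (\<lambda>w e. incl w u (e 0) \<and> incl w (e 0) \<alpha>)"
    using uo \<alpha> by (intro definable_intros)
  note sep = separation_exists[where Q = "\<lambda>w D. incl w u D \<and> incl w D \<alpha>", OF this F(2)]
  obtain H where H: "H \<in> obj w" "\<And>w' D. w \<le> w' \<Longrightarrow> mem w' D H \<longleftrightarrow> mem w' D F \<and> incl w' u D \<and> incl w' D \<alpha>"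
    by (rule sep) (rule that)
  have "definable True w (\<lambda>w e. mem w (e 1) (e 0))" by (intro definable_intros)
  then have "\<exists>D. mem w D H \<and> (\<forall>w'\<ge>w. \<forall>z. mem w' z a \<longrightarrow> mem w' z D)"
  proof (rule finen_directed[where T = "\<lambda>w D z. mem w z D", OF a(2,1) H(1)])
    show "mem w u H" using H(2) u incl_refl by blast
    fix w' D x assume D: "w \<le> w'" "mem w' D H" "mem w' x a"
    have D': "mem w' D F" "incl w' u D" "incl w' D \<alpha>" using D H by blast+
    have x\<alpha>: "mem w' x \<alpha>" using a(3) D unfolding incl_def by blast
    then have "mem w' x S" using \<alpha>(2) D unfolding incl_def by blast
    with finsets_adjoin[OF finsets_mono[OF F(1) D(1)] D'(1)]
    obtain v where v: "mem w' v F" "adjoin w' v D x" by blast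
    have v': "mem w'' z v \<longleftrightarrow> mem w'' z D \<or> eql w'' z x" if "w' \<le> w''" for w'' z
      using v(2) that unfolding adjoin_def by blast
    have "incl w' u v" unfolding incl_def using v' D'(2) unfolding incl_def by blast
    moreover have "incl w' v \<alpha>"
      unfolding incl_def
    proof (intro allI impI)
      fix w'' z assume *: "w' \<le> w''" "mem w'' z v"
      then consider "mem w'' z D" | "eql w'' z x" using v' by blast
      then show "mem w'' z \<alpha>"
      proof cases
        case 1
        then show ?thesis using D'(3) * unfolding incl_def by blast
      next
        case 2
        then show ?thesis using mem_eql1[OF mem_mono[OF x\<alpha> *(1)] eql_sym] by blast
      qed
    qed
    ultimately have "mem w' v H" using H(2) D(1) v(1) by blast
    moreover have "mem w' x v" using v' eql_refl D(3) mem_obj by blast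
    ultimately show "\<exists>D'. mem w' D' H \<and> mem w' x D' \<and> (\<forall>w''\<ge>w'. \<forall>z. mem w'' z a \<longrightarrow> mem w'' z D \<longrightarrow> mem w'' z D')"
      using v' by blast
  qed
  then obtain v where v: "mem w v H" "\<forall>w'\<ge>w. \<forall>z. mem w' z a \<longrightarrow> mem w' z v" by blast
  then have "incl w a v" unfolding incl_def by blast
  with v(1) H(2) show ?thesis by blast
qed

section \<open>Concrete spaces in a world\<close>

definition below :: "world \<Rightarrow> nat \<Rightarrow> nat \<Rightarrow> nat \<Rightarrow> nat \<Rightarrow> nat \<Rightarrow> bool" where
  "below w X V c a b \<longleftrightarrow> (\<forall>w'\<ge>w. \<forall>x. mem w' x X \<longrightarrow> rl w' V x c \<longrightarrow> rl w' V x a \<and> rl w' V x b)"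

definition cspace :: "world \<Rightarrow> nat \<Rightarrow> nat \<Rightarrow> nat \<Rightarrow> bool" where
  "cspace w X V S \<longleftrightarrow> isrel w V X S \<and>
     (\<forall>w'\<ge>w. \<forall>x. mem w' x X \<longrightarrow> (\<exists>a. mem w' a S \<and> rl w' V x a)) \<and>
     (\<forall>w'\<ge>w. \<forall>a b x. mem w' a S \<longrightarrow> mem w' b S \<longrightarrow> mem w' x X \<longrightarrow> rl w' V x a \<longrightarrow> rl w' V x b \<longrightarrow>
        (\<exists>c. mem w' c S \<and> rl w' V x c \<and> below w' X V c a b))"

text \<open>With \<open>V\<close> the forcing relation of the codomain of \<open>r\<close>, this is
  all that equality of arrows sees of an arrow.\<close>

definition rcomp :: "world \<Rightarrow> nat \<Rightarrow> nat \<Rightarrow> nat \<Rightarrow> nat \<Rightarrow> bool" where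
  "rcomp w r V x z \<longleftrightarrow> (\<exists>y\<in>obj w. rl w r x y \<and> rl w V y z)"

lemma holds_below:
  "X < d \<Longrightarrow> V < d \<Longrightarrow> S < d \<Longrightarrow> a < d \<Longrightarrow> b < d \<Longrightarrow> c < d \<Longrightarrow>
    holds j w \<rho> d (down1 (X, V, S) a b c) \<longleftrightarrow> mem w (\<rho> c) (\<rho> S) \<and> below w (\<rho> X) (\<rho> V) (\<rho> c) (\<rho> a) (\<rho> b)"
  unfolding below_def
  by (simp add: cls_sub_def cls_int_def holds_set_theory) (use mem_obj in blast)

lemma holds_concrete_space:
  "X < d \<Longrightarrow> V < d \<Longrightarrow> S < d \<Longrightarrow>
    holds j w \<rho> d (concrete_space (X, V, S)) \<longleftrightarrow> cspace w (\<rho> X) (\<rho> V) (\<rho> S)"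
proof -
  have "(\<forall>w'\<ge>w. \<forall>x\<in>obj w'. mem w' x X \<longleftrightarrow> (\<exists>a. mem w' a S \<and> mem w' x X \<and> rl w' V x a)) \<longleftrightarrow>
      (\<forall>w'\<ge>w. \<forall>x. mem w' x X \<longrightarrow> (\<exists>a. mem w' a S \<and> rl w' V x a))" for w X V S
    using mem_obj by blast
  moreover have "(\<forall>w'\<ge>w. \<forall>a\<in>obj w'. \<forall>b\<in>obj w'. mem w' a S \<and> mem w' b S \<longrightarrow>
         (\<forall>w''\<ge>w'. \<forall>x\<in>obj w''. (mem w'' x X \<and> rl w'' V x a \<and> mem w'' x X \<and> rl w'' V x b) \<longleftrightarrow>
            (\<exists>c. mem w'' c S \<and> below w'' X V c a b \<and> mem w'' x X \<and> rl w'' V x c))) \<longleftrightarrow>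
      (\<forall>w'\<ge>w. \<forall>a b x. mem w' a S \<longrightarrow> mem w' b S \<longrightarrow> mem w' x X \<longrightarrow> rl w' V x a \<longrightarrow> rl w' V x b \<longrightarrow>
        (\<exists>c. mem w' c S \<and> rl w' V x c \<and> below w' X V c a b))" (is "?L \<longleftrightarrow> ?R") for w X V S
  proof
    show "?L \<Longrightarrow> ?R" by (meson mem_obj order_refl)
    assume R: ?R
    have "\<exists>c. mem w'' c S \<and> below w'' X V c a b \<and> mem w'' x X \<and> rl w'' V x c"
      if "w \<le> w'" "mem w' a S" "mem w' b S" "w' \<le> w''" "mem w'' x X" "rl w'' V x a" "rl w'' V x b" for w' w'' a b x
      using R order_trans[OF that(1,4)] mem_mono[OF that(2,4)] mem_mono[OF that(3,4)] that(5-7) by blast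
    moreover have "rl w'' V x a \<and> rl w'' V x b" if "below w'' X V c a b" "mem w'' x X" "rl w'' V x c" for w'' a b x c
      using that unfolding below_def by blast
    ultimately show ?L by blast
  qed
  ultimately show "X < d \<Longrightarrow> V < d \<Longrightarrow> S < d \<Longrightarrow>
      holds j w \<rho> d (concrete_space (X, V, S)) \<longleftrightarrow> cspace w (\<rho> X) (\<rho> V) (\<rho> S)"
    unfolding cspace_def
    by (simp add: cls_eq_def elems_def ext_def cls_int_def holds_set_theory holds_below del: down1.simps)
qed

text \<open>The literal reading of \<open>CSpa_arrow\<close>; between concrete spaces it amounts to \<open>arr\<close> below.\<close>

definition csarrow :: "world \<Rightarrow> nat \<Rightarrow> nat \<Rightarrow> nat \<Rightarrow> nat \<Rightarrow> nat \<Rightarrow> nat \<Rightarrow> nat \<Rightarrow> nat \<Rightarrow> bool" where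
  "csarrow w X1 V1 S1 X2 V2 S2 r s \<longleftrightarrow> (isrel w r X1 X2 \<and> isrel w s S1 S2 \<and>
     (\<forall>w'\<ge>w. \<forall>x\<in>obj w'. \<forall>z\<in>obj w'. rcomp w' r V2 x z \<longleftrightarrow> rcomp w' V1 s x z)) \<and>
     (\<forall>w'\<ge>w. \<forall>x\<in>obj w'. (\<exists>a. mem w' a S1 \<and> mem w' x X1 \<and> rl w' V1 x a) \<longleftrightarrow>
        (\<exists>y\<in>obj w'. (\<exists>b. mem w' b S2 \<and> mem w' y X2 \<and> rl w' V2 y b) \<and> rl w' r x y)) \<and>
     (\<forall>w'\<ge>w. \<forall>a\<in>obj w'. \<forall>b\<in>obj w'. mem w' a S2 \<and> mem w' b S2 \<longrightarrow> (\<forall>w''\<ge>w'. \<forall>x\<in>obj w''.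
        (\<exists>c\<in>obj w''. (\<exists>a'\<in>obj w''. \<exists>b'\<in>obj w''. (\<exists>y\<in>obj w''. eql w'' y a \<and> rl w'' s a' y) \<and>
            (\<exists>y\<in>obj w''. eql w'' y b \<and> rl w'' s b' y) \<and> mem w'' c S1 \<and> below w'' X1 V1 c a' b') \<and>
            mem w'' x X1 \<and> rl w'' V1 x c) \<longleftrightarrow>
        (\<exists>y\<in>obj w''. (\<exists>c. mem w'' c S2 \<and> below w'' X2 V2 c a b \<and> mem w'' y X2 \<and> rl w'' V2 y c) \<and> rl w'' r x y)))"

lemma holds_CSpa_arrow:
  "X1 < d \<Longrightarrow> V1 < d \<Longrightarrow> S1 < d \<Longrightarrow> X2 < d \<Longrightarrow> V2 < d \<Longrightarrow> S2 < d \<Longrightarrow> r < d \<Longrightarrow> s < d \<Longrightarrow>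
    holds j w \<rho> d (CSpa_arrow (X1, V1, S1) (X2, V2, S2) (r, s)) \<longleftrightarrow>
    csarrow w (\<rho> X1) (\<rho> V1) (\<rho> S1) (\<rho> X2) (\<rho> V2) (\<rho> S2) (\<rho> r) (\<rho> s)"
  unfolding CSpa_arrow_def csarrow_def
  by (simp add: cls_eq_def elems_def ext_def cls_int_def preimage_def single_def rel_eq_def rel_comp_def graph_def 
    down_def holds_set_theory holds_below rcomp_def
    del: down1.simps)

text \<open>The last two clauses make the image of every point an ideal point: it is inhabited, and
  any two of its neighbourhoods are refined by a third one.\<close>

definition arr :: "world \<Rightarrow> nat \<Rightarrow> nat \<Rightarrow> nat \<Rightarrow> nat \<Rightarrow> nat \<Rightarrow> nat \<Rightarrow> nat \<Rightarrow> nat \<Rightarrow> bool" where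
  "arr w X1 V1 S1 X2 V2 S2 r s \<longleftrightarrow> isrel w r X1 X2 \<and> isrel w s S1 S2 \<and>
     (\<forall>w'\<ge>w. \<forall>x\<in>obj w'. \<forall>z\<in>obj w'. rcomp w' r V2 x z \<longleftrightarrow> rcomp w' V1 s x z) \<and>
     (\<forall>w'\<ge>w. \<forall>x. mem w' x X1 \<longrightarrow> (\<exists>y\<in>obj w'. rl w' r x y)) \<and>
     (\<forall>w'\<ge>w. \<forall>a b x. mem w' a S2 \<longrightarrow> mem w' b S2 \<longrightarrow> mem w' x X1 \<longrightarrow> rcomp w' r V2 x a \<longrightarrow> rcomp w' r V2 x b \<longrightarrow>
        (\<exists>c. mem w' c S2 \<and> below w' X2 V2 c a b \<and> rcomp w' r V2 x c))"

text \<open>In both equations of convergence one inclusion is automatic. Concreteness of the domain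
  turns the left side of the second equation into the statement that the image of \<open>x\<close>
  has both \<open>a\<close> and \<open>b\<close> as neighbourhoods, and the right side always
  implies this. What remains are the last two clauses of \<open>arr\<close>.\<close>

lemma csarrow_iff:
  assumes A: "cspace w X1 V1 S1" and B: "cspace w X2 V2 S2"
  shows "csarrow w X1 V1 S1 X2 V2 S2 r s \<longleftrightarrow> arr w X1 V1 S1 X2 V2 S2 r s"
proof (cases "isrel w r X1 X2 \<and> isrel w s S1 S2 \<and>
     (\<forall>w'\<ge>w. \<forall>x\<in>obj w'. \<forall>z\<in>obj w'. rcomp w' r V2 x z \<longleftrightarrow> rcomp w' V1 s x z)")
  case False
  then show ?thesis unfolding csarrow_def arr_def by blast
next
  case True
  then have r: "isrel w r X1 X2" and s: "isrel w s S1 S2" and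
    rs: "\<And>w' x z. w \<le> w' \<Longrightarrow> x \<in> obj w' \<Longrightarrow> z \<in> obj w' \<Longrightarrow> rcomp w' r V2 x z \<longleftrightarrow> rcomp w' V1 s x z" by blast+
  have V: "isrel w V1 X1 S1" "isrel w V2 X2 S2" using A B unfolding cspace_def by blast+
  have rm: "mem w' x X1" "mem w' y X2" if "w \<le> w'" "x \<in> obj w'" "y \<in> obj w'" "rl w' r x y" for w' x y
    using isrel_rl[OF isrel_mono[OF r that(1)]] that by blast+
  have sm: "mem w' x S1" "mem w' y S2" if "w \<le> w'" "x \<in> obj w'" "y \<in> obj w'" "rl w' s x y" for w' x y
    using isrel_rl[OF isrel_mono[OF s that(1)]] that by blast+
  have V1m: "mem w' x X1" "mem w' y S1" if "w \<le> w'" "x \<in> obj w'" "y \<in> obj w'" "rl w' V1 x y" for w' x y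
    using isrel_rl[OF isrel_mono[OF V(1) that(1)]] that by blast+
  have V2m: "mem w' x X2" "mem w' y S2" if "w \<le> w'" "x \<in> obj w'" "y \<in> obj w'" "rl w' V2 x y" for w' x y
    using isrel_rl[OF isrel_mono[OF V(2) that(1)]] that by blast+
  have A1: "\<exists>a. mem w' a S1 \<and> rl w' V1 x a" if "w \<le> w'" "mem w' x X1" for w' x
    using A that unfolding cspace_def by blast
  have B1: "\<exists>a. mem w' a S2 \<and> rl w' V2 x a" if "w \<le> w'" "mem w' x X2" for w' x
    using B that unfolding cspace_def by blast
  have A2: "\<exists>c. mem w' c S1 \<and> rl w' V1 x c \<and> below w' X1 V1 c a b"
    if "w \<le> w'" "mem w' a S1" "mem w' b S1" "mem w' x X1" "rl w' V1 x a" "rl w' V1 x b" for w' a b x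
    using A that unfolding cspace_def by blast
  have bl: "rl w' V x a \<and> rl w' V x b" if "below w' X V c a b" "mem w' x X" "rl w' V x c" for w' X V a b c x
    using that unfolding below_def by blast
  have 1: "(\<exists>a. mem w' a S1 \<and> mem w' x X1 \<and> rl w' V1 x a) \<longleftrightarrow> mem w' x X1" if "w \<le> w'" for w' x
    using A1 that by blast
  have 2: "(\<exists>y\<in>obj w'. (\<exists>b. mem w' b S2 \<and> mem w' y X2 \<and> rl w' V2 y b) \<and> rl w' r x y) \<longleftrightarrow> (\<exists>y\<in>obj w'. rl w' r x y)"
    if "w \<le> w'" "x \<in> obj w'" for w' x
    using B1 rm that by blast
  have 3: "(\<forall>w'\<ge>w. \<forall>x\<in>obj w'. (\<exists>a. mem w' a S1 \<and> mem w' x X1 \<and> rl w' V1 x a) \<longleftrightarrow>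
        (\<exists>y\<in>obj w'. (\<exists>b. mem w' b S2 \<and> mem w' y X2 \<and> rl w' V2 y b) \<and> rl w' r x y)) \<longleftrightarrow>
      (\<forall>w'\<ge>w. \<forall>x. mem w' x X1 \<longrightarrow> (\<exists>y\<in>obj w'. rl w' r x y))"
  proof -
    have "mem w' x X1 \<longleftrightarrow> (\<exists>y\<in>obj w'. rl w' r x y)" if "w \<le> w'" "x \<in> obj w'"
      and "mem w' x X1 \<longrightarrow> (\<exists>y\<in>obj w'. rl w' r x y)" for w' x
      using that rm(1) by blast
    moreover have "x \<in> obj w'" if "mem w' x X1" for w' x using that by (rule mem_obj)
    ultimately show ?thesis using 1 2 by simp metis
  qed
  have 4: "(\<exists>c\<in>obj w'. (\<exists>a'\<in>obj w'. \<exists>b'\<in>obj w'. (\<exists>y\<in>obj w'. eql w' y a \<and> rl w' s a' y) \<and>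
            (\<exists>y\<in>obj w'. eql w' y b \<and> rl w' s b' y) \<and> mem w' c S1 \<and> below w' X1 V1 c a' b') \<and>
            mem w' x X1 \<and> rl w' V1 x c) \<longleftrightarrow> rcomp w' r V2 x a \<and> rcomp w' r V2 x b" (is "?L \<longleftrightarrow> ?R")
    if w': "w \<le> w'" "a \<in> obj w'" "b \<in> obj w'" "x \<in> obj w'" for w' a b x
  proof
    assume ?L
    then obtain c a' b' y y' where *: "a' \<in> obj w'" "b' \<in> obj w'" "eql w' y a" "rl w' s a' y" "eql w' y' b" "rl w' s b' y'"
      "mem w' x X1" "rl w' V1 x a'" "rl w' V1 x b'" using bl by blast
    then have "rl w' s a' a" "rl w' s b' b" using rl_eql eql_refl by blast+
    with * have "rcomp w' V1 s x a" "rcomp w' V1 s x b" unfolding rcomp_def by blast+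
    with rs w' show ?R by blast
  next
    assume ?R
    with rs w' have "rcomp w' V1 s x a" "rcomp w' V1 s x b" by blast+
    then obtain a' b' where *: "a' \<in> obj w'" "b' \<in> obj w'" "rl w' s a' a" "rl w' s b' b" "rl w' V1 x a'" "rl w' V1 x b'"
      unfolding rcomp_def by blast
    then have "mem w' a' S1" "mem w' b' S1" "mem w' x X1" using V1m w' by blast+
    with A2[OF w'(1)] * obtain c where "mem w' c S1" "rl w' V1 x c" "below w' X1 V1 c a' b'" by blast
    with * \<open>mem w' x X1\<close> show ?L using w' eql_refl mem_obj by blast
  qed
  have 5: "(\<exists>y\<in>obj w'. (\<exists>c. mem w' c S2 \<and> below w' X2 V2 c a b \<and> mem w' y X2 \<and> rl w' V2 y c) \<and> rl w' r x y) \<longleftrightarrow>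
      (\<exists>c. mem w' c S2 \<and> below w' X2 V2 c a b \<and> rcomp w' r V2 x c)"
    if w': "w \<le> w'" "x \<in> obj w'" for w' a b x
    unfolding rcomp_def using rm w' by blast
  have 6: "mem w' x X1 \<and> rcomp w' r V2 x a \<and> rcomp w' r V2 x b"
    if w': "w \<le> w'" "x \<in> obj w'" "below w' X2 V2 c a b" "rcomp w' r V2 x c" for w' a b c x
  proof -
    obtain y where y: "y \<in> obj w'" "rl w' r x y" "rl w' V2 y c" using w'(4) unfolding rcomp_def by blast
    with rm w' have "mem w' x X1" "mem w' y X2" by blast+
    with bl w' y show ?thesis unfolding rcomp_def by blast
  qed
  have "(\<forall>w'\<ge>w. \<forall>a\<in>obj w'. \<forall>b\<in>obj w'. mem w' a S2 \<and> mem w' b S2 \<longrightarrow> (\<forall>w''\<ge>w'. \<forall>x\<in>obj w''.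
        (\<exists>c\<in>obj w''. (\<exists>a'\<in>obj w''. \<exists>b'\<in>obj w''. (\<exists>y\<in>obj w''. eql w'' y a \<and> rl w'' s a' y) \<and>
            (\<exists>y\<in>obj w''. eql w'' y b \<and> rl w'' s b' y) \<and> mem w'' c S1 \<and> below w'' X1 V1 c a' b') \<and>
            mem w'' x X1 \<and> rl w'' V1 x c) \<longleftrightarrow>
        (\<exists>y\<in>obj w''. (\<exists>c. mem w'' c S2 \<and> below w'' X2 V2 c a b \<and> mem w'' y X2 \<and> rl w'' V2 y c) \<and> rl w'' r x y))) \<longleftrightarrow>
     (\<forall>w'\<ge>w. \<forall>a b x. mem w' a S2 \<longrightarrow> mem w' b S2 \<longrightarrow> mem w' x X1 \<longrightarrow> rcomp w' r V2 x a \<longrightarrow> rcomp w' r V2 x b \<longrightarrow>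
        (\<exists>c. mem w' c S2 \<and> below w' X2 V2 c a b \<and> rcomp w' r V2 x c))" (is "?L \<longleftrightarrow> ?R")
  proof
    assume L: ?L
    show ?R
    proof (intro allI impI)
      fix w' a b x assume *: "w \<le> w'" "mem w' a S2" "mem w' b S2" "mem w' x X1" "rcomp w' r V2 x a" "rcomp w' r V2 x b"
      have o: "a \<in> obj w'" "b \<in> obj w'" "x \<in> obj w'" using * mem_obj by blast+
      have "(rcomp w' r V2 x a \<and> rcomp w' r V2 x b) \<longleftrightarrow> (\<exists>c. mem w' c S2 \<and> below w' X2 V2 c a b \<and> rcomp w' r V2 x c)"
        using L[rule_format, OF *(1) o(1,2) conjI[OF *(2,3)] order_refl o(3)]
        unfolding 4[OF *(1) o] 5[OF *(1) o(3)] .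
      with * show "\<exists>c. mem w' c S2 \<and> below w' X2 V2 c a b \<and> rcomp w' r V2 x c" by blast
    qed
  next
    assume R: ?R
    show ?L
    proof (intro allI impI ballI)
      fix w' a b w'' x assume *: "w \<le> w'" "a \<in> obj w'" "b \<in> obj w'" "mem w' a S2 \<and> mem w' b S2" "w' \<le> w''" "x \<in> obj w''"
      have o: "w \<le> w''" "a \<in> obj w''" "b \<in> obj w''" "mem w'' a S2" "mem w'' b S2"
        using order_trans[OF *(1,5)] obj_mono[OF *(2,5)] obj_mono[OF *(3,5)] mem_mono[OF _ *(5)] *(4) by simp_all
      show "(\<exists>c\<in>obj w''. (\<exists>a'\<in>obj w''. \<exists>b'\<in>obj w''. (\<exists>y\<in>obj w''. eql w'' y a \<and> rl w'' s a' y) \<and>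
            (\<exists>y\<in>obj w''. eql w'' y b \<and> rl w'' s b' y) \<and> mem w'' c S1 \<and> below w'' X1 V1 c a' b') \<and>
            mem w'' x X1 \<and> rl w'' V1 x c) \<longleftrightarrow>
        (\<exists>y\<in>obj w''. (\<exists>c. mem w'' c S2 \<and> below w'' X2 V2 c a b \<and> mem w'' y X2 \<and> rl w'' V2 y c) \<and> rl w'' r x y)"
        unfolding 4[OF o(1-3) *(6)] 5[OF o(1) *(6)]
      proof
        assume c: "rcomp w'' r V2 x a \<and> rcomp w'' r V2 x b"
        then have "mem w'' x X1" using rm o(1) *(6) unfolding rcomp_def by blast
        with R o c show "\<exists>c. mem w'' c S2 \<and> below w'' X2 V2 c a b \<and> rcomp w'' r V2 x c" by blast
      qed (use 6 o *(6) in blast)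
    qed
  qed
  then show ?thesis unfolding csarrow_def arr_def 3 by (simp only: conj_assoc)
qed

section \<open>Parallel arrows and equalisers at a world\<close>

definition comp3 :: "world \<Rightarrow> nat \<Rightarrow> nat \<Rightarrow> nat \<Rightarrow> nat \<Rightarrow> nat \<Rightarrow> bool" where
  "comp3 w p r V x z \<longleftrightarrow> (\<exists>y\<in>obj w. (\<exists>u\<in>obj w. rl w p x u \<and> rl w r u y) \<and> rl w V y z)"

lemma comp3_iff: "comp3 w p r V x z \<longleftrightarrow> (\<exists>u\<in>obj w. rl w p x u \<and> rcomp w r V u z)"
  unfolding comp3_def rcomp_def by blast

definition eqz :: "world \<Rightarrow> nat \<Rightarrow> nat \<Rightarrow> nat \<Rightarrow> nat \<Rightarrow> bool" where
  "eqz w V r r' p \<longleftrightarrow> (\<forall>w'\<ge>w. \<forall>x\<in>obj w'. \<forall>z\<in>obj w'. comp3 w' p r V x z \<longleftrightarrow> comp3 w' p r' V x z)"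

lemma holds_equalises:
  "V2 < d \<Longrightarrow> r < d \<Longrightarrow> r' < d \<Longrightarrow> p < d \<Longrightarrow>
    holds j w \<rho> d (equalises (X2, V2, S2) (r, s) (r', s') (p, q)) \<longleftrightarrow> eqz w (\<rho> V2) (\<rho> r) (\<rho> r') (\<rho> p)"
  unfolding equalises_def eqz_def comp3_def by (simp add: rel_eq_def rel_comp_def graph_def holds_set_theory)

definition iseq :: "world \<Rightarrow> nat \<Rightarrow> nat \<Rightarrow> nat \<Rightarrow> nat \<Rightarrow> nat \<Rightarrow> nat \<Rightarrow> nat \<Rightarrow> nat \<Rightarrow> nat \<Rightarrow> nat \<Rightarrow> nat \<Rightarrow> bool" where
  "iseq w X1 V1 S1 V2 r r' XE VE SE p q \<longleftrightarrow>
     cspace w XE VE SE \<and> csarrow w XE VE SE X1 V1 S1 p q \<and> eqz w V2 r r' p \<and>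
     (\<forall>w'\<ge>w. \<forall>X\<in>obj w'. \<forall>V\<in>obj w'. \<forall>S\<in>obj w'. cspace w' X V S \<longrightarrow>
       (\<forall>w''\<ge>w'. \<forall>t\<in>obj w''. \<forall>u\<in>obj w''. csarrow w'' X V S X1 V1 S1 t u \<and> eqz w'' V2 r r' t \<longrightarrow>
         (\<exists>m\<in>obj w''. \<exists>n\<in>obj w''. csarrow w'' X V S XE VE SE m n \<and>
            (\<forall>v\<ge>w''. \<forall>x\<in>obj v. \<forall>z\<in>obj v. comp3 v m p V1 x z \<longleftrightarrow> rcomp v t V1 x z) \<and>
            (\<forall>v\<ge>w''. \<forall>m'\<in>obj v. \<forall>n'\<in>obj v. csarrow v X V S XE VE SE m' n' \<and>
               (\<forall>v'\<ge>v. \<forall>x\<in>obj v'. \<forall>z\<in>obj v'. comp3 v' m' p V1 x z \<longleftrightarrow> rcomp v' t V1 x z) \<longrightarrow>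
               (\<forall>v'\<ge>v. \<forall>x\<in>obj v'. \<forall>z\<in>obj v'. rcomp v' m' VE x z \<longleftrightarrow> rcomp v' m VE x z)))))"

lemma holds_is_equaliser:
  "X1 < d \<Longrightarrow> V1 < d \<Longrightarrow> S1 < d \<Longrightarrow> V2 < d \<Longrightarrow> r < d \<Longrightarrow> r' < d \<Longrightarrow>
    XE < d \<Longrightarrow> VE < d \<Longrightarrow> SE < d \<Longrightarrow> p < d \<Longrightarrow> q < d \<Longrightarrow>
    holds j w \<rho> d (is_equaliser (X1, V1, S1) (X2, V2, S2) (r, s) (r', s') (XE, VE, SE) (p, q)) \<longleftrightarrow>
    iseq w (\<rho> X1) (\<rho> V1) (\<rho> S1) (\<rho> V2) (\<rho> r) (\<rho> r') (\<rho> XE) (\<rho> VE) (\<rho> SE) (\<rho> p) (\<rho> q)"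
  unfolding is_equaliser_def iseq_def comp3_def rcomp_def
  by (simp add: holds_simps holds_concrete_space holds_CSpa_arrow holds_equalises rel_eq_def rel_comp_def graph_def holds_pair_in
      del: concrete_space.simps)

lemma sat_CSpa_has_equalisers:
  "sat w j CSpa_has_equalisers \<longleftrightarrow>
    (\<forall>w'\<ge>w. \<forall>X1\<in>obj w'. \<forall>V1\<in>obj w'. \<forall>S1\<in>obj w'. \<forall>X2\<in>obj w'. \<forall>V2\<in>obj w'. \<forall>S2\<in>obj w'.
       cspace w' X1 V1 S1 \<and> cspace w' X2 V2 S2 \<longrightarrow>
       (\<forall>w''\<ge>w'. \<forall>r\<in>obj w''. \<forall>s\<in>obj w''. \<forall>r'\<in>obj w''. \<forall>s'\<in>obj w''.
          csarrow w'' X1 V1 S1 X2 V2 S2 r s \<and> csarrow w'' X1 V1 S1 X2 V2 S2 r' s' \<longrightarrow>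
          (\<exists>XE\<in>obj w''. \<exists>VE\<in>obj w''. \<exists>SE\<in>obj w''. \<exists>p\<in>obj w''. \<exists>q\<in>obj w''.
             iseq w'' X1 V1 S1 V2 r r' XE VE SE p q)))"
  unfolding CSpa_has_equalisers_def holds_sentence
  by (simp add: holds_simps holds_concrete_space holds_CSpa_arrow holds_is_equaliser
      del: concrete_space.simps)

definition closed :: "world \<Rightarrow> nat \<Rightarrow> nat \<Rightarrow> nat \<Rightarrow> bool" where
  "closed w S R \<alpha> \<longleftrightarrow> incl w \<alpha> S \<and> (\<forall>w'\<ge>w. \<forall>a\<in>obj w'. \<forall>b\<in>obj w'. rl w' R a b \<longrightarrow>
     (\<forall>w''\<ge>w'. incl w'' a \<alpha> \<longrightarrow> (\<exists>x. mem w'' x b \<and> mem w'' x \<alpha>)))"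

definition finrules :: "world \<Rightarrow> nat \<Rightarrow> nat \<Rightarrow> bool" where
  "finrules w S R \<longleftrightarrow> (\<forall>w'\<ge>w. \<forall>p. mem w' p R \<longrightarrow>
     (\<exists>a\<in>obj w'. \<exists>b\<in>obj w'. opair w' p a b \<and> incl w' a S \<and> incl w' b S \<and> finen w' a))"

definition generates :: "world \<Rightarrow> nat \<Rightarrow> nat \<Rightarrow> nat \<Rightarrow> bool" where
  "generates w S R G \<longleftrightarrow> (\<forall>w'\<ge>w. \<forall>\<beta>. mem w' \<beta> G \<longrightarrow> closed w' S R \<beta>) \<and>
     (\<forall>w'\<ge>w. \<forall>\<alpha>\<in>obj w'. closed w' S R \<alpha> \<longrightarrow>
        (\<forall>w''\<ge>w'. \<forall>x. mem w'' x \<alpha> \<longrightarrow> (\<exists>\<beta>. mem w'' \<beta> G \<and> mem w'' x \<beta> \<and> incl w'' \<beta> \<alpha>)))"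

lemma sat_NID_fin:
  "sat w j NID_fin \<longleftrightarrow>
    (\<forall>w'\<ge>w. \<forall>S\<in>obj w'. \<forall>R\<in>obj w'. finrules w' S R \<longrightarrow> (\<exists>G\<in>obj w'. generates w' S R G))"
  unfolding NID_fin_def holds_sentence set_of_finitary_rules_def set_generated_def closed_subsets_def closed_under_def
    generates_def closed_def finrules_def
  by (simp add: holds_set_theory)

section \<open>Sets of rules\<close>

lemma finen_upair:
  assumes "upair w u x y" "u \<in> obj w" "x \<in> obj w" "y \<in> obj w"
  shows "finen w u"
proof -
  obtain o' where "omega w o'" by (rule omega_exists)
  then obtain z where z: "z \<in> obj w" "empt w z" unfolding omega_def induc_def using mem_obj by blast
  obtain s where s: "s \<in> obj w" "adjoin w s z x" using adjoin_exists[OF z(1) assms(3)] .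
  have fs: "finen w s" using finen_adjoin[OF finen_empty[OF z(2,1)] s(2,1) assms(3)] .
  have "mem w' i u \<longleftrightarrow> mem w' i s \<or> eql w' i y" if w': "w \<le> w'" for w' i
  proof -
    have u: "mem w' i u \<longleftrightarrow> eql w' i x \<or> eql w' i y" using assms(1) w' unfolding upair_def by blast
    have s': "mem w' i s \<longleftrightarrow> mem w' i z \<or> eql w' i x" using s(2) w' unfolding adjoin_def by blast
    have "eql w' i x" if "mem w' i z"
      using z(2) w' that absurd_atoms(2)[OF _ mem_obj(1)[OF that] obj_mono[OF assms(3) w']] unfolding empt_def by blast
    with u s' show ?thesis by blast
  qed
  then have "adjoin w u s y" unfolding adjoin_def by blast
  with fs show ?thesis using finen_adjoin assms by blast
qed

lemma binary_union_exists:
  assumes "a \<in> obj w" "b \<in> obj w"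
  obtains u where "u \<in> obj w" "\<And>w' x. w \<le> w' \<Longrightarrow> mem w' x u \<longleftrightarrow> mem w' x a \<or> mem w' x b"
proof -
  obtain t where t: "t \<in> obj w" "upair w t a b" by (rule upair_exists[OF assms])
  obtain u where u: "u \<in> obj w" "\<And>w' z. w \<le> w' \<Longrightarrow> mem w' z u \<longleftrightarrow> (\<exists>y. mem w' y t \<and> mem w' z y)"
    by (rule union_exists[OF t(1)]) (rule that)
  have "mem w' z u \<longleftrightarrow> mem w' z a \<or> mem w' z b" if w': "w \<le> w'" for w' z
  proof -
    have "mem w' y t \<longleftrightarrow> eql w' y a \<or> eql w' y b" for y using t(2) w' unfolding upair_def by blast
    moreover have "eql w' a a" "eql w' b b" using assms obj_mono[OF _ w'] eql_refl by blast+
    ultimately show ?thesis using u(2)[OF w'] mem_eql2 by blast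
  qed
  with u(1) that show thesis by blast
qed

text \<open>The first argument of \<open>Q\<close> is frozen to an object \<open>c\<close>, which
  joins the parameters. This allows Separation at the world where an index \<open>c\<close>
  appears.\<close>

lemma definable_inst:
  assumes "definable b w (\<lambda>w e. Q w (e 0) (e 1))" "c \<in> obj w"
  shows "definable b w (\<lambda>w e. Q w c (e 0))"
proof -
  from assms(1) obtain \<phi> p where *: "b \<longrightarrow> restricted \<phi>" "\<forall>i. p i \<in> obj w"
    "\<forall>w'\<ge>w. \<forall>e. (\<forall>i. e i \<in> obj w') \<longrightarrow> (sat w' (mix e p) \<phi> \<longleftrightarrow> Q w' (e 0) (e 1))"
    unfolding definable_def by blast
  \<comment> \<open>Index 3 reads \<open>c\<close>, the first entry of the second sequence in
    \<open>mix p (\<lambda>_. c)\<close>; the other variables all become \<open>e 0\<close>.\<close>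
  let ?h = "\<lambda>i. if even i then (if i = 0 then 3 else 0) else mix_fst i"
  have "mix e (mix p (\<lambda>_. c)) (?h i) = mix (\<lambda>n. if n = 0 then c else e 0) p i" for e i
  proof (cases "even i")
    case True
    then show ?thesis by (auto simp: mix_def elim!: evenE)
  next
    case False
    then have "mix e (mix p (\<lambda>_. c)) (?h i) = mix e p i" by (simp add: mix_mix_fst)
    with False show ?thesis by (simp add: mix_def)
  qed
  with * assms(2) show ?thesis
    by (intro definableI[of b "rename ?h \<phi>" "mix p (\<lambda>_. c)"])
      (simp_all add: restricted_rename sat_rename obj_mono mix_obj)
qed

text \<open>Separation yields each member at the world where its index appears, and
  \<open>family_exists\<close> collects the members.\<close>

lemma subset_family_exists:
  assumes "definable True w (\<lambda>w e. Q w (e 0) (e 1))" "I \<in> obj w" "X \<in> obj w"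
  obtains G where "G \<in> obj w" "\<And>w' y. w \<le> w' \<Longrightarrow> mem w' y G \<Longrightarrow> incl w' y X"
    "\<And>w' i. w \<le> w' \<Longrightarrow> mem w' i I \<Longrightarrow>
       \<exists>y. mem w' y G \<and> (\<forall>w''\<ge>w'. \<forall>z. mem w'' z y \<longleftrightarrow> mem w'' z X \<and> Q w'' i z)"
    "\<And>w' y. w \<le> w' \<Longrightarrow> mem w' y G \<Longrightarrow>
       \<exists>i. mem w' i I \<and> (\<forall>w''\<ge>w'. \<forall>z. mem w'' z y \<longleftrightarrow> mem w'' z X \<and> Q w'' i z)"
proof -
  let ?Q = "\<lambda>w i z. mem w z X \<and> Q w i z"
  have "definable False w (\<lambda>w e. Q w (e 0) (e 1))" using assms(1) unfolding definable_def by blast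
  then have 1: "definable False w (\<lambda>w e. ?Q w (e 0) (e 1))"
    using assms(3) by (intro definable_conj definable_mem tm_var tm_const)
  have 2: "\<exists>y\<in>obj w'. \<forall>w''\<ge>w'. \<forall>z\<in>obj w''. mem w'' z y \<longleftrightarrow> ?Q w'' i z" if w': "w \<le> w'" "mem w' i I" for w' i
  proof -
    have "definable True w' (\<lambda>w e. Q w i (e 0))"
      using definable_inst[OF definable_mono[OF assms(1) w'(1)] mem_obj(1)[OF w'(2)]] .
    note sep = separation_exists[where Q = "\<lambda>w. Q w i", OF this obj_mono[OF assms(3) w'(1)]]
    obtain y where "y \<in> obj w'" "\<And>w'' z. w' \<le> w'' \<Longrightarrow> mem w'' z y \<longleftrightarrow> ?Q w'' i z"
      by (rule sep) (rule that)
    then show ?thesis by blast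
  qed
  note fam = family_exists[where Q = ?Q, OF 1 assms(2) 2]
  obtain G where G: "G \<in> obj w" "\<And>w' y. w \<le> w' \<Longrightarrow> y \<in> obj w' \<Longrightarrow> mem w' y G \<longleftrightarrow>
      (\<exists>i. mem w' i I \<and> (\<forall>w''\<ge>w'. \<forall>z\<in>obj w''. mem w'' z y \<longleftrightarrow> ?Q w'' i z))"
    by (rule fam) (assumption, assumption, rule that)
  have drop: "(\<forall>w''\<ge>w'. \<forall>z\<in>obj w''. mem w'' z y \<longleftrightarrow> ?Q w'' i z) \<longleftrightarrow> (\<forall>w''\<ge>w'. \<forall>z. mem w'' z y \<longleftrightarrow> ?Q w'' i z)"
    for w' y i using mem_obj by blast
  have elim: "\<exists>i. mem w' i I \<and> (\<forall>w''\<ge>w'. \<forall>z. mem w'' z y \<longleftrightarrow> ?Q w'' i z)" if w': "w \<le> w'" "mem w' y G" for w' y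
    using G(2)[OF w'(1) mem_obj(1)[OF w'(2)]] w'(2) unfolding drop by blast
  show thesis
  proof (rule that[OF G(1)])
    fix w' y assume w': "w \<le> w'" "mem w' y G"
    show "\<exists>i. mem w' i I \<and> (\<forall>w''\<ge>w'. \<forall>z. mem w'' z y \<longleftrightarrow> ?Q w'' i z)" using elim[OF w'] .
    then show "incl w' y X" unfolding incl_def by blast
  next
    fix w' i assume w': "w \<le> w'" "mem w' i I"
    obtain y where y: "y \<in> obj w'" "\<forall>w''\<ge>w'. \<forall>z\<in>obj w''. mem w'' z y \<longleftrightarrow> ?Q w'' i z"
      using 2[OF w'] by blast
    then have "mem w' y G" using G(2)[OF w'(1) y(1)] w'(2) by blast
    with y show "\<exists>y. mem w' y G \<and> (\<forall>w''\<ge>w'. \<forall>z. mem w'' z y \<longleftrightarrow> ?Q w'' i z)" unfolding drop by blast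
  qed
qed

text \<open>The rules in \<open>R\<close> are the pairs \<open>({y1, y2}, {z \<in> X. K i z})\<close> with \<open>L i y1\<close> and \<open>M i y2\<close>.\<close>

lemma rule_set_exists:
  assumes K: "definable True w (\<lambda>w e. K w (e 0) (e 1))" and L: "definable True w (\<lambda>w e. L w (e 0) (e 1))"
    and M: "definable True w (\<lambda>w e. M w (e 0) (e 1))" and I: "I \<in> obj w" and X: "X \<in> obj w"
  obtains R where "R \<in> obj w" "finrules w X R"
    "\<And>w' \<alpha>. w \<le> w' \<Longrightarrow> \<alpha> \<in> obj w' \<Longrightarrow> closed w' X R \<alpha> \<longleftrightarrow> incl w' \<alpha> X \<and>
      (\<forall>w''\<ge>w'. \<forall>i y1 y2. mem w'' i I \<longrightarrow> mem w'' y1 \<alpha> \<longrightarrow> mem w'' y2 \<alpha> \<longrightarrow> L w'' i y1 \<longrightarrow> M w'' i y2 \<longrightarrow>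
        (\<exists>z. mem w'' z \<alpha> \<and> K w'' i z))"
proof -
  obtain F where F: "F \<in> obj w" "finsets w F X" by (rule finsets_exists[OF X])
  note fam = subset_family_exists[where Q = K, OF K I X]
  obtain B where B: "B \<in> obj w" "\<And>w' y. w \<le> w' \<Longrightarrow> mem w' y B \<Longrightarrow> incl w' y X"
    "\<And>w' i. w \<le> w' \<Longrightarrow> mem w' i I \<Longrightarrow> \<exists>y. mem w' y B \<and> (\<forall>w''\<ge>w'. \<forall>z. mem w'' z y \<longleftrightarrow> mem w'' z X \<and> K w'' i z)"
    by (rule fam) (rule that)
  \<comment> \<open>Restricted rendering of \<open>v = {z \<in> X. K i z}\<close>: the two
    inclusions quantify over \<open>v\<close> and over \<open>X\<close> only.\<close>
  let ?same = "\<lambda>w v i. (\<forall>w'\<ge>w. \<forall>z. mem w' z v \<longrightarrow> mem w' z X \<and> K w' i z) \<and>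
      (\<forall>w'\<ge>w. \<forall>z. mem w' z X \<longrightarrow> (\<forall>w''\<ge>w'. K w'' i z \<longrightarrow> mem w'' z v))"
  let ?Q = "\<lambda>w u v. \<exists>i. mem w i I \<and> (\<exists>y1. mem w y1 X \<and> (\<exists>y2. mem w y2 X \<and> upair w u y1 y2 \<and>
      L w i y1 \<and> M w i y2 \<and> ?same w v i))"
  have "definable True w (\<lambda>w e. K w (e 3) (e 0))" "definable True w (\<lambda>w e. L w (e 2) (e 1))" "definable True w (\<lambda>w e. M w (e 2) (e 0))"
    using definable_rename[OF K, of "\<lambda>i. if i = 0 then 3 else 0"]
      definable_rename[OF L, of "\<lambda>i. if i = 0 then 2 else 1"]
      definable_rename[OF M, of "\<lambda>i. if i = 0 then 2 else 0"] by simp_all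
  then have "definable True w (\<lambda>w e. ?Q w (e 0) (e 1))"
    using I X by (intro definable_intros definable_upair) (simp_all add: numeral_2_eq_2 numeral_3_eq_3)
  note rel = relation_exists[where Q = ?Q, OF this F(1) B(1)]
  obtain R where R: "R \<in> obj w" "isrel w R F B" and
    R': "\<And>w' u v. w \<le> w' \<Longrightarrow> u \<in> obj w' \<Longrightarrow> v \<in> obj w' \<Longrightarrow> rl w' R u v \<longleftrightarrow> mem w' u F \<and> mem w' v B \<and> ?Q w' u v"
    by (rule rel) (rule that)
  have "finrules w X R"
    unfolding finrules_def
  proof (intro allI impI)
    fix w' p assume w': "w \<le> w'" "mem w' p R"
    then obtain a b where ab: "mem w' a F" "mem w' b B" "opair w' p a b" using R(2) unfolding isrel_def by blast
    have "incl w' a X" "finen w' a" "incl w' b X" using finsets_mem[OF F(2) w'(1) ab(1)] B(2)[OF w'(1) ab(2)] by blast+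
    with ab mem_obj show "\<exists>a\<in>obj w'. \<exists>b\<in>obj w'. opair w' p a b \<and> incl w' a X \<and> incl w' b X \<and> finen w' a" by blast
  qed
  moreover have "closed w' X R \<alpha> \<longleftrightarrow> incl w' \<alpha> X \<and>
      (\<forall>w''\<ge>w'. \<forall>i y1 y2. mem w'' i I \<longrightarrow> mem w'' y1 \<alpha> \<longrightarrow> mem w'' y2 \<alpha> \<longrightarrow> L w'' i y1 \<longrightarrow> M w'' i y2 \<longrightarrow>
        (\<exists>z. mem w'' z \<alpha> \<and> K w'' i z))" (is "?C \<longleftrightarrow> _ \<and> ?D") if w': "w \<le> w'" "\<alpha> \<in> obj w'" for w' \<alpha>
  proof -
    have "?C \<longleftrightarrow> ?D" if \<alpha>: "incl w' \<alpha> X"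
    proof
      assume C: ?C
      show ?D
      proof (intro allI impI)
        fix v i y1 y2
        assume *: "w' \<le> v" "mem v i I" "mem v y1 \<alpha>" "mem v y2 \<alpha>" "L v i y1" "M v i y2"
        have wv: "w \<le> v" using w'(1) *(1) by (rule order_trans)
        obtain b where b: "mem v b B" "\<forall>w''\<ge>v. \<forall>z. mem w'' z b \<longleftrightarrow> mem w'' z X \<and> K w'' i z"
          using B(3)[OF wv *(2)] by blast
        have yo: "y1 \<in> obj v" "y2 \<in> obj v" using *(3,4) mem_obj(1) by blast+
        obtain u where u: "u \<in> obj v" "upair v u y1 y2" by (rule upair_exists[OF yo])
        have u': "mem v' z u \<longleftrightarrow> eql v' z y1 \<or> eql v' z y2" if "v \<le> v'" for v' z
          using u(2) that unfolding upair_def by blast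
        have u\<alpha>: "incl v u \<alpha>"
          unfolding incl_def
        proof (intro allI impI)
          fix v' z assume v': "v \<le> v'" "mem v' z u"
          then have "eql v' y1 z \<or> eql v' y2 z" using u' eql_sym by blast
          then show "mem v' z \<alpha>" using mem_mono[OF *(3) v'(1)] mem_mono[OF *(4) v'(1)] mem_eql1 by blast
        qed
        have \<alpha>': "incl v \<alpha> X" using \<alpha> *(1) by (rule incl_mono)
        have uX: "incl v u X" using u\<alpha> \<alpha>' by (rule incl_trans)
        have "mem v u F" using F(2) wv u(1) uX finen_upair[OF u(2,1) yo] unfolding finsets_def by blast
        moreover have "?same v b i"
        proof (intro conjI allI impI)
          fix v1 z v2 assume z: "v \<le> v1" "mem v1 z X" "v1 \<le> v2" "K v2 i z"
          show "mem v2 z b" using b(2)[rule_format, OF order_trans[OF z(1,3)]] mem_mono[OF z(2,3)] z(4) by blast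
        qed (use b(2) in blast)+
        moreover have "mem v y1 X" "mem v y2 X" using incl_mem[OF \<alpha>'] *(3,4) by blast+
        ultimately have "rl v R u b" using R'[OF wv u(1) mem_obj(1)[OF b(1)]] b(1) * u(2) by blast
        then have "\<exists>x. mem v x b \<and> mem v x \<alpha>"
          using C *(1) u\<alpha> u(1) mem_obj(1)[OF b(1)] unfolding closed_def by blast
        with b(2) show "\<exists>z. mem v z \<alpha> \<and> K v i z" by blast
      qed
    next
      assume D: ?D
      have "\<exists>x. mem v' x b \<and> mem v' x \<alpha>"
        if *: "w' \<le> v" "a \<in> obj v" "b \<in> obj v" "rl v R a b" "v \<le> v'" "incl v' a \<alpha>" for v v' a b
      proof -
        have wv: "w \<le> v" "w' \<le> v'" using order_trans[OF w'(1) *(1)] order_trans[OF *(1,5)] by blast+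
        have wv': "w \<le> v'" using wv(1) *(5) by (rule order_trans)
        from R'[OF wv' obj_mono[OF *(2,5)] obj_mono[OF *(3,5)]] rl_mono[OF *(4,5)]
        obtain i y1 y2 where i: "mem v' i I" "mem v' y1 X" "mem v' y2 X" "upair v' a y1 y2" "L v' i y1" "M v' i y2" "?same v' b i"
          by blast
        have "mem v' y1 a" "mem v' y2 a" using upair_mem[OF i(4)] i(2,3) mem_obj(1) by blast+
        then have "mem v' y1 \<alpha>" "mem v' y2 \<alpha>" using incl_mem[OF *(6)] by blast+
        then obtain z where z: "mem v' z \<alpha>" "K v' i z" using D wv(2) i by blast
        have "mem v' z X" using incl_mem[OF incl_mono[OF \<alpha> wv(2)] z(1)] .
        with i(7) z show ?thesis by blast
      qed
      with \<alpha> show ?C unfolding closed_def by blast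
    qed
    then show ?thesis unfolding closed_def by blast
  qed
  ultimately show thesis using that R(1) by blast
qed

lemma closed_union:
  assumes "\<And>w' p. w \<le> w' \<Longrightarrow> mem w' p R \<longleftrightarrow> mem w' p R1 \<or> mem w' p R2"
  shows "closed w X R \<alpha> \<longleftrightarrow> closed w X R1 \<alpha> \<and> closed w X R2 \<alpha>"
proof -
  have "rl w' R a b \<longleftrightarrow> rl w' R1 a b \<or> rl w' R2 a b" if "w \<le> w'" for w' a b
    using assms[OF that] unfolding rl_def by blast
  then show ?thesis unfolding closed_def by blast
qed

lemma finrules_union:
  assumes "\<And>w' p. w \<le> w' \<Longrightarrow> mem w' p R \<longleftrightarrow> mem w' p R1 \<or> mem w' p R2" "finrules w X R1" "finrules w X R2"
  shows "finrules w X R"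
  using assms unfolding finrules_def by blast

section \<open>Equalised ideal points as closed sets of rules\<close>

lemma cspaceD:
  assumes "cspace w X V S" "w \<le> w'"
  shows "isrel w' V X S"
    "mem w' x X \<Longrightarrow> \<exists>a. mem w' a S \<and> rl w' V x a"
    "mem w' a S \<Longrightarrow> mem w' b S \<Longrightarrow> mem w' x X \<Longrightarrow> rl w' V x a \<Longrightarrow> rl w' V x b \<Longrightarrow>
      \<exists>c. mem w' c S \<and> rl w' V x c \<and> below w' X V c a b"
    "rl w' V x a \<Longrightarrow> x \<in> obj w' \<Longrightarrow> a \<in> obj w' \<Longrightarrow> mem w' x X \<and> mem w' a S"
proof -
  show 1: "isrel w' V X S" using assms isrel_mono unfolding cspace_def by blast
  show "rl w' V x a \<Longrightarrow> x \<in> obj w' \<Longrightarrow> a \<in> obj w' \<Longrightarrow> mem w' x X \<and> mem w' a S"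
    using isrel_rl[OF 1] by blast
  show "mem w' x X \<Longrightarrow> \<exists>a. mem w' a S \<and> rl w' V x a"
    using assms unfolding cspace_def by blast
  show "mem w' a S \<Longrightarrow> mem w' b S \<Longrightarrow> mem w' x X \<Longrightarrow> rl w' V x a \<Longrightarrow> rl w' V x b \<Longrightarrow>
      \<exists>c. mem w' c S \<and> rl w' V x c \<and> below w' X V c a b"
    using assms unfolding cspace_def by blast
qed

lemma cspace_mono: "cspace w X V S \<Longrightarrow> w \<le> w' \<Longrightarrow> cspace w' X V S"
  unfolding cspace_def
  by (elim conjE) (intro conjI, erule (1) isrel_mono, (erule (1) forall_ge_mono)+)

lemma belowD: "below w X V c a b \<Longrightarrow> w \<le> w' \<Longrightarrow> mem w' x X \<Longrightarrow> rl w' V x c \<Longrightarrow> rl w' V x a \<and> rl w' V x b"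
  unfolding below_def by blast

lemma arrD:
  assumes "arr w X1 V1 S1 X2 V2 S2 r s" "w \<le> w'"
  shows "isrel w' r X1 X2" "isrel w' s S1 S2"
    "x \<in> obj w' \<Longrightarrow> z \<in> obj w' \<Longrightarrow> rcomp w' r V2 x z \<longleftrightarrow> rcomp w' V1 s x z"
    "mem w' x X1 \<Longrightarrow> \<exists>y\<in>obj w'. rl w' r x y"
    "mem w' a S2 \<Longrightarrow> mem w' b S2 \<Longrightarrow> mem w' x X1 \<Longrightarrow> rcomp w' r V2 x a \<Longrightarrow> rcomp w' r V2 x b \<Longrightarrow>
      \<exists>c. mem w' c S2 \<and> below w' X2 V2 c a b \<and> rcomp w' r V2 x c"
    "rl w' r x y \<Longrightarrow> x \<in> obj w' \<Longrightarrow> y \<in> obj w' \<Longrightarrow> mem w' x X1 \<and> mem w' y X2"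
    "rl w' s a b \<Longrightarrow> a \<in> obj w' \<Longrightarrow> b \<in> obj w' \<Longrightarrow> mem w' a S1 \<and> mem w' b S2"
proof -
  note * = assms[unfolded arr_def]
  show 1: "isrel w' r X1 X2" "isrel w' s S1 S2" using assms isrel_mono unfolding arr_def by blast+
  show "rl w' r x y \<Longrightarrow> x \<in> obj w' \<Longrightarrow> y \<in> obj w' \<Longrightarrow> mem w' x X1 \<and> mem w' y X2"
    using isrel_rl[OF 1(1)] by blast
  show "rl w' s a b \<Longrightarrow> a \<in> obj w' \<Longrightarrow> b \<in> obj w' \<Longrightarrow> mem w' a S1 \<and> mem w' b S2"
    using isrel_rl[OF 1(2)] by blast
  show "x \<in> obj w' \<Longrightarrow> z \<in> obj w' \<Longrightarrow> rcomp w' r V2 x z \<longleftrightarrow> rcomp w' V1 s x z"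
    using * by blast
  show "mem w' x X1 \<Longrightarrow> \<exists>y\<in>obj w'. rl w' r x y"
    using * by blast
  show "mem w' a S2 \<Longrightarrow> mem w' b S2 \<Longrightarrow> mem w' x X1 \<Longrightarrow> rcomp w' r V2 x a \<Longrightarrow> rcomp w' r V2 x b \<Longrightarrow>
      \<exists>c. mem w' c S2 \<and> below w' X2 V2 c a b \<and> rcomp w' r V2 x c"
    using * by blast
qed

text \<open>A subset of \<open>X1\<close> closed under the rules \<open>({y1, y2}, ext a \<inter> ext b)\<close>, for \<open>y1 \<in> ext a\<close> and
  \<open>y2 \<in> ext b\<close>, and \<open>({y}, r'\<^sup>- (ext b))\<close>, for \<open>y \<in> r\<^sup>- (ext b)\<close>, and the latter with \<open>r\<close> and \<open>r'\<close>
  exchanged.\<close>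

definition eqpoint :: "world \<Rightarrow> nat \<Rightarrow> nat \<Rightarrow> nat \<Rightarrow> nat \<Rightarrow> nat \<Rightarrow> nat \<Rightarrow> bool" where
  "eqpoint w V1 V2 r r' X1 \<alpha> \<longleftrightarrow> incl w \<alpha> X1 \<and>
     (\<forall>w'\<ge>w. \<forall>y1 y2 a b. mem w' y1 \<alpha> \<longrightarrow> mem w' y2 \<alpha> \<longrightarrow> a \<in> obj w' \<longrightarrow> b \<in> obj w' \<longrightarrow> rl w' V1 y1 a \<longrightarrow> rl w' V1 y2 b \<longrightarrow>
        (\<exists>z. mem w' z \<alpha> \<and> rl w' V1 z a \<and> rl w' V1 z b)) \<and>
     (\<forall>w'\<ge>w. \<forall>y b. mem w' y \<alpha> \<longrightarrow> b \<in> obj w' \<longrightarrow> rcomp w' r V2 y b \<longrightarrow> (\<exists>z. mem w' z \<alpha> \<and> rcomp w' r' V2 z b)) \<and>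
     (\<forall>w'\<ge>w. \<forall>y b. mem w' y \<alpha> \<longrightarrow> b \<in> obj w' \<longrightarrow> rcomp w' r' V2 y b \<longrightarrow> (\<exists>z. mem w' z \<alpha> \<and> rcomp w' r V2 z b))"

text \<open>Here \<open>rule_set_exists\<close> is applied with index \<open>b\<close> in
  \<open>S2\<close> and with the same condition on both premises. The case \<open>y1 = y2\<close> is
  the rule with one premise, and that rule implies the general case.\<close>

lemma image_rules_exist:
  assumes r: "isrel w r X1 X2" and r': "isrel w r' X1 X2" and V2: "isrel w V2 X2 S2"
    and o: "X1 \<in> obj w" "V2 \<in> obj w" "X2 \<in> obj w" "S2 \<in> obj w" "r \<in> obj w" "r' \<in> obj w"
  obtains R where "R \<in> obj w" "finrules w X1 R"
    "\<And>w' \<alpha>. w \<le> w' \<Longrightarrow> \<alpha> \<in> obj w' \<Longrightarrow> closed w' X1 R \<alpha> \<longleftrightarrow> incl w' \<alpha> X1 \<and>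
       (\<forall>v\<ge>w'. \<forall>y b. mem v y \<alpha> \<longrightarrow> b \<in> obj v \<longrightarrow> rcomp v r V2 y b \<longrightarrow> (\<exists>z. mem v z \<alpha> \<and> rcomp v r' V2 z b))"
proof -
  \<comment> \<open>This is \<open>rcomp\<close> with the middle point bounded by \<open>X2\<close>,
    so as to be restricted.\<close>
  let ?c = "\<lambda>r w b y. \<exists>u. mem w u X2 \<and> rl w r y u \<and> rl w V2 u b"
  have c: "rcomp w' q V2 y b \<longleftrightarrow> ?c q w' b y"
    if "isrel w q X1 X2" "w \<le> w'" "y \<in> obj w'" "b \<in> obj w'" for q w' y b
    unfolding rcomp_def using isrel_rl[OF isrel_mono[OF that(1,2)]] that(3) mem_obj by blast
  have d: "definable True w (\<lambda>w e. ?c q w (e 0) (e 1))" if "q \<in> obj w" for q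
    using o that by (intro definable_intros)
  note rules = rule_set_exists[where K = "?c r'" and L = "?c r" and M = "?c r", OF d[OF o(6)] d[OF o(5)] d[OF o(5)] o(4,1)]
  obtain R where R: "R \<in> obj w" "finrules w X1 R"
    "\<And>w' \<alpha>. w \<le> w' \<Longrightarrow> \<alpha> \<in> obj w' \<Longrightarrow> closed w' X1 R \<alpha> \<longleftrightarrow> incl w' \<alpha> X1 \<and>
      (\<forall>v\<ge>w'. \<forall>i y1 y2. mem v i S2 \<longrightarrow> mem v y1 \<alpha> \<longrightarrow> mem v y2 \<alpha> \<longrightarrow> ?c r v i y1 \<longrightarrow> ?c r v i y2 \<longrightarrow>
        (\<exists>z. mem v z \<alpha> \<and> ?c r' v i z))"
    by (rule rules) (rule that)
  show thesis
  proof (rule that[OF R(1,2)])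
    fix w' \<alpha> assume w': "w \<le> w'" "\<alpha> \<in> obj w'"
    have bS: "mem v b S2" if "w \<le> v" "rcomp v q V2 y b" "b \<in> obj v" for q v y b
      using that isrel_rl[OF isrel_mono[OF V2 that(1)]] unfolding rcomp_def by blast
    have "(\<forall>i y1 y2. mem v i S2 \<longrightarrow> mem v y1 \<alpha> \<longrightarrow> mem v y2 \<alpha> \<longrightarrow> ?c r v i y1 \<longrightarrow> ?c r v i y2 \<longrightarrow>
        (\<exists>z. mem v z \<alpha> \<and> ?c r' v i z)) \<longleftrightarrow>
      (\<forall>y b. mem v y \<alpha> \<longrightarrow> b \<in> obj v \<longrightarrow> rcomp v r V2 y b \<longrightarrow> (\<exists>z. mem v z \<alpha> \<and> rcomp v r' V2 z b))" (is "?L \<longleftrightarrow> ?R")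
      if v: "w \<le> v" for v
    proof
      assume L: ?L
      show ?R
      proof (intro allI impI)
        fix y b assume *: "mem v y \<alpha>" "b \<in> obj v" "rcomp v r V2 y b"
        have "?c r v b y" using c[OF r v mem_obj(1)[OF *(1)] *(2)] *(3) by blast
        with L *(1) bS[OF v *(3,2)] obtain z where z: "mem v z \<alpha>" "?c r' v b z" by blast
        then show "\<exists>z. mem v z \<alpha> \<and> rcomp v r' V2 z b" using c[OF r' v mem_obj(1)[OF z(1)] *(2)] by blast
      qed
    next
      assume R: ?R
      show ?L
      proof (intro allI impI)
        fix i y1 y2 assume *: "mem v i S2" "mem v y1 \<alpha>" "?c r v i y1"
        have i: "i \<in> obj v" using *(1) by (rule mem_obj)
        have "rcomp v r V2 y1 i" using c[OF r v mem_obj(1)[OF *(2)] i] *(3) by blast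
        with R *(2) i obtain z where z: "mem v z \<alpha>" "rcomp v r' V2 z i" by blast
        then show "\<exists>z. mem v z \<alpha> \<and> ?c r' v i z" using c[OF r' v mem_obj(1)[OF z(1)] i] by blast
      qed
    qed
    then show "closed w' X1 R \<alpha> \<longleftrightarrow> incl w' \<alpha> X1 \<and>
       (\<forall>v\<ge>w'. \<forall>y b. mem v y \<alpha> \<longrightarrow> b \<in> obj v \<longrightarrow> rcomp v r V2 y b \<longrightarrow> (\<exists>z. mem v z \<alpha> \<and> rcomp v r' V2 z b))"
      unfolding R(3)[OF w'] using order_trans[OF w'(1)] by simp
  qed
qed

text \<open>The rules are indexed by pairs \<open>(a, b)\<close> of basic neighbourhoods;
  injectivity of pairing recovers \<open>a\<close> and \<open>b\<close> from the index.\<close>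

lemma filter_rules_exist:
  assumes V1: "isrel w V1 X1 S1" and o: "X1 \<in> obj w" "V1 \<in> obj w" "S1 \<in> obj w"
  obtains R where "R \<in> obj w" "finrules w X1 R"
    "\<And>w' \<alpha>. w \<le> w' \<Longrightarrow> \<alpha> \<in> obj w' \<Longrightarrow> closed w' X1 R \<alpha> \<longleftrightarrow> incl w' \<alpha> X1 \<and>
       (\<forall>v\<ge>w'. \<forall>y1 y2 a b. mem v y1 \<alpha> \<longrightarrow> mem v y2 \<alpha> \<longrightarrow> a \<in> obj v \<longrightarrow> b \<in> obj v \<longrightarrow> rl v V1 y1 a \<longrightarrow> rl v V1 y2 b \<longrightarrow>
        (\<exists>z. mem v z \<alpha> \<and> rl v V1 z a \<and> rl v V1 z b))"
proof -
  obtain P where P: "P \<in> obj w"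
    "\<And>w' p. w \<le> w' \<Longrightarrow> p \<in> obj w' \<Longrightarrow> mem w' p P \<longleftrightarrow> (\<exists>a b. mem w' a S1 \<and> mem w' b S1 \<and> opair w' p a b)"
    by (rule product_exists[OF o(3,3)]) (rule that)
  let ?L = "\<lambda>w i y. \<exists>a. mem w a S1 \<and> (\<exists>b. mem w b S1 \<and> opair w i a b \<and> rl w V1 y a)"
  let ?M = "\<lambda>w i y. \<exists>a. mem w a S1 \<and> (\<exists>b. mem w b S1 \<and> opair w i a b \<and> rl w V1 y b)"
  let ?K = "\<lambda>w i z. ?L w i z \<and> ?M w i z"
  have L: "definable True w (\<lambda>w e. ?L w (e 0) (e 1))" using o by (intro definable_intros)
  have M: "definable True w (\<lambda>w e. ?M w (e 0) (e 1))" using o by (intro definable_intros)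
  note rules = rule_set_exists[where K = ?K and L = ?L and M = ?M, OF definable_conj[OF L M] L M P(1) o(1)]
  obtain R where R: "R \<in> obj w" "finrules w X1 R"
    "\<And>w' \<alpha>. w \<le> w' \<Longrightarrow> \<alpha> \<in> obj w' \<Longrightarrow> closed w' X1 R \<alpha> \<longleftrightarrow> incl w' \<alpha> X1 \<and>
      (\<forall>v\<ge>w'. \<forall>i y1 y2. mem v i P \<longrightarrow> mem v y1 \<alpha> \<longrightarrow> mem v y2 \<alpha> \<longrightarrow> ?L v i y1 \<longrightarrow> ?M v i y2 \<longrightarrow>
        (\<exists>z. mem v z \<alpha> \<and> ?K v i z))"
    by (rule rules) (rule that)
  show thesis
  proof (rule that[OF R(1,2)])
    fix w' \<alpha> assume w': "w \<le> w'" "\<alpha> \<in> obj w'"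
    have "(\<forall>i y1 y2. mem v i P \<longrightarrow> mem v y1 \<alpha> \<longrightarrow> mem v y2 \<alpha> \<longrightarrow> ?L v i y1 \<longrightarrow> ?M v i y2 \<longrightarrow>
        (\<exists>z. mem v z \<alpha> \<and> ?K v i z)) \<longleftrightarrow>
      (\<forall>y1 y2 a b. mem v y1 \<alpha> \<longrightarrow> mem v y2 \<alpha> \<longrightarrow> a \<in> obj v \<longrightarrow> b \<in> obj v \<longrightarrow> rl v V1 y1 a \<longrightarrow> rl v V1 y2 b \<longrightarrow>
        (\<exists>z. mem v z \<alpha> \<and> rl v V1 z a \<and> rl v V1 z b))" (is "?lhs \<longleftrightarrow> ?rhs")
      if v: "w \<le> v" for v
    proof -
      have pairs: "(?L v i y \<longleftrightarrow> rl v V1 y a) \<and> (?M v i y \<longleftrightarrow> rl v V1 y b)"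
        if i: "mem v a S1" "mem v b S1" "opair v i a b" "y \<in> obj v" for i a b y
      proof -
        have "eql v a' a \<and> eql v b' b" if "mem v a' S1" "mem v b' S1" "opair v i a' b'" for a' b'
          using opair_inject[OF that(3) i(3)] mem_obj(1) that i by blast
        then show ?thesis using i rl_eql[OF _ eql_refl[OF i(4)]] by blast
      qed
      show ?thesis
      proof
        assume lhs: ?lhs
        show ?rhs
        proof (intro allI impI)
          fix y1 y2 a b assume *: "mem v y1 \<alpha>" "mem v y2 \<alpha>" "a \<in> obj v" "b \<in> obj v" "rl v V1 y1 a" "rl v V1 y2 b"
          have y: "y1 \<in> obj v" "y2 \<in> obj v" using *(1,2) mem_obj(1) by blast+
          have ab: "mem v a S1" "mem v b S1"
            using isrel_rl(2)[OF isrel_mono[OF V1 v]] * y by blast+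
          obtain i where i: "i \<in> obj v" "opair v i a b" by (rule opair_exists[OF *(3,4)])
          have "mem v i P" using P(2)[OF v i(1)] ab i(2) by blast
          moreover have "?L v i y1" using pairs[OF ab i(2) y(1)] *(5) by blast
          moreover have "?M v i y2" using pairs[OF ab i(2) y(2)] *(6) by blast
          ultimately have "\<exists>z. mem v z \<alpha> \<and> ?K v i z"
            using lhs[THEN spec, THEN spec, THEN spec, THEN mp, THEN mp, THEN mp, THEN mp, THEN mp, OF _ *(1,2)] by simp
          then obtain z where z: "mem v z \<alpha>" "?K v i z" by (rule exE) (erule conjE, rule that)
          then show "\<exists>z. mem v z \<alpha> \<and> rl v V1 z a \<and> rl v V1 z b"
            using pairs[OF ab i(2) mem_obj(1)[OF z(1)]] by blast
        qed
      next
        assume rhs: ?rhs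
        show ?lhs
        proof (intro allI impI)
          fix i y1 y2 assume *: "mem v i P" "mem v y1 \<alpha>" "mem v y2 \<alpha>" "?L v i y1" "?M v i y2"
          obtain a b where ab: "mem v a S1" "mem v b S1" "opair v i a b"
            using P(2)[OF v mem_obj(1)[OF *(1)]] *(1) by blast
          have "rl v V1 y1 a" "rl v V1 y2 b"
            using pairs[OF ab mem_obj(1)[OF *(2)]] pairs[OF ab mem_obj(1)[OF *(3)]] *(4,5) by blast+
          then obtain z where z: "mem v z \<alpha>" "rl v V1 z a" "rl v V1 z b"
            using rhs *(2,3) mem_obj(1)[OF ab(1)] mem_obj(1)[OF ab(2)] by blast
          then show "\<exists>z. mem v z \<alpha> \<and> ?K v i z" using pairs[OF ab mem_obj(1)[OF z(1)]] by blast
        qed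
      qed
    qed
    then show "closed w' X1 R \<alpha> \<longleftrightarrow> incl w' \<alpha> X1 \<and>
       (\<forall>v\<ge>w'. \<forall>y1 y2 a b. mem v y1 \<alpha> \<longrightarrow> mem v y2 \<alpha> \<longrightarrow> a \<in> obj v \<longrightarrow> b \<in> obj v \<longrightarrow> rl v V1 y1 a \<longrightarrow> rl v V1 y2 b \<longrightarrow>
        (\<exists>z. mem v z \<alpha> \<and> rl v V1 z a \<and> rl v V1 z b))"
      unfolding R(3)[OF w'] using order_trans[OF w'(1)] by simp
  qed
qed

lemma eqpoint_rules_exist:
  assumes A: "cspace w X1 V1 S1" and B: "cspace w X2 V2 S2"
    and f: "isrel w r X1 X2" and g: "isrel w r' X1 X2"
    and o: "X1 \<in> obj w" "V1 \<in> obj w" "S1 \<in> obj w" "X2 \<in> obj w" "V2 \<in> obj w" "S2 \<in> obj w" "r \<in> obj w" "r' \<in> obj w"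
  obtains R where "R \<in> obj w" "finrules w X1 R"
    "\<And>w' \<alpha>. w \<le> w' \<Longrightarrow> \<alpha> \<in> obj w' \<Longrightarrow> closed w' X1 R \<alpha> \<longleftrightarrow> eqpoint w' V1 V2 r r' X1 \<alpha>"
proof -
  note rules1 = filter_rules_exist[OF cspaceD(1)[OF A order_refl] o(1,2,3)]
  obtain R1 where R1: "R1 \<in> obj w" "finrules w X1 R1" 
    "\<And>w' \<alpha>. w \<le> w' \<Longrightarrow> \<alpha> \<in> obj w' \<Longrightarrow> closed w' X1 R1 \<alpha> \<longleftrightarrow> incl w' \<alpha> X1 \<and>
       (\<forall>v\<ge>w'. \<forall>y1 y2 a b. mem v y1 \<alpha> \<longrightarrow> mem v y2 \<alpha> \<longrightarrow> a \<in> obj v \<longrightarrow> b \<in> obj v \<longrightarrow> rl v V1 y1 a \<longrightarrow> rl v V1 y2 b \<longrightarrow>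
        (\<exists>z. mem v z \<alpha> \<and> rl v V1 z a \<and> rl v V1 z b))"
    by (rule rules1) (rule that)
  note rules2 = image_rules_exist[OF f g cspaceD(1)[OF B order_refl] o(1,5,4,6,7,8)]
  obtain R2 where R2: "R2 \<in> obj w" "finrules w X1 R2"
    "\<And>w' \<alpha>. w \<le> w' \<Longrightarrow> \<alpha> \<in> obj w' \<Longrightarrow> closed w' X1 R2 \<alpha> \<longleftrightarrow> incl w' \<alpha> X1 \<and>
       (\<forall>v\<ge>w'. \<forall>y b. mem v y \<alpha> \<longrightarrow> b \<in> obj v \<longrightarrow> rcomp v r V2 y b \<longrightarrow> (\<exists>z. mem v z \<alpha> \<and> rcomp v r' V2 z b))"
    by (rule rules2) (rule that)
  note rules3 = image_rules_exist[OF g f cspaceD(1)[OF B order_refl] o(1,5,4,6,8,7)]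
  obtain R3 where R3: "R3 \<in> obj w" "finrules w X1 R3"
    "\<And>w' \<alpha>. w \<le> w' \<Longrightarrow> \<alpha> \<in> obj w' \<Longrightarrow> closed w' X1 R3 \<alpha> \<longleftrightarrow> incl w' \<alpha> X1 \<and>
       (\<forall>v\<ge>w'. \<forall>y b. mem v y \<alpha> \<longrightarrow> b \<in> obj v \<longrightarrow> rcomp v r' V2 y b \<longrightarrow> (\<exists>z. mem v z \<alpha> \<and> rcomp v r V2 z b))"
    by (rule rules3) (rule that)
  obtain R' where R': "R' \<in> obj w" "\<And>w' x. w \<le> w' \<Longrightarrow> mem w' x R' \<longleftrightarrow> mem w' x R1 \<or> mem w' x R2"
    by (rule binary_union_exists[OF R1(1) R2(1)]) (rule that)
  obtain R where R: "R \<in> obj w" "\<And>w' x. w \<le> w' \<Longrightarrow> mem w' x R \<longleftrightarrow> mem w' x R' \<or> mem w' x R3"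
    by (rule binary_union_exists[OF R'(1) R3(1)]) (rule that)
  show thesis
  proof (rule that[OF R(1)])
    have R'f: "finrules w X1 R'" by (rule finrules_union[OF R'(2) R1(2) R2(2)])
    show "finrules w X1 R" by (rule finrules_union[OF R(2) R'f R3(2)])
    fix w' \<alpha> assume w': "w \<le> w'" "\<alpha> \<in> obj w'"
    have "closed w' X1 R \<alpha> \<longleftrightarrow> closed w' X1 R' \<alpha> \<and> closed w' X1 R3 \<alpha>"
      by (rule closed_union) (use R(2) order_trans[OF w'(1)] in blast)
    moreover have "closed w' X1 R' \<alpha> \<longleftrightarrow> closed w' X1 R1 \<alpha> \<and> closed w' X1 R2 \<alpha>"
      by (rule closed_union) (use R'(2) order_trans[OF w'(1)] in blast)
    ultimately show "closed w' X1 R \<alpha> \<longleftrightarrow> eqpoint w' V1 V2 r r' X1 \<alpha>"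
      unfolding eqpoint_def R1(3)[OF w'] R2(3)[OF w'] R3(3)[OF w'] by blast
  qed
qed

lemma eqpointD:
  assumes "eqpoint w V1 V2 r r' X1 \<alpha>" "w \<le> w'"
  shows "incl w' \<alpha> X1"
    "mem w' y1 \<alpha> \<Longrightarrow> mem w' y2 \<alpha> \<Longrightarrow> a \<in> obj w' \<Longrightarrow> b \<in> obj w' \<Longrightarrow> rl w' V1 y1 a \<Longrightarrow> rl w' V1 y2 b \<Longrightarrow>
      \<exists>z. mem w' z \<alpha> \<and> rl w' V1 z a \<and> rl w' V1 z b"
    "mem w' y \<alpha> \<Longrightarrow> b \<in> obj w' \<Longrightarrow> rcomp w' r V2 y b \<Longrightarrow> \<exists>z. mem w' z \<alpha> \<and> rcomp w' r' V2 z b"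
    "mem w' y \<alpha> \<Longrightarrow> b \<in> obj w' \<Longrightarrow> rcomp w' r' V2 y b \<Longrightarrow> \<exists>z. mem w' z \<alpha> \<and> rcomp w' r V2 z b"
proof -
  show "incl w' \<alpha> X1" using assms incl_mono unfolding eqpoint_def by blast
  note * = assms[unfolded eqpoint_def]
  show "mem w' y1 \<alpha> \<Longrightarrow> mem w' y2 \<alpha> \<Longrightarrow> a \<in> obj w' \<Longrightarrow> b \<in> obj w' \<Longrightarrow> rl w' V1 y1 a \<Longrightarrow> rl w' V1 y2 b \<Longrightarrow>
      \<exists>z. mem w' z \<alpha> \<and> rl w' V1 z a \<and> rl w' V1 z b" using * by blast
  show "mem w' y \<alpha> \<Longrightarrow> b \<in> obj w' \<Longrightarrow> rcomp w' r V2 y b \<Longrightarrow> \<exists>z. mem w' z \<alpha> \<and> rcomp w' r' V2 z b" using * by blast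
  show "mem w' y \<alpha> \<Longrightarrow> b \<in> obj w' \<Longrightarrow> rcomp w' r' V2 y b \<Longrightarrow> \<exists>z. mem w' z \<alpha> \<and> rcomp w' r V2 z b" using * by blast
qed

section \<open>Equalisers from generated classes\<close>

text \<open>The points of the equaliser are the inhabited members of the generating set
  \<open>G\<close>, and its basic neighbourhoods are those of \<open>X1\<close>: a point
  \<open>D\<close> lies in \<open>a\<close> when some element of \<open>D\<close> does.
  \<open>pe\<close> relates \<open>D\<close> to its elements and \<open>qe\<close> is the identity
  of \<open>S1\<close>. Inhabitedness gives every point a neighbourhood.\<close>

locale generated_equaliser =
  fixes w X1 V1 S1 X2 V2 S2 r s r' s' G XE VE pe qe
  assumes A: "cspace w X1 V1 S1" and B: "cspace w X2 V2 S2"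
    and f: "arr w X1 V1 S1 X2 V2 S2 r s" and g: "arr w X1 V1 S1 X2 V2 S2 r' s'"
    and X1_obj: "X1 \<in> obj w" and V1_obj: "V1 \<in> obj w" and S1_obj: "S1 \<in> obj w" and XE_obj: "XE \<in> obj w"
    and G_sound: "\<And>w' D. w \<le> w' \<Longrightarrow> mem w' D G \<Longrightarrow> eqpoint w' V1 V2 r r' X1 D"
    and G_generates: "\<And>w' \<alpha> x. w \<le> w' \<Longrightarrow> \<alpha> \<in> obj w' \<Longrightarrow> eqpoint w' V1 V2 r r' X1 \<alpha> \<Longrightarrow> mem w' x \<alpha> \<Longrightarrow>
      \<exists>\<beta>. mem w' \<beta> G \<and> mem w' x \<beta> \<and> incl w' \<beta> \<alpha>"
    and XE: "\<And>w' D. w \<le> w' \<Longrightarrow> mem w' D XE \<longleftrightarrow> mem w' D G \<and> (\<exists>y. mem w' y X1 \<and> mem w' y D)"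
    and VE_rel: "isrel w VE XE S1"
    and VE: "\<And>w' D a. w \<le> w' \<Longrightarrow> D \<in> obj w' \<Longrightarrow> a \<in> obj w' \<Longrightarrow>
      rl w' VE D a \<longleftrightarrow> mem w' D XE \<and> mem w' a S1 \<and> (\<exists>y. mem w' y D \<and> rl w' V1 y a)"
    and pe_rel: "isrel w pe XE X1"
    and pe: "\<And>w' D y. w \<le> w' \<Longrightarrow> D \<in> obj w' \<Longrightarrow> y \<in> obj w' \<Longrightarrow>
      rl w' pe D y \<longleftrightarrow> mem w' D XE \<and> mem w' y X1 \<and> mem w' y D"
    and qe_rel: "isrel w qe S1 S1"
    and qe: "\<And>w' a b. w \<le> w' \<Longrightarrow> a \<in> obj w' \<Longrightarrow> b \<in> obj w' \<Longrightarrow>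
      rl w' qe a b \<longleftrightarrow> mem w' a S1 \<and> mem w' b S1 \<and> eql w' a b"
begin

lemma XE_D:
  assumes "w \<le> v" "mem v D XE"
  shows "eqpoint v V1 V2 r r' X1 D" "\<exists>y. mem v y D" "mem v y D \<Longrightarrow> mem v y X1"
proof -
  show "eqpoint v V1 V2 r r' X1 D" "\<exists>y. mem v y D" using G_sound XE assms by blast+
  then show "mem v y D \<Longrightarrow> mem v y X1" using eqpointD(1) incl_mem by blast
qed

lemma below_E:
  assumes "w \<le> v" "mem v a S1" "mem v b S1" "mem v c S1" "below v X1 V1 c a b"
  shows "below v XE VE c a b"
  unfolding below_def
proof (intro allI impI)
  fix v' D assume *: "v \<le> v'" "mem v' D XE" "rl v' VE D c"
  have wv: "w \<le> v'" using assms(1) *(1) by (rule order_trans)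
  have D: "D \<in> obj v'" using *(2) by (rule mem_obj)
  have ab: "mem v' a S1" "mem v' b S1" using assms(2,3) *(1) mem_mono by blast+
  have "c \<in> obj v'" using obj_mono[OF mem_obj(1)[OF assms(4)] *(1)] .
  then obtain y where y: "mem v' y D" "rl v' V1 y c" using VE[OF wv D] *(3) by blast
  then have "rl v' V1 y a \<and> rl v' V1 y b" using belowD[OF assms(5) *(1) XE_D(3)[OF wv *(2)]] by blast
  then show "rl v' VE D a \<and> rl v' VE D b"
    using VE[OF wv D mem_obj(1)[OF ab(1)]] VE[OF wv D mem_obj(1)[OF ab(2)]] ab *(2) y by blast
qed

text \<open>Passing from \<open>D\<close> to its elements does not change its neighbourhoods. Hence
  an arrow into the equaliser and its composite with \<open>pe\<close> have the same neighbourhoods,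
  from which uniqueness will follow.\<close>

lemma rcomp_VE:
  assumes "w \<le> v" "D \<in> obj v" "a \<in> obj v"
  shows "rcomp v pe V1 D a \<longleftrightarrow> rl v VE D a"
proof
  assume "rcomp v pe V1 D a"
  then obtain y where y: "y \<in> obj v" "rl v pe D y" "rl v V1 y a" unfolding rcomp_def by blast
  have "mem v a S1" using cspaceD(4)[OF A assms(1) y(3,1) assms(3)] by blast
  then show "rl v VE D a" using VE[OF assms] pe[OF assms(1,2) y(1)] y by blast
next
  assume "rl v VE D a"
  then obtain y where y: "mem v D XE" "mem v y D" "rl v V1 y a" using VE[OF assms] by blast
  have yX: "mem v y X1" using XE_D(3)[OF assms(1) y(1,2)] .
  have "y \<in> obj v" using y(2) by (rule mem_obj)
  then show "rcomp v pe V1 D a" using pe[OF assms(1,2)] y yX unfolding rcomp_def by blast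
qed

lemma rcomp_qe:
  assumes "w \<le> v" "D \<in> obj v" "a \<in> obj v"
  shows "rcomp v VE qe D a \<longleftrightarrow> rl v VE D a"
proof
  assume "rcomp v VE qe D a"
  then obtain a' where a': "a' \<in> obj v" "rl v VE D a'" "rl v qe a' a" unfolding rcomp_def by blast
  then have "eql v a' a" using qe[OF assms(1) a'(1) assms(3)] by blast
  then show "rl v VE D a" using rl_eql[OF a'(2) eql_refl[OF assms(2)]] by blast
next
  assume a: "rl v VE D a"
  then have "mem v a S1" using VE[OF assms] by blast
  then have "rl v qe a a" using qe[OF assms(1,3,3)] eql_refl[OF assms(3)] by blast
  with a assms(3) show "rcomp v VE qe D a" unfolding rcomp_def by blast
qed

text \<open>Closure of \<open>D\<close> under the filter rules merges the two witnesses into one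
  \<open>z \<in> D\<close> lying in both neighbourhoods; concreteness of the space on
  \<open>X1\<close> refines these at \<open>z\<close>.\<close>

lemma VE_filter:
  assumes "w \<le> v" "mem v D XE" "mem v a S1" "mem v b S1" "rl v VE D a" "rl v VE D b"
  shows "\<exists>c. mem v c S1 \<and> rl v VE D c \<and> below v X1 V1 c a b"
proof -
  have D: "D \<in> obj v" using assms(2) by (rule mem_obj)
  have ab: "a \<in> obj v" "b \<in> obj v" using assms(3,4) mem_obj(1) by blast+
  obtain y1 y2 where y: "mem v y1 D" "rl v V1 y1 a" "mem v y2 D" "rl v V1 y2 b"
    using VE[OF assms(1) D ab(1)] VE[OF assms(1) D ab(2)] assms(5,6) by blast
  obtain z where z: "mem v z D" "rl v V1 z a" "rl v V1 z b"
    using eqpointD(2)[OF XE_D(1)[OF assms(1,2)] order_refl y(1,3) ab y(2,4)] by blast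
  obtain c where c: "mem v c S1" "rl v V1 z c" "below v X1 V1 c a b"
    using cspaceD(3)[OF A assms(1,3,4) XE_D(3)[OF assms(1,2) z(1)] z(2,3)] by blast
  have "rl v VE D c" using VE[OF assms(1) D mem_obj(1)[OF c(1)]] assms(2) c z(1) by blast
  with c show ?thesis by blast
qed

lemma cspace_E: "cspace w XE VE S1"
  unfolding cspace_def
proof (intro conjI allI impI)
  show "isrel w VE XE S1" by (rule VE_rel)
  fix v D assume *: "w \<le> v" "mem v D XE"
  obtain y where y: "mem v y D" using XE_D(2)[OF *] by blast
  obtain a where a: "mem v a S1" "rl v V1 y a" using cspaceD(2)[OF A *(1) XE_D(3)[OF * y]] by blast
  then have "rl v VE D a" using VE[OF *(1) mem_obj(1)[OF *(2)] mem_obj(1)[OF a(1)]] * y by blast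
  with a show "\<exists>a. mem v a S1 \<and> rl v VE D a" by blast
next
  fix v a b D assume *: "w \<le> v" "mem v a S1" "mem v b S1" "mem v D XE" "rl v VE D a" "rl v VE D b"
  from VE_filter[OF *(1,4,2,3,5,6)] show "\<exists>c. mem v c S1 \<and> rl v VE D c \<and> below v XE VE c a b"
    using below_E[OF *(1-3)] by blast
qed

lemma arr_E: "arr w XE VE S1 X1 V1 S1 pe qe"
  unfolding arr_def
proof (intro conjI allI impI ballI)
  show "isrel w pe XE X1" "isrel w qe S1 S1" by (rule pe_rel, rule qe_rel)
  show "rcomp v pe V1 D a \<longleftrightarrow> rcomp v VE qe D a" if "w \<le> v" "D \<in> obj v" "a \<in> obj v" for v D a
    using rcomp_VE[OF that] rcomp_qe[OF that] by blast
  show "\<exists>y\<in>obj v. rl v pe D y" if *: "w \<le> v" "mem v D XE" for v D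
  proof -
    obtain y where y: "mem v y D" using XE_D(2)[OF *] by blast
    then have "y \<in> obj v" by (rule mem_obj)
    then show ?thesis using pe[OF *(1) mem_obj(1)[OF *(2)]] * y XE_D(3)[OF * y] by blast
  qed
  fix v a b D assume *: "w \<le> v" "mem v a S1" "mem v b S1" "mem v D XE" "rcomp v pe V1 D a" "rcomp v pe V1 D b"
  have D: "D \<in> obj v" using *(4) by (rule mem_obj)
  have "rl v VE D a" "rl v VE D b"
    using rcomp_VE[OF *(1) D mem_obj(1)[OF *(2)]] rcomp_VE[OF *(1) D mem_obj(1)[OF *(3)]] *(5,6) by blast+
  from VE_filter[OF *(1,4,2,3) this] obtain c where c: "mem v c S1" "rl v VE D c" "below v X1 V1 c a b" by blast
  then have "rcomp v pe V1 D c" using rcomp_VE[OF *(1) D mem_obj(1)[OF c(1)]] by blast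
  with c show "\<exists>c. mem v c S1 \<and> below v X1 V1 c a b \<and> rcomp v pe V1 D c" by blast
qed

text \<open>The two families of image rules under which \<open>D\<close> is closed are the two
  inclusions to be shown.\<close>

lemma eqz_E: "eqz w V2 r r' pe"
  unfolding eqz_def comp3_iff
proof (intro allI impI ballI)
  fix v D z assume *: "w \<le> v" "D \<in> obj v" "z \<in> obj v"
  have pD: "mem v D XE \<and> mem v y D" if "y \<in> obj v" "rl v pe D y" for y
    using pe[OF *(1,2) that(1)] that(2) by blast
  have Dp: "rl v pe D y \<and> y \<in> obj v" if "mem v D XE" "mem v y D" for y
    using pe[OF *(1,2) mem_obj(1)[OF that(2)]] XE_D(3)[OF *(1) that] mem_obj(1)[OF that(2)] that by blast
  show "(\<exists>u\<in>obj v. rl v pe D u \<and> rcomp v r V2 u z) \<longleftrightarrow> (\<exists>u\<in>obj v. rl v pe D u \<and> rcomp v r' V2 u z)"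
  proof
    assume "\<exists>u\<in>obj v. rl v pe D u \<and> rcomp v r V2 u z"
    then obtain y where y: "mem v D XE" "mem v y D" "rcomp v r V2 y z" using pD by blast
    then show "\<exists>u\<in>obj v. rl v pe D u \<and> rcomp v r' V2 u z"
      using eqpointD(3)[OF XE_D(1)[OF *(1) y(1)] order_refl y(2) *(3) y(3)] Dp[OF y(1)] by blast
  next
    assume "\<exists>u\<in>obj v. rl v pe D u \<and> rcomp v r' V2 u z"
    then obtain y where y: "mem v D XE" "mem v y D" "rcomp v r' V2 y z" using pD by blast
    then show "\<exists>u\<in>obj v. rl v pe D u \<and> rcomp v r V2 u z"
      using eqpointD(4)[OF XE_D(1)[OF *(1) y(1)] order_refl y(2) *(3) y(3)] Dp[OF y(1)] by blast
  qed
qed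

text \<open>The point \<open>x\<close> is mapped to the set of all \<open>y\<close> whose neighbourhoods are neighbourhoods
  of its image under \<open>(t, u)\<close>.\<close>

definition near where
  "near v t x y \<longleftrightarrow> (\<forall>v'\<ge>v. \<forall>a. mem v' a S1 \<longrightarrow> (\<forall>v''\<ge>v'. rl v'' V1 y a \<longrightarrow>
     (\<exists>y'. mem v'' y' X1 \<and> rl v'' t x y' \<and> rl v'' V1 y' a)))"

lemma definable_near:
  assumes "w \<le> v" "t \<in> obj v" "tm v c" "tm v d"
  shows "definable True v (\<lambda>w e. near w t (c e) (d e))"
  unfolding near_def using assms X1_obj V1_obj S1_obj obj_mono[OF _ assms(1)]
  by (intro definable_intros) simp_all

context
  fixes v X V S t u
  assumes wv: "w \<le> v" and h: "arr v X V S X1 V1 S1 t u"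
    and heq: "eqz v V2 r r' t" and t_obj: "t \<in> obj v" and X_obj: "X \<in> obj v"
begin

lemma nearD: "v \<le> v' \<Longrightarrow> near v' t x y \<Longrightarrow> y \<in> obj v' \<Longrightarrow> a \<in> obj v' \<Longrightarrow> rl v' V1 y a \<Longrightarrow> rcomp v' t V1 x a"
proof -
  assume *: "v \<le> v'" "near v' t x y" "y \<in> obj v'" "a \<in> obj v'" "rl v' V1 y a"
  have "mem v' a S1" using cspaceD(4)[OF A order_trans[OF wv *(1)] *(5,3,4)] by blast
  with * show "rcomp v' t V1 x a" unfolding near_def rcomp_def using mem_obj(1) by blast
qed

lemma nearI: "v \<le> v' \<Longrightarrow> x \<in> obj v' \<Longrightarrow> y \<in> obj v' \<Longrightarrow> rl v' t x y \<Longrightarrow> near v' t x y"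
  unfolding near_def
proof (intro allI impI)
  fix v1 a v2
  assume *: "v \<le> v'" "x \<in> obj v'" "y \<in> obj v'" "rl v' t x y" "v' \<le> v1" "mem v1 a S1" "v1 \<le> v2" "rl v2 V1 y a"
  have v2: "v' \<le> v2" "v \<le> v2" using order_trans[OF *(5,7)] order_trans[OF *(1) order_trans[OF *(5,7)]] .
  have r: "rl v2 t x y" using *(4) v2(1) by (rule rl_mono)
  then have "mem v2 y X1" using arrD(6)[OF h v2(2)] obj_mono[OF *(2) v2(1)] obj_mono[OF *(3) v2(1)] by blast
  with r * show "\<exists>y'. mem v2 y' X1 \<and> rl v2 t x y' \<and> rl v2 V1 y' a" by blast
qed

text \<open>Every neighbourhood of a near \<open>y\<close> is shared by some image point of
  \<open>x\<close>, and image points are themselves near. Each closure condition is thereby moved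
  from \<open>y\<close> to image points, where it follows from convergence of \<open>(t, u)\<close>
  or from \<open>heq\<close>.\<close>

lemma near_eqpoint:
  assumes v': "v \<le> v'" and x: "mem v' x X"
    and \<gamma>: "\<And>v'' y. v' \<le> v'' \<Longrightarrow> mem v'' y \<gamma> \<longleftrightarrow> mem v'' y X1 \<and> near v'' t x y"
  shows "eqpoint v' V1 V2 r r' X1 \<gamma>"
proof -
  have le: "v \<le> v1" "w \<le> v1" if "v' \<le> v1" for v1
    using order_trans[OF v' that] order_trans[OF wv order_trans[OF v' that]] .
  have x1: "mem v1 x X" "x \<in> obj v1" if "v' \<le> v1" for v1
    using mem_mono[OF x that] mem_obj(1) by blast+
  have in_\<gamma>: "mem v1 y \<gamma>" if "v' \<le> v1" "y \<in> obj v1" "rl v1 t x y" for v1 y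
    using \<gamma>[OF that(1)] nearI[OF le(1)[OF that(1)] x1(2)[OF that(1)] that(2,3)]
      arrD(6)[OF h le(1)[OF that(1)] that(3) x1(2)[OF that(1)] that(2)] by blast
  have near_\<gamma>: "rcomp v1 t V1 x a" if "v' \<le> v1" "mem v1 y \<gamma>" "a \<in> obj v1" "rl v1 V1 y a" for v1 y a
    using nearD[OF le(1)[OF that(1)] _ mem_obj(1)[OF that(2)] that(3,4)] \<gamma>[OF that(1)] that(2) by blast
  \<comment> \<open>As \<open>(q, n)\<close> is a relation pair, \<open>b\<close> is reached from
    \<open>y\<close> through a neighbourhood \<open>a\<close> of \<open>y\<close>. Some image point
    \<open>y'\<close> of \<open>x\<close> shares \<open>a\<close>, hence reaches \<open>b\<close>
    too, and equality of the two composites provides \<open>y''\<close>.\<close>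
  have transfer: "\<exists>z. mem v1 z \<gamma> \<and> rcomp v1 q' V2 z b"
    if *: "v' \<le> v1" "mem v1 y \<gamma>" "b \<in> obj v1" "rcomp v1 q V2 y b"
      and q: "arr w X1 V1 S1 X2 V2 S2 q n"
      and qq: "comp3 v1 t q V2 x b \<Longrightarrow> comp3 v1 t q' V2 x b" for v1 y b q q' n
  proof -
    have "y \<in> obj v1" using *(2) by (rule mem_obj)
    then have "rcomp v1 V1 n y b" using arrD(3)[OF q le(2)[OF *(1)]] * by blast
    then obtain a where a: "a \<in> obj v1" "rl v1 V1 y a" "rl v1 n a b" unfolding rcomp_def by blast
    then obtain y' where y': "y' \<in> obj v1" "rl v1 t x y'" "rl v1 V1 y' a"
      using near_\<gamma>[OF *(1,2)] unfolding rcomp_def by blast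
    have "rcomp v1 V1 n y' b" unfolding rcomp_def using a y' by blast
    then have "rcomp v1 q V2 y' b" using arrD(3)[OF q le(2)[OF *(1)] y'(1) *(3)] by blast
    then have "comp3 v1 t q V2 x b" unfolding comp3_iff using y' by blast
    from qq[OF this] obtain y'' where y'': "y'' \<in> obj v1" "rl v1 t x y''" "rcomp v1 q' V2 y'' b"
      unfolding comp3_iff by blast
    then show ?thesis using in_\<gamma>[OF *(1)] by blast
  qed
  have eqs: "comp3 v1 t r V2 x b \<longleftrightarrow> comp3 v1 t r' V2 x b" if "v' \<le> v1" "b \<in> obj v1" for v1 b
    using heq le(1)[OF that(1)] x1(2)[OF that(1)] that(2) unfolding eqz_def by blast
  show ?thesis
    unfolding eqpoint_def
  proof (intro conjI allI impI)
    show "incl v' \<gamma> X1" using \<gamma> unfolding incl_def by blast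
    fix v1 y1 y2 a b
    assume *: "v' \<le> v1" "mem v1 y1 \<gamma>" "mem v1 y2 \<gamma>" "a \<in> obj v1" "b \<in> obj v1" "rl v1 V1 y1 a" "rl v1 V1 y2 b"
    have y: "y1 \<in> obj v1" "y2 \<in> obj v1" using *(2,3) mem_obj(1) by blast+
    have ab: "mem v1 a S1" "mem v1 b S1"
      using cspaceD(4)[OF A le(2)[OF *(1)] *(6) y(1) *(4)] cspaceD(4)[OF A le(2)[OF *(1)] *(7) y(2) *(5)] by blast+
    obtain c where c: "mem v1 c S1" "below v1 X1 V1 c a b" "rcomp v1 t V1 x c"
      using arrD(5)[OF h le(1)[OF *(1)] ab x1(1)[OF *(1)] near_\<gamma>[OF *(1,2,4,6)] near_\<gamma>[OF *(1,3,5,7)]] by blast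
    then obtain y' where y': "y' \<in> obj v1" "rl v1 t x y'" "rl v1 V1 y' c" unfolding rcomp_def by blast
    have y'\<gamma>: "mem v1 y' \<gamma>" using in_\<gamma>[OF *(1) y'(1,2)] .
    then have "mem v1 y' X1" using \<gamma>[OF *(1)] by blast
    with belowD[OF c(2) order_refl _ y'(3)] y'\<gamma>
    show "\<exists>z. mem v1 z \<gamma> \<and> rl v1 V1 z a \<and> rl v1 V1 z b" by blast
  next
    fix v1 y b assume *: "v' \<le> v1" "mem v1 y \<gamma>" "b \<in> obj v1" "rcomp v1 r V2 y b"
    show "\<exists>z. mem v1 z \<gamma> \<and> rcomp v1 r' V2 z b"
      by (rule transfer[OF * f]) (use eqs[OF *(1,3)] in blast)
  next
    fix v1 y b assume *: "v' \<le> v1" "mem v1 y \<gamma>" "b \<in> obj v1" "rcomp v1 r' V2 y b"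
    show "\<exists>z. mem v1 z \<gamma> \<and> rcomp v1 r V2 z b"
      by (rule transfer[OF * g]) (use eqs[OF *(1,3)] in blast)
  qed
qed

text \<open>The point \<open>x\<close> is sent to all points of \<open>XE\<close> included in its
  ideal point. No neighbourhood is lost, since generation covers that ideal point by such members of
  \<open>G\<close>.\<close>

lemma mediating_relation_exists:
  obtains m where "m \<in> obj v" "isrel v m X XE"
    "\<And>v' x a. v \<le> v' \<Longrightarrow> x \<in> obj v' \<Longrightarrow> a \<in> obj v' \<Longrightarrow> rcomp v' m VE x a \<longleftrightarrow> rcomp v' t V1 x a"
proof -
  let ?Q = "\<lambda>w x D. \<forall>w'\<ge>w. \<forall>y. mem w' y D \<longrightarrow> near w' t x y"
  have "definable True v (\<lambda>w e. ?Q w (e 0) (e 1))"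
    using wv t_obj by (intro definable_ball definable_near tm_var)
  note rel = relation_exists[where Q = ?Q, OF this X_obj obj_mono[OF XE_obj wv]]
  obtain m where m: "m \<in> obj v" "isrel v m X XE" and
    m': "\<And>v' x D. v \<le> v' \<Longrightarrow> x \<in> obj v' \<Longrightarrow> D \<in> obj v' \<Longrightarrow> rl v' m x D \<longleftrightarrow> mem v' x X \<and> mem v' D XE \<and> ?Q v' x D"
    by (rule rel) (rule that)
  show thesis
  proof (rule that[OF m])
    fix v' x a assume *: "v \<le> v'" "x \<in> obj v'" "a \<in> obj v'"
    have wv': "w \<le> v'" using wv *(1) by (rule order_trans)
    show "rcomp v' m VE x a \<longleftrightarrow> rcomp v' t V1 x a"
    proof
      assume "rcomp v' m VE x a"
      then obtain D where D: "D \<in> obj v'" "rl v' m x D" "rl v' VE D a" unfolding rcomp_def by blast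
      then obtain y where y: "mem v' y D" "rl v' V1 y a" using VE[OF wv' D(1) *(3)] by blast
      have "near v' t x y" using m'[OF *(1,2) D(1)] D(2) y(1) by blast
      then show "rcomp v' t V1 x a" using nearD[OF *(1) _ mem_obj(1)[OF y(1)] *(3) y(2)] by blast
    next
      assume "rcomp v' t V1 x a"
      then obtain y where y: "y \<in> obj v'" "rl v' t x y" "rl v' V1 y a" unfolding rcomp_def by blast
      have x: "mem v' x X" and yX: "mem v' y X1" using arrD(6)[OF h *(1) y(2) *(2) y(1)] by blast+
      have tv': "t \<in> obj v'" using t_obj *(1) by (rule obj_mono)
      have "definable True v' (\<lambda>w e. near w t x (e 0))"
        using wv' tv' *(2) by (intro definable_near tm_var tm_const)
      note sep = separation_exists[where Q = "\<lambda>w. near w t x", OF this obj_mono[OF X1_obj wv']]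
      obtain \<gamma> where \<gamma>: "\<gamma> \<in> obj v'" "\<And>v'' y. v' \<le> v'' \<Longrightarrow> mem v'' y \<gamma> \<longleftrightarrow> mem v'' y X1 \<and> near v'' t x y"
        by (rule sep) (rule that)
      have "eqpoint v' V1 V2 r r' X1 \<gamma>" by (rule near_eqpoint[OF *(1) x \<gamma>(2)])
      moreover have "mem v' y \<gamma>" using \<gamma>(2)[OF order_refl] yX nearI[OF *(1,2) y(1,2)] by blast
      ultimately obtain \<beta> where \<beta>: "mem v' \<beta> G" "mem v' y \<beta>" "incl v' \<beta> \<gamma>"
        using G_generates[OF wv' \<gamma>(1)] by blast
      have \<beta>o: "\<beta> \<in> obj v'" using \<beta>(1) by (rule mem_obj)
      have \<beta>XE: "mem v' \<beta> XE" using XE[OF wv'] \<beta> yX by blast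
      have "?Q v' x \<beta>" using \<beta>(3) \<gamma>(2) unfolding incl_def by blast
      then have "rl v' m x \<beta>" using m'[OF *(1,2) \<beta>o] x \<beta>XE by blast
      moreover have "mem v' a S1" using cspaceD(4)[OF A wv' y(3,1) *(3)] by blast
      then have "rl v' VE \<beta> a" using VE[OF wv' \<beta>o *(3)] \<beta>XE \<beta>(2) y(3) by blast
      ultimately show "rcomp v' m VE x a" using \<beta>o unfolding rcomp_def by blast
    qed
  qed
qed

lemma comp3_pe:
  assumes "v \<le> v'" "x \<in> obj v'" "a \<in> obj v'"
  shows "comp3 v' m pe V1 x a \<longleftrightarrow> rcomp v' m VE x a"
  unfolding comp3_iff using rcomp_VE[OF order_trans[OF wv assms(1)] _ assms(3)] unfolding rcomp_def[of v' m] by blast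

text \<open>The equaliser keeps the neighbourhoods \<open>S1\<close>, so \<open>u\<close> can be
  reused. The clauses pass from \<open>t\<close> to \<open>m\<close> because both have the same
  neighbourhoods at every point.\<close>

lemma arr_mediating:
  assumes "isrel v m X XE"
    and m: "\<And>v' x a. v \<le> v' \<Longrightarrow> x \<in> obj v' \<Longrightarrow> a \<in> obj v' \<Longrightarrow> rcomp v' m VE x a \<longleftrightarrow> rcomp v' t V1 x a"
  shows "arr v X V S XE VE S1 m u"
  unfolding arr_def
proof (intro conjI allI impI ballI)
  show "isrel v m X XE" by fact
  show "isrel v u S S1" using arrD(2)[OF h order_refl] .
  show "rcomp v' m VE x a \<longleftrightarrow> rcomp v' V u x a" if "v \<le> v'" "x \<in> obj v'" "a \<in> obj v'" for v' x a
    using m[OF that] arrD(3)[OF h that] by blast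
  show "\<exists>D\<in>obj v'. rl v' m x D" if *: "v \<le> v'" "mem v' x X" for v' x
  proof -
    have x: "x \<in> obj v'" using *(2) by (rule mem_obj)
    obtain y where y: "y \<in> obj v'" "rl v' t x y" using arrD(4)[OF h *] by blast
    have "mem v' y X1" using arrD(6)[OF h *(1) y(2) x y(1)] by blast
    then obtain a where a: "mem v' a S1" "rl v' V1 y a" using cspaceD(2)[OF A order_trans[OF wv *(1)]] by blast
    then have "rcomp v' t V1 x a" using y unfolding rcomp_def by blast
    then have "rcomp v' m VE x a" using m[OF *(1) x mem_obj(1)[OF a(1)]] by blast
    then show ?thesis unfolding rcomp_def by blast
  qed
  fix v' a b x
  assume *: "v \<le> v'" "mem v' a S1" "mem v' b S1" "mem v' x X" "rcomp v' m VE x a" "rcomp v' m VE x b"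
  have o: "x \<in> obj v'" "a \<in> obj v'" "b \<in> obj v'" using *(2-4) mem_obj(1) by blast+
  have ab: "rcomp v' t V1 x a" "rcomp v' t V1 x b" using m[OF *(1) o(1,2)] m[OF *(1) o(1,3)] *(5,6) by blast+
  obtain c where c: "mem v' c S1" "below v' X1 V1 c a b" "rcomp v' t V1 x c"
    using arrD(5)[OF h *(1-4) ab] by blast
  have "below v' XE VE c a b" using below_E[OF order_trans[OF wv *(1)] *(2,3) c(1,2)] .
  moreover have "rcomp v' m VE x c" using m[OF *(1) o(1) mem_obj(1)[OF c(1)]] c(3) by blast
  ultimately show "\<exists>c. mem v' c S1 \<and> below v' XE VE c a b \<and> rcomp v' m VE x c" using c(1) by blast
qed

end

lemma iseq_E: "iseq w X1 V1 S1 V2 r r' XE VE S1 pe qe"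
  unfolding iseq_def
proof (intro conjI allI impI ballI)
  show "cspace w XE VE S1" by (rule cspace_E)
  show "csarrow w XE VE S1 X1 V1 S1 pe qe" using csarrow_iff[OF cspace_E A] arr_E by blast
  show "eqz w V2 r r' pe" by (rule eqz_E)
  fix v0 X V S v t u
  assume v0: "w \<le> v0" "X \<in> obj v0" "V \<in> obj v0" "S \<in> obj v0" "cspace v0 X V S"
    and v: "v0 \<le> v" "t \<in> obj v" "u \<in> obj v" and tu: "csarrow v X V S X1 V1 S1 t u \<and> eqz v V2 r r' t"
  have wv: "w \<le> v" using v0(1) v(1) by (rule order_trans)
  have C: "cspace v X V S" using v0(5) v(1) by (rule cspace_mono)
  have h: "arr v X V S X1 V1 S1 t u" using csarrow_iff[OF C cspace_mono[OF A wv]] tu by blast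
  have X: "X \<in> obj v" using v0(2) v(1) by (rule obj_mono)
  have heq: "eqz v V2 r r' t" using tu by blast
  note med = mediating_relation_exists[OF wv h heq v(2) X]
  obtain m where m: "m \<in> obj v" "isrel v m X XE"
    "\<And>v' x a. v \<le> v' \<Longrightarrow> x \<in> obj v' \<Longrightarrow> a \<in> obj v' \<Longrightarrow> rcomp v' m VE x a \<longleftrightarrow> rcomp v' t V1 x a"
    by (rule med) (rule that)
  show "\<exists>m\<in>obj v. \<exists>n\<in>obj v. csarrow v X V S XE VE S1 m n \<and>
      (\<forall>v'\<ge>v. \<forall>x\<in>obj v'. \<forall>z\<in>obj v'. comp3 v' m pe V1 x z \<longleftrightarrow> rcomp v' t V1 x z) \<and>
      (\<forall>v'\<ge>v. \<forall>m'\<in>obj v'. \<forall>n'\<in>obj v'. csarrow v' X V S XE VE S1 m' n' \<and>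
        (\<forall>v''\<ge>v'. \<forall>x\<in>obj v''. \<forall>z\<in>obj v''. comp3 v'' m' pe V1 x z \<longleftrightarrow> rcomp v'' t V1 x z) \<longrightarrow>
        (\<forall>v''\<ge>v'. \<forall>x\<in>obj v''. \<forall>z\<in>obj v''. rcomp v'' m' VE x z \<longleftrightarrow> rcomp v'' m VE x z))"
  proof (rule bexI[of _ m], rule bexI[of _ u], intro conjI allI impI ballI)
    show "csarrow v X V S XE VE S1 m u"
      using csarrow_iff[OF C cspace_mono[OF cspace_E wv]] arr_mediating[OF wv h heq v(2) X m(2,3)] by blast
    show "comp3 v' m pe V1 x z \<longleftrightarrow> rcomp v' t V1 x z" if "v \<le> v'" "x \<in> obj v'" "z \<in> obj v'" for v' x z
      using m(3)[OF that] comp3_pe[OF wv h heq v(2) X that] by blast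
    fix v' m' n' v'' x z
    assume *: "v \<le> v'" and 1: "csarrow v' X V S XE VE S1 m' n' \<and>
        (\<forall>v''\<ge>v'. \<forall>x\<in>obj v''. \<forall>z\<in>obj v''. comp3 v'' m' pe V1 x z \<longleftrightarrow> rcomp v'' t V1 x z)"
      and 2: "v' \<le> v''" "x \<in> obj v''" "z \<in> obj v''"
    have le: "v \<le> v''" using * 2(1) by (rule order_trans)
    have "comp3 v'' m' pe V1 x z \<longleftrightarrow> rcomp v'' t V1 x z" using 1 2 by blast
    \<comment> \<open>By \<open>comp3_pe\<close> the composite with \<open>pe\<close> determines
      \<open>m'\<close> up to equality.\<close>
    then show "rcomp v'' m' VE x z \<longleftrightarrow> rcomp v'' m VE x z"
      using m(3)[OF le 2(2,3)] comp3_pe[OF wv h heq v(2) X le 2(2,3)] by blast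
  qed (use m v in auto)
qed

end

text \<open>\<open>NID_fin\<close> is applied once, to the rules whose closed sets are the equalised
  ideal points, and supplies \<open>G\<close>. The rest of the equaliser comes from products and
  Separation.\<close>

lemma NID_imp_equaliser:
  assumes NID: "sat w j NID_fin" and A: "cspace w X1 V1 S1" and B: "cspace w X2 V2 S2"
    and f: "arr w X1 V1 S1 X2 V2 S2 r s" and g: "arr w X1 V1 S1 X2 V2 S2 r' s'"
    and o: "X1 \<in> obj w" "V1 \<in> obj w" "S1 \<in> obj w" "X2 \<in> obj w" "V2 \<in> obj w" "S2 \<in> obj w" "r \<in> obj w" "r' \<in> obj w"
  shows "\<exists>XE\<in>obj w. \<exists>VE\<in>obj w. \<exists>SE\<in>obj w. \<exists>p\<in>obj w. \<exists>q\<in>obj w. iseq w X1 V1 S1 V2 r r' XE VE SE p q"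
proof -
  note rules = eqpoint_rules_exist[OF A B arrD(1)[OF f order_refl] arrD(1)[OF g order_refl] o]
  obtain R where R: "R \<in> obj w" "finrules w X1 R"
    and cl: "\<And>w' \<alpha>. w \<le> w' \<Longrightarrow> \<alpha> \<in> obj w' \<Longrightarrow> closed w' X1 R \<alpha> \<longleftrightarrow> eqpoint w' V1 V2 r r' X1 \<alpha>"
    by (rule rules) (rule that)
  obtain G where G: "G \<in> obj w" "generates w X1 R G"
    using NID R o(1) unfolding sat_NID_fin by blast
  have "definable True w (\<lambda>w e. \<exists>y. mem w y X1 \<and> mem w y (e 0))" using o by (intro definable_intros)
  note sep = separation_exists[where Q = "\<lambda>w D. \<exists>y. mem w y X1 \<and> mem w y D", OF this G(1)]
  obtain XE where XE: "XE \<in> obj w"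
    "\<And>w' D. w \<le> w' \<Longrightarrow> mem w' D XE \<longleftrightarrow> mem w' D G \<and> (\<exists>y. mem w' y X1 \<and> mem w' y D)"
    by (rule sep) (rule that)
  have "definable True w (\<lambda>w e. \<exists>y. mem w y (e 0) \<and> rl w V1 y (e 1))" using o by (intro definable_intros)
  note rel = relation_exists[where Q = "\<lambda>w D a. \<exists>y. mem w y D \<and> rl w V1 y a", OF this XE(1) o(3)]
  obtain VE where VE: "VE \<in> obj w" "isrel w VE XE S1"
    "\<And>w' D a. w \<le> w' \<Longrightarrow> D \<in> obj w' \<Longrightarrow> a \<in> obj w' \<Longrightarrow>
      rl w' VE D a \<longleftrightarrow> mem w' D XE \<and> mem w' a S1 \<and> (\<exists>y. mem w' y D \<and> rl w' V1 y a)"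
    by (rule rel) (rule that)
  have "definable True w (\<lambda>w e. mem w (e 1) (e 0))" by (intro definable_intros)
  note rel = relation_exists[where Q = "\<lambda>w D y. mem w y D", OF this XE(1) o(1)]
  obtain pe where pe: "pe \<in> obj w" "isrel w pe XE X1"
    "\<And>w' D y. w \<le> w' \<Longrightarrow> D \<in> obj w' \<Longrightarrow> y \<in> obj w' \<Longrightarrow> rl w' pe D y \<longleftrightarrow> mem w' D XE \<and> mem w' y X1 \<and> mem w' y D"
    by (rule rel) (rule that)
  have "definable True w (\<lambda>w e. eql w (e 0) (e 1))" by (intro definable_intros)
  note rel = relation_exists[where Q = eql, OF this o(3,3)]
  obtain qe where qe: "qe \<in> obj w" "isrel w qe S1 S1"
    "\<And>w' a b. w \<le> w' \<Longrightarrow> a \<in> obj w' \<Longrightarrow> b \<in> obj w' \<Longrightarrow> rl w' qe a b \<longleftrightarrow> mem w' a S1 \<and> mem w' b S1 \<and> eql w' a b"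
    by (rule rel) (rule that)
  interpret E: generated_equaliser w X1 V1 S1 X2 V2 S2 r s r' s' G XE VE pe qe
  proof
    fix w' D assume *: "w \<le> w'" "mem w' D G"
    then have "closed w' X1 R D" using G(2) unfolding generates_def by blast
    then show "eqpoint w' V1 V2 r r' X1 D" using cl[OF *(1) mem_obj(1)[OF *(2)]] by blast
  next
    fix w' \<alpha> x assume *: "w \<le> w'" "\<alpha> \<in> obj w'" "eqpoint w' V1 V2 r r' X1 \<alpha>" "mem w' x \<alpha>"
    then have "closed w' X1 R \<alpha>" using cl[OF *(1,2)] by blast
    from conjunct2[OF G(2)[unfolded generates_def], rule_format, OF *(1,2) this order_refl *(4)]
    show "\<exists>\<beta>. mem w' \<beta> G \<and> mem w' x \<beta> \<and> incl w' \<beta> \<alpha>" .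
  qed (rule A, rule B, rule f, rule g, rule o(1), rule o(2), rule o(3), rule XE(1),
      rule XE(2), assumption, rule VE(2), rule VE(3), assumption+, rule pe(2), rule pe(3), assumption+,
      rule qe(2), rule qe(3), assumption+)
  show ?thesis
    by (rule bexI[where x = XE], rule bexI[where x = VE], rule bexI[where x = S1], rule bexI[where x = pe],
      rule bexI[where x = qe], rule E.iseq_E) (rule qe(1) pe(1) o(3) VE(1) XE(1))+
qed

section \<open>Generated classes from equalisers\<close>

lemma absurd_sat: "absurd w \<Longrightarrow> (\<And>i. e i \<in> obj w) \<Longrightarrow> sat w e \<phi>"
proof (induction \<phi> arbitrary: w e)
  case (Impl \<phi> \<psi>)
  have "sat w' e \<psi>" if "w \<le> w'" for w'
    using Impl.prems that by (intro Impl.IH) (auto intro: absurd_mono obj_mono)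
  then show ?case by simp
next
  case (Forall \<phi>)
  have "sat w' (case_nat x e) \<phi>" if "w \<le> w'" "x \<in> obj w'" for w' x
    using Forall.prems that by (intro Forall.IH) (auto split: nat.split intro: absurd_mono obj_mono)
  then show ?case by simp
next
  case (Exists \<phi>)
  have "sat w (case_nat (e 0) e) \<phi>" using Exists.prems by (intro Exists.IH) (auto split: nat.split)
  then show ?case using Exists.prems by auto
qed (simp_all add: absurd_atoms)

text \<open>Lets conditions on all elements of an empty set be verified: elements occur only at
  absurd worlds, where every definable predicate holds.\<close>

lemma absurd_definable:
  assumes "definable b w Q" "w \<le> w'" "absurd w'" "\<And>i. e i \<in> obj w'"
  shows "Q w' e"
proof -
  obtain \<phi> p where *: "\<forall>i. p i \<in> obj w"
    "\<forall>w'\<ge>w. \<forall>e. (\<forall>i. e i \<in> obj w') \<longrightarrow> (sat w' (mix e p) \<phi> \<longleftrightarrow> Q w' e)"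
    using assms(1) unfolding definable_def by blast
  have "p i \<in> obj w'" for i using *(1) assms(2) obj_mono by blast
  then have "sat w' (mix e p) \<phi>" by (intro absurd_sat[OF assms(3)] mix_obj assms(4))
  then show ?thesis using * assms(2,4) by blast
qed

lemma empt_incl: "empt w u \<Longrightarrow> a \<in> obj w \<Longrightarrow> incl w u a"
  unfolding incl_def empt_def using absurd_incl[OF _ obj_mono] incl_mem by blast

text \<open>The space of finitely enumerable subsets of \<open>S\<close>, each of which is a basic neighbourhood of
  its supersets. Its ideal points are the subsets of \<open>S\<close>.\<close>

definition finspace :: "world \<Rightarrow> nat \<Rightarrow> nat \<Rightarrow> nat \<Rightarrow> bool" where
  "finspace w F V S \<longleftrightarrow> finsets w F S \<and> isrel w V F F \<and>
     (\<forall>w'\<ge>w. \<forall>D\<in>obj w'. \<forall>u\<in>obj w'. rl w' V D u \<longleftrightarrow> mem w' D F \<and> mem w' u F \<and> incl w' u D)"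

lemma finspaceD:
  assumes "finspace w F V S" "w \<le> w'"
  shows "finsets w' F S" "isrel w' V F F"
    "D \<in> obj w' \<Longrightarrow> u \<in> obj w' \<Longrightarrow> rl w' V D u \<longleftrightarrow> mem w' D F \<and> mem w' u F \<and> incl w' u D"
proof -
  show "finsets w' F S" "isrel w' V F F"
    using assms finsets_mono isrel_mono unfolding finspace_def by blast+
  show "D \<in> obj w' \<Longrightarrow> u \<in> obj w' \<Longrightarrow> rl w' V D u \<longleftrightarrow> mem w' D F \<and> mem w' u F \<and> incl w' u D"
    using assms unfolding finspace_def by blast
qed

lemma finspace_mono: "finspace w F V S \<Longrightarrow> w \<le> w' \<Longrightarrow> finspace w' F V S"
  unfolding finspace_def
  by (elim conjE) (intro conjI, erule (1) finsets_mono, erule (1) isrel_mono, erule (1) forall_ge_mono)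

lemma finspace_exists:
  assumes "S \<in> obj w"
  obtains F V where "F \<in> obj w" "V \<in> obj w" "finspace w F V S"
proof -
  obtain F where F: "F \<in> obj w" "finsets w F S" by (rule finsets_exists[OF assms])
  have "definable True w (\<lambda>w e. incl w (e 1) (e 0))" by (intro definable_intros)
  note rel = relation_exists[where Q = "\<lambda>w D u. incl w u D", OF this F(1,1)]
  obtain V where "V \<in> obj w" "isrel w V F F"
    "\<And>w' D u. w \<le> w' \<Longrightarrow> D \<in> obj w' \<Longrightarrow> u \<in> obj w' \<Longrightarrow> rl w' V D u \<longleftrightarrow> mem w' D F \<and> mem w' u F \<and> incl w' u D"
    by (rule rel) (rule that)
  with F show thesis by (intro that[of F V]) (auto simp: finspace_def)
qed

lemma finspace_self:
  assumes "finspace w F V S" "w \<le> w'" "mem w' D F"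
  shows "rl w' V D D"
  using finspaceD(3)[OF assms(1,2) mem_obj(1)[OF assms(3)] mem_obj(1)[OF assms(3)]] assms(3) incl_refl by blast

text \<open>Inclusion is reversed: a larger finitely enumerable set is a smaller neighbourhood. For
  the converse, \<open>c\<close> is tested as a point of its own neighbourhood.\<close>

lemma finspace_below:
  assumes "finspace w F V S" "mem w c F"
  shows "mem w a F \<Longrightarrow> mem w b F \<Longrightarrow> incl w a c \<Longrightarrow> incl w b c \<Longrightarrow> below w F V c a b"
    and "a \<in> obj w \<Longrightarrow> b \<in> obj w \<Longrightarrow> below w F V c a b \<Longrightarrow> incl w a c \<and> incl w b c"
proof -
  assume ab: "mem w a F" "mem w b F" "incl w a c" "incl w b c"
  show "below w F V c a b"
    unfolding below_def
  proof (intro allI impI)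
    fix w' D assume *: "w \<le> w'" "mem w' D F" "rl w' V D c"
    have m: "mem w' a F" "mem w' b F" "mem w' c F" using assms(2) ab(1,2) *(1) mem_mono by blast+
    have i: "incl w' a c" "incl w' b c" using ab(3,4) *(1) incl_mono by blast+
    have "incl w' c D" using finspaceD(3)[OF assms(1) *(1) mem_obj(1)[OF *(2)] mem_obj(1)[OF m(3)]] *(3) by blast
    then have "incl w' a D" "incl w' b D" using i incl_trans by blast+
    then show "rl w' V D a \<and> rl w' V D b"
      using finspaceD(3)[OF assms(1) *(1) mem_obj(1)[OF *(2)] mem_obj(1)[OF m(1)]]
        finspaceD(3)[OF assms(1) *(1) mem_obj(1)[OF *(2)] mem_obj(1)[OF m(2)]] m *(2) by blast
  qed
next
  assume *: "a \<in> obj w" "b \<in> obj w" "below w F V c a b"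
  have c: "c \<in> obj w" using assms(2) by (rule mem_obj)
  show "incl w a c \<and> incl w b c"
    using belowD[OF *(3) order_refl assms(2) finspace_self[OF assms(1) order_refl assms(2)]]
      finspaceD(3)[OF assms(1) order_refl c *(1)] finspaceD(3)[OF assms(1) order_refl c *(2)] by blast
qed

text \<open>Each point \<open>D\<close> is its own smallest neighbourhood, so \<open>D\<close>
  refines any two neighbourhoods of it.\<close>

lemma cspace_finspace:
  assumes "finspace w F V S"
  shows "cspace w F V F"
  unfolding cspace_def
proof (intro conjI allI impI)
  show "isrel w V F F" using finspaceD(2)[OF assms order_refl] .
  show "\<exists>a. mem w' a F \<and> rl w' V D a" if "w \<le> w'" "mem w' D F" for w' D
    using finspace_self[OF assms that] that(2) by blast
  fix w' a b D assume *: "w \<le> w'" "mem w' a F" "mem w' b F" "mem w' D F" "rl w' V D a" "rl w' V D b"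
  have "incl w' a D" "incl w' b D"
    using finspaceD(3)[OF assms *(1) mem_obj(1)[OF *(4)] mem_obj(1)[OF *(2)]]
      finspaceD(3)[OF assms *(1) mem_obj(1)[OF *(4)] mem_obj(1)[OF *(3)]] *(5,6) by blast+
  then have "below w' F V D a b" using finspace_below(1)[OF finspace_mono[OF assms *(1)] *(4,2,3)] by blast
  then show "\<exists>c. mem w' c F \<and> rl w' V D c \<and> below w' F V c a b"
    using finspace_self[OF assms *(1,4)] *(4) by blast
qed

text \<open>A relation determined by a monotone predicate \<open>P D \<rho>\<close> stands for the map sending a subset \<open>\<alpha>\<close>
  of \<open>S\<close> to the set of all \<open>\<rho>\<close> such that \<open>P D \<rho>\<close> for some finitely enumerable \<open>D\<close> included in \<open>\<alpha>\<close>.\<close>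

lemma finspace_arrow_exists:
  assumes A: "finspace w F V S" and B: "finspace w F' V' R"
    and o: "F \<in> obj w" "F' \<in> obj w" "R \<in> obj w"
    and P: "definable True w (\<lambda>w e. P w (e 0) (e 1))"
    and mono: "\<And>w' D D' \<rho>. w \<le> w' \<Longrightarrow> D \<in> obj w' \<Longrightarrow> D' \<in> obj w' \<Longrightarrow> incl w' D D' \<Longrightarrow> P w' D \<rho> \<Longrightarrow> P w' D' \<rho>"
  obtains q where "q \<in> obj w" "arr w F V F F' V' F' q q"
    "\<And>w' D v. w \<le> w' \<Longrightarrow> D \<in> obj w' \<Longrightarrow> v \<in> obj w' \<Longrightarrow>
       rcomp w' q V' D v \<longleftrightarrow> mem w' D F \<and> mem w' v F' \<and> (\<forall>w''\<ge>w'. \<forall>\<rho>. mem w'' \<rho> v \<longrightarrow> P w'' D \<rho>)"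
proof -
  \<comment> \<open>The finitely enumerable sets are points and basic neighbourhoods alike, so one
    relation \<open>q\<close> serves as both components of the arrow.\<close>
  let ?Q = "\<lambda>w D v. \<forall>w'\<ge>w. \<forall>\<rho>. mem w' \<rho> v \<longrightarrow> P w' D \<rho>"
  have "definable True w (\<lambda>w e. P w (e 1) (e 0))"
    using definable_rename[OF P, of "\<lambda>i. if i = 0 then 1 else 0"] by simp
  then have "definable True w (\<lambda>w e. ?Q w (e 0) (e 1))" by (intro definable_intros) simp
  note rel = relation_exists[where Q = ?Q, OF this o(1,2)]
  obtain q where q: "q \<in> obj w" "isrel w q F F'"
    "\<And>w' D v. w \<le> w' \<Longrightarrow> D \<in> obj w' \<Longrightarrow> v \<in> obj w' \<Longrightarrow> rl w' q D v \<longleftrightarrow> mem w' D F \<and> mem w' v F' \<and> ?Q w' D v"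
    by (rule rel) (rule that)
  \<comment> \<open>The condition on \<open>v\<close> passes to subsets, so composing with
    \<open>V'\<close> changes nothing; for \<open>V\<close> the same follows from monotonicity of
    \<open>P\<close>.\<close>
  have right: "rcomp w' q V' D v \<longleftrightarrow> rl w' q D v" if *: "w \<le> w'" "D \<in> obj w'" "v \<in> obj w'" for w' D v
  proof
    assume "rcomp w' q V' D v"
    then obtain v1 where v1: "v1 \<in> obj w'" "rl w' q D v1" "rl w' V' v1 v" unfolding rcomp_def by blast
    have "mem w' v F'" "incl w' v v1" using finspaceD(3)[OF B *(1) v1(1) *(3)] v1(3) by blast+
    moreover have "mem w' D F" "?Q w' D v1" using q(3)[OF *(1,2) v1(1)] v1(2) by blast+
    ultimately show "rl w' q D v" using q(3)[OF *] unfolding incl_def by blast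
  next
    assume v: "rl w' q D v"
    then have "mem w' v F'" using q(3)[OF *] by blast
    then have "rl w' V' v v" using finspace_self[OF B *(1)] by blast
    with v *(3) show "rcomp w' q V' D v" unfolding rcomp_def by blast
  qed
  have left: "rcomp w' V q D v \<longleftrightarrow> rl w' q D v" if *: "w \<le> w'" "D \<in> obj w'" "v \<in> obj w'" for w' D v
  proof
    assume "rcomp w' V q D v"
    then obtain D1 where D1: "D1 \<in> obj w'" "rl w' V D D1" "rl w' q D1 v" unfolding rcomp_def by blast
    have D: "mem w' D F" "incl w' D1 D" using finspaceD(3)[OF A *(1,2) D1(1)] D1(2) by blast+
    have v: "mem w' v F'" "?Q w' D1 v" using q(3)[OF *(1) D1(1) *(3)] D1(3) by blast+
    have "P w'' D \<rho>" if "w' \<le> w''" "mem w'' \<rho> v" for w'' \<rho>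
      using mono[OF order_trans[OF *(1) that(1)] obj_mono[OF D1(1) that(1)] obj_mono[OF *(2) that(1)]
          incl_mono[OF D(2) that(1)]] v(2) that by blast
    with D v show "rl w' q D v" using q(3)[OF *] by blast
  next
    assume v: "rl w' q D v"
    then have "mem w' D F" using q(3)[OF *] by blast
    then have "rl w' V D D" using finspace_self[OF A *(1)] by blast
    with v *(2) show "rcomp w' V q D v" unfolding rcomp_def by blast
  qed
  show thesis
  proof (rule that[OF q(1)])
    show "rcomp w' q V' D v \<longleftrightarrow> mem w' D F \<and> mem w' v F' \<and> ?Q w' D v"
      if "w \<le> w'" "D \<in> obj w'" "v \<in> obj w'" for w' D v
      using right[OF that] q(3)[OF that] by blast
    show "arr w F V F F' V' F' q q"
      unfolding arr_def
    proof (intro conjI allI impI ballI)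
      show "isrel w q F F'" "isrel w q F F'" by (rule q(2))+
      show "rcomp w' q V' D v \<longleftrightarrow> rcomp w' V q D v" if "w \<le> w'" "D \<in> obj w'" "v \<in> obj w'" for w' D v
        using right[OF that] left[OF that] by blast
      show "\<exists>v\<in>obj w'. rl w' q D v" if *: "w \<le> w'" "mem w' D F" for w' D
      proof -
        \<comment> \<open>The empty set is related to every \<open>D\<close>, which makes the image
          inhabited.\<close>
        obtain v where v: "mem w' v F'" "empt w' v"
          by (rule finsets_empty[OF finspaceD(1)[OF B *(1)] obj_mono[OF o(3) *(1)]])
        have D: "D \<in> obj w'" and vo: "v \<in> obj w'" using *(2) v(1) mem_obj(1) by blast+
        have "P w'' D \<rho>" if "w' \<le> w''" "mem w'' \<rho> v" for w'' \<rho>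
          using absurd_definable[OF P order_trans[OF *(1) that(1)], of "\<lambda>i. if i = 0 then D else \<rho>"]
            that v(2) obj_mono[OF D that(1)] mem_obj(1)[OF that(2)] unfolding empt_def by simp
        then have "rl w' q D v" using q(3)[OF *(1) D vo] *(2) v(1) by blast
        with vo show ?thesis by blast
      qed
      fix w' a b D
      assume *: "w \<le> w'" "mem w' a F'" "mem w' b F'" "mem w' D F" "rcomp w' q V' D a" "rcomp w' q V' D b"
      have ob: "D \<in> obj w'" "a \<in> obj w'" "b \<in> obj w'" using *(2-4) mem_obj(1) by blast+
      have Qab: "?Q w' D a" "?Q w' D b"
        using right[OF *(1) ob(1,2)] right[OF *(1) ob(1,3)] q(3)[OF *(1) ob(1,2)] q(3)[OF *(1) ob(1,3)] *(5,6) by blast+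
      \<comment> \<open>The image of \<open>D\<close> is
        \<open>\<alpha> = {\<rho> \<in> R. P D \<rho>}\<close>. The finitely enumerable subsets
        \<open>a\<close> and \<open>b\<close> of it have a common finitely enumerable extension
        inside it.\<close>
      have "definable True w' (\<lambda>w e. P w D (e 0))"
        using definable_inst[OF definable_mono[OF P *(1)] ob(1)] .
      note sep = separation_exists[where Q = "\<lambda>w. P w D", OF this obj_mono[OF o(3) *(1)]]
      obtain \<alpha> where \<alpha>: "\<alpha> \<in> obj w'" "\<And>w'' \<rho>. w' \<le> w'' \<Longrightarrow> mem w'' \<rho> \<alpha> \<longleftrightarrow> mem w'' \<rho> R \<and> P w'' D \<rho>"
        by (rule sep) (rule that)
      have B': "finsets w' F' R" using finspaceD(1)[OF B *(1)] .
      have R: "incl w' a R" "incl w' b R" "finen w' b" using finsets_mem[OF B' order_refl] *(2,3) by blast+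
      have "incl w' a \<alpha>" "incl w' b \<alpha>" "incl w' \<alpha> R" using R \<alpha>(2) Qab unfolding incl_def by blast+
      from finsets_directed[OF B' obj_mono[OF o(2) *(1)] ob(3) R(3) this(2) \<alpha>(1) this(3) *(2) this(1)]
      obtain c where c: "mem w' c F'" "incl w' a c" "incl w' b c" "incl w' c \<alpha>" by blast
      have co: "c \<in> obj w'" using c(1) by (rule mem_obj)
      have "?Q w' D c" using c(4) \<alpha>(2) unfolding incl_def by blast
      then have "rl w' q D c" using q(3)[OF *(1) ob(1) co] c(1) *(4) by blast
      then have "rcomp w' q V' D c" using right[OF *(1) ob(1) co] by blast
      moreover have "below w' F' V' c a b"
        using finspace_below(1)[OF finspace_mono[OF B *(1)] c(1) *(2,3) c(2,3)] .
      ultimately show "\<exists>c. mem w' c F' \<and> below w' F' V' c a b \<and> rcomp w' q V' D c" using c(1) by blast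
    qed
  qed
qed

section \<open>The two arrows determined by a set of rules\<close>

definition applies :: "world \<Rightarrow> nat \<Rightarrow> nat \<Rightarrow> bool" where
  "applies w D \<rho> \<longleftrightarrow> (\<exists>a\<in>obj w. \<exists>b\<in>obj w. opair w \<rho> a b \<and> incl w a D)"

definition applied :: "world \<Rightarrow> nat \<Rightarrow> nat \<Rightarrow> bool" where
  "applied w D \<rho> \<longleftrightarrow> (\<exists>a\<in>obj w. \<exists>b\<in>obj w. opair w \<rho> a b \<and> incl w a D \<and> (\<exists>x. mem w x b \<and> mem w x D))"

text \<open>Components of a Kuratowski pair are elements of its elements. This bounds the
  quantifiers over \<open>a\<close> and \<open>b\<close> in \<open>applies\<close> and
  \<open>applied\<close>, which thus become restricted.\<close>

lemma opair_components:
  assumes "opair w p a b" "a \<in> obj w" "b \<in> obj w"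
  shows "\<exists>u. mem w u p \<and> mem w a u" "\<exists>u. mem w u p \<and> mem w b u"
proof -
  obtain u where u: "u \<in> obj w" "upair w u a b" by (rule upair_exists[OF assms(2,3)])
  have "mem w u p" using assms(1) u unfolding opair_def by blast
  then show "\<exists>u. mem w u p \<and> mem w a u" "\<exists>u. mem w u p \<and> mem w b u"
    using upair_mem[OF u(2) assms(2,3)] by blast+
qed

lemma definable_applies: "definable True w (\<lambda>w e. applies w (e 0) (e 1))"
proof (rule definable_cong)
  show "definable True w (\<lambda>w e. \<exists>u. mem w u (e 1) \<and> (\<exists>a. mem w a u \<and> (\<exists>u'. mem w u' (e 1) \<and> (\<exists>b. mem w b u' \<and>
      opair w (e 1) a b \<and> incl w a (e 0)))))"
    by (intro definable_intros)
  show "(\<exists>u. mem w' u (e 1) \<and> (\<exists>a. mem w' a u \<and> (\<exists>u'. mem w' u' (e 1) \<and> (\<exists>b. mem w' b u' \<and>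
      opair w' (e 1) a b \<and> incl w' a (e 0))))) \<longleftrightarrow> applies w' (e 0) (e 1)" for w' e
    unfolding applies_def using opair_components[of w' "e 1"] mem_obj(1) by meson
qed

lemma definable_applied: "definable True w (\<lambda>w e. applied w (e 0) (e 1))"
proof (rule definable_cong)
  show "definable True w (\<lambda>w e. \<exists>u. mem w u (e 1) \<and> (\<exists>a. mem w a u \<and> (\<exists>u'. mem w u' (e 1) \<and> (\<exists>b. mem w b u' \<and>
      opair w (e 1) a b \<and> incl w a (e 0) \<and> (\<exists>x. mem w x b \<and> mem w x (e 0))))))"
    by (intro definable_intros)
  show "(\<exists>u. mem w' u (e 1) \<and> (\<exists>a. mem w' a u \<and> (\<exists>u'. mem w' u' (e 1) \<and> (\<exists>b. mem w' b u' \<and>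
      opair w' (e 1) a b \<and> incl w' a (e 0) \<and> (\<exists>x. mem w' x b \<and> mem w' x (e 0)))))) \<longleftrightarrow> applied w' (e 0) (e 1)" for w' e
    unfolding applied_def using opair_components[of w' "e 1"] mem_obj(1) by meson
qed

lemma applies_incl: "incl w D D' \<Longrightarrow> applies w D \<rho> \<Longrightarrow> applies w D' \<rho>"
  unfolding applies_def using incl_trans by blast

lemma applied_incl: "incl w D D' \<Longrightarrow> applied w D \<rho> \<Longrightarrow> applied w D' \<rho>"
  unfolding applied_def using incl_trans incl_mem by blast

lemma applied_imp_applies: "applied w D \<rho> \<Longrightarrow> applies w D \<rho>"
  unfolding applies_def applied_def by blast

lemma finrulesD:
  assumes "finrules w S R" "w \<le> w'" "rl w' R a b" "a \<in> obj w'" "b \<in> obj w'" and S: "S \<in> obj w"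
  shows "finen w' a" "incl w' a S"
proof -
  obtain p where p: "opair w' p a b" "mem w' p R" using assms(3) unfolding rl_def by blast
  then obtain a' b' where a': "a' \<in> obj w'" "b' \<in> obj w'" "opair w' p a' b'" "incl w' a' S" "finen w' a'"
    using assms(1,2) unfolding finrules_def by blast
  have S': "S \<in> obj w'" using S assms(2) by (rule obj_mono)
  \<comment> \<open>The given \<open>a\<close> is only equal to the finitely enumerable
    \<open>a'\<close>. Membership in the set \<open>F\<close> of finitely enumerable subsets carries
    the property across.\<close>
  obtain F where F: "F \<in> obj w'" "finsets w' F S" by (rule finsets_exists[OF S'])
  have "mem w' a' F" using F a' unfolding finsets_def by blast
  moreover have "eql w' a' a" using opair_inject[OF a'(3) p(1) a'(1,2) assms(4,5)] by blast
  ultimately have "mem w' a F" by (rule mem_eql1)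
  then show "finen w' a" "incl w' a S" using finsets_mem[OF F(2) order_refl] by blast+
qed

lemma finspace_rcomp:
  assumes "finspace w F V S" "w \<le> w'" "isrel w' r X F" "x \<in> obj w'"
  shows "mem w' u F \<Longrightarrow> rcomp w' r V x u \<longleftrightarrow> (\<exists>D. mem w' D F \<and> rl w' r x D \<and> incl w' u D)"
    "u \<in> obj w' \<Longrightarrow> rcomp w' r V x u \<Longrightarrow> mem w' u F"
proof -
  show "mem w' u F" if "u \<in> obj w'" "rcomp w' r V x u"
    using that finspaceD(3)[OF assms(1,2) _ that(1)] unfolding rcomp_def by blast
  assume u: "mem w' u F"
  have "mem w' D F" if "D \<in> obj w'" "rl w' r x D" for D using isrel_rl(2)[OF assms(3) that(2) assms(4) that(1)] .
  with finspaceD(3)[OF assms(1,2) _ mem_obj(1)[OF u]] u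
  show "rcomp w' r V x u \<longleftrightarrow> (\<exists>D. mem w' D F \<and> rl w' r x D \<and> incl w' u D)"
    unfolding rcomp_def using mem_obj(1) by blast
qed

lemma finsets_singleton:
  assumes "finsets w F S" "w \<le> w'" "mem w' x S"
  obtains u where "mem w' u F" "upair w' u x x"
proof -
  have x: "x \<in> obj w'" using assms(3) by (rule mem_obj)
  obtain u where u: "u \<in> obj w'" "upair w' u x x" by (rule upair_exists[OF x x])
  have "mem v z S" if "w' \<le> v" "mem v z u" for v z
  proof -
    have "eql v x z" using u(2) that eql_sym unfolding upair_def by blast
    then show ?thesis by (rule mem_eql1[OF mem_mono[OF assms(3) that(1)]])
  qed
  then have "incl w' u S" unfolding incl_def by blast
  with finen_upair[OF u(2,1) x x] u(1) assms(1,2) have "mem w' u F" unfolding finsets_def by blast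
  then show thesis using u(2) that by blast
qed

lemma upair_incl: "upair w u x x \<Longrightarrow> mem w x a \<Longrightarrow> incl w u a"
  unfolding incl_def upair_def
proof (intro allI impI)
  fix w' z assume *: "\<forall>w'\<ge>w. \<forall>z. mem w' z u \<longleftrightarrow> eql w' z x \<or> eql w' z x" "mem w x a" "w \<le> w'" "mem w' z u"
  then have "eql w' x z" using eql_sym by blast
  then show "mem w' z a" by (rule mem_eql1[OF mem_mono[OF *(2,3)]])
qed

text \<open>\<open>rf\<close> and \<open>rg\<close> are the arrows obtained from
  \<open>applied\<close> and \<open>applies\<close>. The equaliser is arbitrary: its points are
  accessible only through \<open>pe\<close> and the universal property.\<close>

locale rule_equaliser =
  fixes w S R F VA F' VB rf rg XE VE SE pe qe
  assumes fin: "finrules w S R" and A: "finspace w F VA S" and B: "finspace w F' VB R"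
    and S_obj: "S \<in> obj w" and F_obj: "F \<in> obj w"
    and pe_obj: "pe \<in> obj w"
    and rf: "\<And>w' D v. w \<le> w' \<Longrightarrow> D \<in> obj w' \<Longrightarrow> v \<in> obj w' \<Longrightarrow>
       rcomp w' rf VB D v \<longleftrightarrow> mem w' D F \<and> mem w' v F' \<and> (\<forall>w''\<ge>w'. \<forall>\<rho>. mem w'' \<rho> v \<longrightarrow> applied w'' D \<rho>)"
    and rg: "\<And>w' D v. w \<le> w' \<Longrightarrow> D \<in> obj w' \<Longrightarrow> v \<in> obj w' \<Longrightarrow>
       rcomp w' rg VB D v \<longleftrightarrow> mem w' D F \<and> mem w' v F' \<and> (\<forall>w''\<ge>w'. \<forall>\<rho>. mem w'' \<rho> v \<longrightarrow> applies w'' D \<rho>)"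
    and E: "iseq w F VA F VB rf rg XE VE SE pe qe"
begin

lemma cspace_E: "cspace w XE VE SE"
  using E unfolding iseq_def by blast

lemma arr_e: "arr w XE VE SE F VA F pe qe"
  using E csarrow_iff[OF cspace_E cspace_finspace[OF A]] unfolding iseq_def by blast

lemma eqz_e: "eqz w VB rf rg pe"
  using E unfolding iseq_def by blast

text \<open>The subset of \<open>S\<close> that stands for the ideal point to which
  \<open>pe\<close> maps \<open>x\<close>.\<close>

definition trace where
  "trace v x z \<longleftrightarrow> (\<exists>D. mem v D F \<and> rl v pe x D \<and> mem v z D)"

text \<open>Let \<open>(a, b)\<close> be a rule with \<open>a\<close> inside the trace. Convergence
  of \<open>pe\<close> puts all of \<open>a\<close> into a single \<open>D\<close> related to
  \<open>x\<close>, so the rule applies at \<open>D\<close>. As \<open>rf\<close> and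
  \<open>rg\<close> agree after \<open>pe\<close>, the rule is applied at some \<open>D2\<close>
  related to \<open>x\<close>, and \<open>D2\<close> meets \<open>b\<close> inside the
  trace.\<close>

lemma trace_closed:
  assumes wv: "w \<le> v" and x: "mem v x XE"
    and \<beta>: "\<And>v' z. v \<le> v' \<Longrightarrow> mem v' z \<beta> \<longleftrightarrow> mem v' z S \<and> trace v' x z"
  shows "closed v S R \<beta>"
  unfolding closed_def
proof (intro conjI allI impI ballI)
  show "incl v \<beta> S" using \<beta> unfolding incl_def by blast
  fix v1 a b v' assume v1: "v \<le> v1" "a \<in> obj v1" "b \<in> obj v1" "rl v1 R a b" and v': "v1 \<le> v'" "incl v' a \<beta>"
  have le: "v \<le> v'" "w \<le> v1" "w \<le> v'"
    using order_trans[OF v1(1) v'(1)] order_trans[OF wv v1(1)] order_trans[OF wv order_trans[OF v1(1) v'(1)]] .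
  have a: "finen v' a" "a \<in> obj v'" and b: "b \<in> obj v'" and ab: "rl v' R a b"
    using finen_mono[OF finrulesD(1)[OF fin le(2) v1(4,2,3) S_obj] v'(1)] obj_mono[OF v1(2) v'(1)] obj_mono[OF v1(3) v'(1)]
      rl_mono[OF v1(4) v'(1)] .
  have x': "mem v2 x XE" "x \<in> obj v2" if "v' \<le> v2" for v2
    using mem_mono[OF x order_trans[OF le(1) that]] mem_obj(1) by blast+
  have pe': "isrel v2 pe XE F" if "v' \<le> v2" for v2 using arrD(1)[OF arr_e order_trans[OF le(3) that]] .
  have pe_obj': "pe \<in> obj v'" and F_obj': "F \<in> obj v'" using pe_obj F_obj le(3) obj_mono by blast+
  \<comment> \<open>\<open>H\<close> will consist of the neighbourhoods of the image of
    \<open>x\<close>. By convergence they are directed, so \<open>finen_directed\<close> finds one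
    that contains all of \<open>a\<close>.\<close>
  have "definable True v' (\<lambda>w e. \<exists>D. mem w D F \<and> rl w pe x D \<and> incl w (e 0) D)"
    using pe_obj' F_obj' x'(2)[OF order_refl] by (intro definable_intros)
  note sep = separation_exists[where Q = "\<lambda>w u. \<exists>D. mem w D F \<and> rl w pe x D \<and> incl w u D", OF this F_obj']
  obtain H where H: "H \<in> obj v'"
    "\<And>v2 u. v' \<le> v2 \<Longrightarrow> mem v2 u H \<longleftrightarrow> mem v2 u F \<and> (\<exists>D. mem v2 D F \<and> rl v2 pe x D \<and> incl v2 u D)"
    by (rule sep) (rule that)
  have Hr: "mem v2 u H \<longleftrightarrow> mem v2 u F \<and> rcomp v2 pe VA x u" if "v' \<le> v2" for v2 u
    using H(2)[OF that] finspace_rcomp(1)[OF A order_trans[OF le(3) that] pe'[OF that] x'(2)[OF that]] by blast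
  have \<beta>': "mem v2 z \<beta> \<longleftrightarrow> mem v2 z S \<and> trace v2 x z" if "v' \<le> v2" for v2 z using \<beta>[OF order_trans[OF le(1) that]] .
  have F: "finsets v2 F S" if "v' \<le> v2" for v2 using finspaceD(1)[OF A order_trans[OF le(3) that]] .
  obtain D0 where D0: "D0 \<in> obj v'" "rl v' pe x D0" using arrD(4)[OF arr_e le(3) x'(1)[OF order_refl]] by blast
  have D0F: "mem v' D0 F" using isrel_rl(2)[OF pe'[OF order_refl] D0(2) x'(2)[OF order_refl] D0(1)] .
  have "definable True v' (\<lambda>w e. mem w (e 1) (e 0))" by (intro definable_intros)
  then have "\<exists>D. mem v' D H \<and> (\<forall>v2\<ge>v'. \<forall>z. mem v2 z a \<longrightarrow> mem v2 z D)"
  proof (rule finen_directed[where T = "\<lambda>w D z. mem w z D", OF a H(1)])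
    show "mem v' D0 H" using H(2)[OF order_refl] D0F D0 incl_refl by blast
    fix v2 D z assume *: "v' \<le> v2" "mem v2 D H" "mem v2 z a"
    have lev2: "w \<le> v2" using le(3) *(1) by (rule order_trans)
    have "mem v2 z \<beta>" using v'(2) *(1,3) unfolding incl_def by blast
    then obtain D1 where D1: "mem v2 D1 F" "rl v2 pe x D1" "mem v2 z D1" using \<beta>'[OF *(1)] unfolding trace_def by blast
    then have "mem v2 D1 H" using H(2)[OF *(1)] incl_refl by blast
    with *(2) have DD: "mem v2 D F" "mem v2 D1 F" "rcomp v2 pe VA x D" "rcomp v2 pe VA x D1" using Hr[OF *(1)] by blast+
    obtain c where c: "mem v2 c F" "below v2 F VA c D D1" "rcomp v2 pe VA x c"
      using arrD(5)[OF arr_e lev2 DD(1,2) x'(1)[OF *(1)] DD(3,4)] by blast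
    have "incl v2 D c" "incl v2 D1 c"
      using finspace_below(2)[OF finspace_mono[OF A lev2] c(1) mem_obj(1)[OF DD(1)] mem_obj(1)[OF DD(2)] c(2)] by blast+
    moreover have "mem v2 c H" using Hr[OF *(1)] c by blast
    ultimately show "\<exists>D'. mem v2 D' H \<and> mem v2 z D' \<and> (\<forall>v3\<ge>v2. \<forall>z. mem v3 z a \<longrightarrow> mem v3 z D \<longrightarrow> mem v3 z D')"
      using D1(3) unfolding incl_def by blast
  qed
  then obtain u where u: "mem v' u H" "incl v' a u" unfolding incl_def by blast
  then obtain D where D: "mem v' D F" "rl v' pe x D" "incl v' u D" using H(2)[OF order_refl] by blast
  have aD: "incl v' a D" using u(2) D(3) by (rule incl_trans)
  obtain \<rho> where \<rho>: "opair v' \<rho> a b" "mem v' \<rho> R" using ab unfolding rl_def by blast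
  \<comment> \<open>The singleton of the code \<open>\<rho>\<close> of the rule, taken as a
    neighbourhood in the second space, tests whether just this rule applies, respectively is
    applied.\<close>
  obtain s where s: "mem v' s F'" "upair v' s \<rho> \<rho>"
    by (rule finsets_singleton[OF finspaceD(1)[OF B le(3)] order_refl \<rho>(2)])
  have so: "s \<in> obj v'" using s(1) by (rule mem_obj)
  have s': "eql v2 \<rho>' \<rho>" if "v' \<le> v2" "mem v2 \<rho>' s" for v2 \<rho>' using s(2) that unfolding upair_def by blast
  have "applies v2 D \<rho>'" if v2: "v' \<le> v2" "mem v2 \<rho>' s" for v2 \<rho>'
  proof -
    have "applies v2 D \<rho>"
      unfolding applies_def using obj_mono[OF a(2) v2(1)] obj_mono[OF b v2(1)] opair_mono[OF \<rho>(1) v2(1)] incl_mono[OF aD v2(1)] by blast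
    then show ?thesis
      using definable_eql[OF definable_applies order_refl, of v2 "\<lambda>i. if i = 0 then D else \<rho>" "\<lambda>i. if i = 0 then D else \<rho>'"]
        eql_sym[OF s'[OF v2]] eql_refl[OF obj_mono[OF mem_obj(1)[OF D(1)] v2(1)]] by simp
  qed
  then have "rcomp v' rg VB D s" using rg[OF le(3) mem_obj(1)[OF D(1)] so] D(1) s(1) by blast
  then have "comp3 v' pe rg VB x s" unfolding comp3_iff using D mem_obj(1) by blast
  then have "comp3 v' pe rf VB x s" using eqz_e le(3) x'(2)[OF order_refl] so unfolding eqz_def by blast
  then obtain D2 where D2: "D2 \<in> obj v'" "rl v' pe x D2" "rcomp v' rf VB D2 s" unfolding comp3_iff by blast
  have "mem v' \<rho> s" using upair_mem[OF s(2)] \<rho>(2) mem_obj(1) by blast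
  then have "applied v' D2 \<rho>" and D2F: "mem v' D2 F" using rf[OF le(3) D2(1) so] D2(3) by blast+
  then obtain a' b' z where z: "a' \<in> obj v'" "b' \<in> obj v'" "opair v' \<rho> a' b'" "mem v' z b'" "mem v' z D2"
    unfolding applied_def by blast
  have "eql v' b' b" using opair_inject[OF z(3) \<rho>(1) z(1,2) a(2) b] by blast
  then have "mem v' z b" by (rule mem_eql2[OF z(4)])
  moreover have "mem v' z \<beta>"
    using \<beta>'[OF order_refl] D2F D2(2) z(5) incl_mem finsets_mem[OF F[OF order_refl] order_refl D2F] unfolding trace_def by blast
  ultimately show "\<exists>z. mem v' z b \<and> mem v' z \<beta>" by blast
qed

context
  fixes v \<alpha>
  assumes wv: "w \<le> v" and \<alpha>: "\<alpha> \<in> obj v" and cl: "closed v S R \<alpha>"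
begin

lemma \<alpha>_S: "incl v \<alpha> S"
  using cl unfolding closed_def by blast

text \<open>As \<open>\<alpha>\<close> is closed, each of the finitely many rules in
  \<open>z\<close> has a conclusion in \<open>\<alpha>\<close>. Adjoining one conclusion after
  another stays inside \<open>\<alpha>\<close> and keeps the rules already served, so
  \<open>finen_directed\<close> applies.\<close>

lemma applied_extension:
  assumes D0: "mem v' D0 F" "incl v' D0 \<alpha>" and v': "v \<le> v'" and z: "mem v' z F'"
    and ap: "\<And>v'' \<rho>. v' \<le> v'' \<Longrightarrow> mem v'' \<rho> z \<Longrightarrow> applies v'' D0 \<rho>"
  shows "\<exists>D. mem v' D F \<and> incl v' D \<alpha> \<and> (\<forall>v''\<ge>v'. \<forall>\<rho>. mem v'' \<rho> z \<longrightarrow> applied v'' D \<rho>)"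
proof -
  have le: "w \<le> v'" using wv v' by (rule order_trans)
  have o: "D0 \<in> obj v'" "\<alpha> \<in> obj v'" "F \<in> obj v'" "z \<in> obj v'"
    using mem_obj(1)[OF D0(1)] obj_mono[OF \<alpha> v'] obj_mono[OF F_obj le] mem_obj(1)[OF z] .
  have zR: "incl v' z R" "finen v' z" using finsets_mem[OF finspaceD(1)[OF B le] order_refl z] by blast+
  have "definable True v' (\<lambda>w e. incl w D0 (e 0) \<and> incl w (e 0) \<alpha>)"
    using o by (intro definable_intros)
  note sep = separation_exists[where Q = "\<lambda>w D. incl w D0 D \<and> incl w D \<alpha>", OF this o(3)]
  obtain H where H: "H \<in> obj v'" "\<And>v2 D. v' \<le> v2 \<Longrightarrow> mem v2 D H \<longleftrightarrow> mem v2 D F \<and> incl v2 D0 D \<and> incl v2 D \<alpha>"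
    by (rule sep) (rule that)
  have "\<exists>D. mem v' D H \<and> (\<forall>v''\<ge>v'. \<forall>\<rho>. mem v'' \<rho> z \<longrightarrow> applied v'' D \<rho>)"
  proof (rule finen_directed[where T = applied, OF zR(2) o(4) H(1) definable_applied])
    show "mem v' D0 H" using H(2)[OF order_refl] D0 incl_refl by blast
    fix v2 D \<rho> assume *: "v' \<le> v2" "mem v2 D H" "mem v2 \<rho> z"
    have le2: "w \<le> v2" "v \<le> v2" using order_trans[OF le *(1)] order_trans[OF v' *(1)] .
    have D: "mem v2 D F" "incl v2 D0 D" "incl v2 D \<alpha>" using H(2)[OF *(1)] *(2) by blast+
    from ap[OF *(1,3)] obtain a b where ab: "a \<in> obj v2" "b \<in> obj v2" "opair v2 \<rho> a b" "incl v2 a D0"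
      unfolding applies_def by blast
    have "mem v2 \<rho> R" using zR(1) *(1,3) unfolding incl_def by blast
    with ab(3) have "rl v2 R a b" unfolding rl_def by blast
    moreover have aD: "incl v2 a D" using ab(4) D(2) by (rule incl_trans)
    moreover have "incl v2 a \<alpha>" using aD D(3) by (rule incl_trans)
    ultimately obtain x where x: "mem v2 x b" "mem v2 x \<alpha>"
      using cl le2(2) ab(1,2) unfolding closed_def by blast
    have xS: "mem v2 x S" using incl_mem[OF incl_mono[OF \<alpha>_S le2(2)] x(2)] .
    obtain D' where D': "mem v2 D' F" "adjoin v2 D' D x"
      by (rule finsets_adjoin[OF finspaceD(1)[OF A le2(1)] D(1) xS])
    have m: "mem v3 y D' \<longleftrightarrow> mem v3 y D \<or> eql v3 y x" if "v2 \<le> v3" for v3 y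
      using D'(2) that unfolding adjoin_def by blast
    have DD': "incl v2 D D'" using m unfolding incl_def by blast
    have "incl v2 D' \<alpha>"
      unfolding incl_def
    proof (intro allI impI)
      fix v3 y assume y: "v2 \<le> v3" "mem v3 y D'"
      from m[OF y(1)] y(2) consider "mem v3 y D" | "eql v3 y x" by blast
      then show "mem v3 y \<alpha>"
      proof cases
        case 1
        then show ?thesis using incl_mem[OF incl_mono[OF D(3) y(1)]] by blast
      next
        case 2
        then show ?thesis using mem_eql1[OF mem_mono[OF x(2) y(1)] eql_sym] by blast
      qed
    qed
    then have D'H: "mem v2 D' H" using H(2)[OF *(1)] D'(1) incl_trans[OF D(2) DD'] by blast
    have "mem v2 x D'" using m[OF order_refl] eql_refl[OF mem_obj(1)[OF x(1)]] by blast
    then have "applied v2 D' \<rho>"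
      unfolding applied_def using ab(1-3) incl_trans[OF aD DD'] x(1) by blast
    with D'H show "\<exists>D'. mem v2 D' H \<and> applied v2 D' \<rho> \<and> (\<forall>v3\<ge>v2. \<forall>\<rho>. mem v3 \<rho> z \<longrightarrow> applied v3 D \<rho> \<longrightarrow> applied v3 D' \<rho>)"
      using applied_incl incl_mono[OF DD'] by blast
  qed
  then show ?thesis using H(2)[OF order_refl] by blast
qed

text \<open>The closed set \<open>\<alpha>\<close> is an equalising map from the one-point space \<open>{z0}\<close>. As it factors through the
  equaliser, it is the union of the traces of those points of \<open>XE\<close> that are related to \<open>z0\<close>.\<close>

lemma trace_generates:
  assumes z0: "mem v z0 \<alpha>"
  shows "\<exists>y. mem v y XE \<and> trace v y z0 \<and> (\<forall>v'\<ge>v. \<forall>z. trace v' y z \<longrightarrow> mem v' z \<alpha>)"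
proof -
  have z0o: "z0 \<in> obj v" using z0 by (rule mem_obj)
  obtain X where X: "X \<in> obj v" "upair v X z0 z0" by (rule upair_exists[OF z0o z0o])
  have X': "mem v' x X \<longleftrightarrow> eql v' x z0" if "v \<le> v'" for v' x using X(2) that unfolding upair_def by blast
  have "definable True v (\<lambda>w e. eql w (e 0) (e 1))" by (intro definable_intros)
  note rel = relation_exists[where Q = eql, OF this X(1,1)]
  obtain V where V: "V \<in> obj v" "isrel v V X X"
    "\<And>v' x a. v \<le> v' \<Longrightarrow> x \<in> obj v' \<Longrightarrow> a \<in> obj v' \<Longrightarrow> rl v' V x a \<longleftrightarrow> mem v' x X \<and> mem v' a X \<and> eql v' x a"
    by (rule rel) (rule that)
  have V': "rl v' V x a" if "v \<le> v'" "mem v' x X" "mem v' a X" for v' x a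
  proof -
    have "eql v' x a" using X'[OF that(1)] that(2,3) eql_trans eql_sym by blast
    then show ?thesis using V(3)[OF that(1) mem_obj(1)[OF that(2)] mem_obj(1)[OF that(3)]] that by blast
  qed
  have C: "cspace v X V X"
    unfolding cspace_def
  proof (intro conjI allI impI)
    show "isrel v V X X" by (rule V(2))
    show "\<exists>a. mem v' a X \<and> rl v' V x a" if "v \<le> v'" "mem v' x X" for v' x
      using V'[OF that that(2)] that(2) by blast
    fix v' a b x assume *: "v \<le> v'" "mem v' a X" "mem v' b X" "mem v' x X"
    have "below v' X V a a b"
      unfolding below_def using V'[OF order_trans[OF *(1)]] mem_mono[OF *(2)] mem_mono[OF *(3)] by blast
    then show "\<exists>c. mem v' c X \<and> rl v' V x c \<and> below v' X V c a b" using V'[OF *(1,4,2)] *(2) by blast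
  qed
  have F_obj': "F \<in> obj v" using F_obj wv by (rule obj_mono)
  \<comment> \<open>\<open>t\<close> relates the single point to all finitely enumerable subsets of
    \<open>\<alpha>\<close>, so that its image is \<open>\<alpha>\<close> as an ideal point.\<close>
  have "definable True v (\<lambda>w e. incl w (e 1) \<alpha>)" using \<alpha> by (intro definable_intros)
  note rel = relation_exists[where Q = "\<lambda>w x D. incl w D \<alpha>", OF this X(1) F_obj']
  obtain t where t: "t \<in> obj v" "isrel v t X F"
    "\<And>v' x D. v \<le> v' \<Longrightarrow> x \<in> obj v' \<Longrightarrow> D \<in> obj v' \<Longrightarrow> rl v' t x D \<longleftrightarrow> mem v' x X \<and> mem v' D F \<and> incl v' D \<alpha>"
    by (rule rel) (rule that)
  have tA: "rcomp v' t VA x u \<longleftrightarrow> mem v' x X \<and> mem v' u F \<and> incl v' u \<alpha>"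
    if *: "v \<le> v'" "x \<in> obj v'" "u \<in> obj v'" for v' x u
  proof
    have le: "w \<le> v'" using wv *(1) by (rule order_trans)
    assume r: "rcomp v' t VA x u"
    then have u: "mem v' u F" using finspace_rcomp(2)[OF A le isrel_mono[OF t(2) *(1)] *(2,3)] by blast
    then obtain D where "mem v' D F" "rl v' t x D" "incl v' u D"
      using finspace_rcomp(1)[OF A le isrel_mono[OF t(2) *(1)] *(2) u] r by blast
    then show "mem v' x X \<and> mem v' u F \<and> incl v' u \<alpha>"
      using t(3)[OF *(1,2) mem_obj(1)] u incl_trans by blast
  next
    have le: "w \<le> v'" using wv *(1) by (rule order_trans)
    assume u: "mem v' x X \<and> mem v' u F \<and> incl v' u \<alpha>"
    then have "rl v' t x u" using t(3)[OF *] by blast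
    then show "rcomp v' t VA x u" unfolding rcomp_def using finspace_self[OF A le] u *(3) by blast
  qed
  have Vt: "rcomp v' V t x u \<longleftrightarrow> mem v' x X \<and> mem v' u F \<and> incl v' u \<alpha>"
    if *: "v \<le> v'" "x \<in> obj v'" "u \<in> obj v'" for v' x u
  proof
    assume "rcomp v' V t x u"
    then obtain a where "a \<in> obj v'" "rl v' V x a" "rl v' t a u" unfolding rcomp_def by blast
    then show "mem v' x X \<and> mem v' u F \<and> incl v' u \<alpha>" using V(3)[OF *(1,2)] t(3)[OF *(1) _ *(3)] by blast
  next
    assume u: "mem v' x X \<and> mem v' u F \<and> incl v' u \<alpha>"
    then have "rl v' t x u" using t(3)[OF *] by blast
    then show "rcomp v' V t x u" unfolding rcomp_def using V'[OF *(1)] u *(2) by blast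
  qed
  have h: "arr v X V X F VA F t t"
    unfolding arr_def
  proof (intro conjI allI impI ballI)
    show "isrel v t X F" "isrel v t X F" by (rule t(2))+
    show "rcomp v' t VA x u \<longleftrightarrow> rcomp v' V t x u" if "v \<le> v'" "x \<in> obj v'" "u \<in> obj v'" for v' x u
      using tA[OF that] Vt[OF that] by blast
    show "\<exists>D\<in>obj v'. rl v' t x D" if *: "v \<le> v'" "mem v' x X" for v' x
    proof -
      have le: "w \<le> v'" using wv *(1) by (rule order_trans)
      obtain D where D: "mem v' D F" "empt v' D"
        by (rule finsets_empty[OF finspaceD(1)[OF A le] obj_mono[OF S_obj le]])
      have Do: "D \<in> obj v'" using D(1) by (rule mem_obj)
      then have "rl v' t x D"
        using t(3)[OF *(1) mem_obj(1)[OF *(2)]] *(2) D(1) empt_incl[OF D(2) obj_mono[OF \<alpha> *(1)]] by blast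
      with Do show ?thesis by blast
    qed
    fix v' a b x assume *: "v \<le> v'" "mem v' a F" "mem v' b F" "mem v' x X" "rcomp v' t VA x a" "rcomp v' t VA x b"
    have le: "w \<le> v'" using wv *(1) by (rule order_trans)
    have o: "x \<in> obj v'" "a \<in> obj v'" "b \<in> obj v'" using *(2-4) mem_obj(1) by blast+
    have ab: "incl v' a \<alpha>" "incl v' b \<alpha>" using tA[OF *(1) o(1,2)] tA[OF *(1) o(1,3)] *(5,6) by blast+
    have "finen v' b" using finsets_mem[OF finspaceD(1)[OF A le] order_refl *(3)] by blast
    from finsets_directed[OF finspaceD(1)[OF A le] obj_mono[OF F_obj le] o(3) this ab(2) obj_mono[OF \<alpha> *(1)]
        incl_mono[OF \<alpha>_S *(1)] *(2) ab(1)]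
    obtain c where c: "mem v' c F" "incl v' a c" "incl v' b c" "incl v' c \<alpha>" by blast
    have "below v' F VA c a b" using finspace_below(1)[OF finspace_mono[OF A le] c(1) *(2,3) c(2,3)] .
    moreover have "rcomp v' t VA x c" using tA[OF *(1) o(1) mem_obj(1)[OF c(1)]] c *(4) by blast
    ultimately show "\<exists>c. mem v' c F \<and> below v' F VA c a b \<and> rcomp v' t VA x c" using c(1) by blast
  qed
  \<comment> \<open>One inclusion holds since \<open>applied\<close> implies \<open>applies\<close>.
    The other is where closedness of \<open>\<alpha>\<close> enters, through
    \<open>applied_extension\<close>.\<close>
  have heq: "eqz v VB rf rg t"
    unfolding eqz_def comp3_iff
  proof (intro allI impI ballI)
    fix v' x z assume *: "v \<le> v'" "x \<in> obj v'" "z \<in> obj v'"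
    have le: "w \<le> v'" using wv *(1) by (rule order_trans)
    show "(\<exists>D\<in>obj v'. rl v' t x D \<and> rcomp v' rf VB D z) \<longleftrightarrow> (\<exists>D\<in>obj v'. rl v' t x D \<and> rcomp v' rg VB D z)"
    proof
      assume "\<exists>D\<in>obj v'. rl v' t x D \<and> rcomp v' rf VB D z"
      then obtain D where D: "D \<in> obj v'" "rl v' t x D" "rcomp v' rf VB D z" by blast
      then have "rcomp v' rg VB D z" using rf[OF le D(1) *(3)] rg[OF le D(1) *(3)] applied_imp_applies by blast
      with D show "\<exists>D\<in>obj v'. rl v' t x D \<and> rcomp v' rg VB D z" by blast
    next
      assume "\<exists>D\<in>obj v'. rl v' t x D \<and> rcomp v' rg VB D z"
      then obtain D0 where D0: "D0 \<in> obj v'" "rl v' t x D0" "rcomp v' rg VB D0 z" by blast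
      have 1: "mem v' D0 F" "incl v' D0 \<alpha>" "mem v' x X" using t(3)[OF *(1,2) D0(1)] D0(2) by blast+
      have 2: "mem v' z F'" "\<And>v'' \<rho>. v' \<le> v'' \<Longrightarrow> mem v'' \<rho> z \<Longrightarrow> applies v'' D0 \<rho>"
        using rg[OF le D0(1) *(3)] D0(3) by blast+
      obtain D where D: "mem v' D F" "incl v' D \<alpha>" "\<forall>v''\<ge>v'. \<forall>\<rho>. mem v'' \<rho> z \<longrightarrow> applied v'' D \<rho>"
        using applied_extension[OF 1(1,2) *(1) 2] by blast
      have Do: "D \<in> obj v'" using D(1) by (rule mem_obj)
      have "rl v' t x D" using t(3)[OF *(1,2) Do] D(1,2) 1(3) by blast
      moreover have "rcomp v' rf VB D z" using rf[OF le Do *(3)] D 2(1) by blast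
      ultimately show "\<exists>D\<in>obj v'. rl v' t x D \<and> rcomp v' rf VB D z" using Do by blast
    qed
  qed
  have "csarrow v X V X F VA F t t" using csarrow_iff[OF C cspace_finspace[OF finspace_mono[OF A wv]]] h by blast
  with E[unfolded iseq_def, THEN conjunct2, THEN conjunct2, THEN conjunct2, rule_format, OF wv X(1) V(1) X(1) C order_refl t(1,1)] heq
  obtain m n where m: "m \<in> obj v" "csarrow v X V X XE VE SE m n"
    "\<forall>v'\<ge>v. \<forall>x\<in>obj v'. \<forall>z\<in>obj v'. comp3 v' m pe VA x z \<longleftrightarrow> rcomp v' t VA x z" by blast
  have arr_m: "arr v X V X XE VE SE m n" using csarrow_iff[OF C cspace_mono[OF cspace_E wv]] m(2) by blast
  have "mem v z0 S" using incl_mem[OF \<alpha>_S z0] .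
  \<comment> \<open>The singleton of \<open>z0\<close> is a neighbourhood of the image of the point.
    Followed through the mediating arrow, it yields a point \<open>y\<close> of \<open>XE\<close>
    whose trace contains \<open>z0\<close>.\<close>
  then obtain s where s: "mem v s F" "upair v s z0 z0"
    by (rule finsets_singleton[OF finspaceD(1)[OF A wv] order_refl])
  have so: "s \<in> obj v" using s(1) by (rule mem_obj)
  have z0X: "mem v z0 X" using X'[OF order_refl] eql_refl[OF z0o] by blast
  have "rcomp v t VA z0 s" using tA[OF order_refl z0o so] z0X s(1) upair_incl[OF s(2) z0] by blast
  then have "comp3 v m pe VA z0 s" using m(3) z0o so by blast
  then obtain y where y: "y \<in> obj v" "rl v m z0 y" "rcomp v pe VA y s" unfolding comp3_iff by blast
  have yX: "mem v y XE" using arrD(6)[OF arr_m order_refl y(2) z0o y(1)] by blast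
  obtain D where D: "mem v D F" "rl v pe y D" "incl v s D"
    using finspace_rcomp(1)[OF A wv arrD(1)[OF arr_e wv] y(1) s(1)] y(3) by blast
  have "mem v z0 D" using upair_mem[OF s(2) z0o z0o] incl_mem[OF D(3)] by blast
  then have "trace v y z0" unfolding trace_def using D by blast
  \<comment> \<open>By the same factorization, any \<open>D\<close> related to \<open>y\<close> is a
    neighbourhood of the image under \<open>t\<close>, hence included in
    \<open>\<alpha>\<close>.\<close>
  moreover have "mem v' z \<alpha>" if v': "v \<le> v'" "trace v' y z" for v' z
  proof -
    have le: "w \<le> v'" using wv v'(1) by (rule order_trans)
    obtain D where D: "mem v' D F" "rl v' pe y D" "mem v' z D" using v'(2) unfolding trace_def by blast
    have Do: "D \<in> obj v'" using D(1) by (rule mem_obj)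
    have yo: "y \<in> obj v'" and zo: "z0 \<in> obj v'" using y(1) z0o v'(1) obj_mono by blast+
    have "rcomp v' pe VA y D" unfolding rcomp_def using D(2) Do finspace_self[OF A le D(1)] by blast
    then have "comp3 v' m pe VA z0 D" unfolding comp3_iff using rl_mono[OF y(2) v'(1)] yo by blast
    then have "rcomp v' t VA z0 D" using m(3) v'(1) zo Do by blast
    then have "incl v' D \<alpha>" using tA[OF v'(1) zo Do] by blast
    then show ?thesis using D(3) by (rule incl_mem)
  qed
  ultimately show ?thesis using yX by blast
qed

end

end

text \<open>The traces of the points of an equaliser form a set, since its points do. They are
  closed by \<open>trace_closed\<close>, and \<open>trace_generates\<close> finds one around any
  element of a closed set and inside that set.\<close>

lemma equalisers_imp_generates:
  assumes eq: "sat w j CSpa_has_equalisers" and S: "S \<in> obj w" and R: "R \<in> obj w" and fin: "finrules w S R"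
  shows "\<exists>G\<in>obj w. generates w S R G"
proof -
  obtain F VA where F: "F \<in> obj w" "VA \<in> obj w" "finspace w F VA S" by (rule finspace_exists[OF S])
  obtain F' VB where F': "F' \<in> obj w" "VB \<in> obj w" "finspace w F' VB R" by (rule finspace_exists[OF R])
  note arrow = finspace_arrow_exists[OF F(3) F'(3) F(1) F'(1) R]
  obtain rf where rf: "rf \<in> obj w" "arr w F VA F F' VB F' rf rf"
    "\<And>w' D v. w \<le> w' \<Longrightarrow> D \<in> obj w' \<Longrightarrow> v \<in> obj w' \<Longrightarrow>
       rcomp w' rf VB D v \<longleftrightarrow> mem w' D F \<and> mem w' v F' \<and> (\<forall>w''\<ge>w'. \<forall>\<rho>. mem w'' \<rho> v \<longrightarrow> applied w'' D \<rho>)"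
    by (rule arrow[where P = applied, OF definable_applied applied_incl]) (assumption, assumption, rule that)
  obtain rg where rg: "rg \<in> obj w" "arr w F VA F F' VB F' rg rg"
    "\<And>w' D v. w \<le> w' \<Longrightarrow> D \<in> obj w' \<Longrightarrow> v \<in> obj w' \<Longrightarrow>
       rcomp w' rg VB D v \<longleftrightarrow> mem w' D F \<and> mem w' v F' \<and> (\<forall>w''\<ge>w'. \<forall>\<rho>. mem w'' \<rho> v \<longrightarrow> applies w'' D \<rho>)"
    by (rule arrow[where P = applies, OF definable_applies applies_incl]) (assumption, assumption, rule that)
  have cs: "cspace w F VA F" "cspace w F' VB F'" using cspace_finspace F(3) F'(3) by blast+
  have "csarrow w F VA F F' VB F' rf rf" "csarrow w F VA F F' VB F' rg rg" using csarrow_iff[OF cs] rf(2) rg(2) by blast+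
  with eq[unfolded sat_CSpa_has_equalisers, rule_format, OF order_refl F(1,2,1) F'(1,2,1) conjI[OF cs] order_refl rf(1,1) rg(1,1)]
  obtain XE VE SE pe qe where E: "XE \<in> obj w" "pe \<in> obj w" "iseq w F VA F VB rf rg XE VE SE pe qe" by blast
  interpret E: rule_equaliser w S R F VA F' VB rf rg XE VE SE pe qe
    by unfold_locales (rule fin, rule F(3), rule F'(3), rule S, rule F(1), rule E(2),
      rule rf(3), assumption+, rule rg(3), assumption+, rule E(3))
  have "definable True w (\<lambda>w e. E.trace w (e 0) (e 1))"
    unfolding E.trace_def using F(1) E(2) by (intro definable_intros)
  note fam = subset_family_exists[where Q = E.trace, OF this E(1) S]
  obtain G where G: "G \<in> obj w"
    "\<And>w' i. w \<le> w' \<Longrightarrow> mem w' i XE \<Longrightarrow>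
       \<exists>y. mem w' y G \<and> (\<forall>w''\<ge>w'. \<forall>z. mem w'' z y \<longleftrightarrow> mem w'' z S \<and> E.trace w'' i z)"
    "\<And>w' y. w \<le> w' \<Longrightarrow> mem w' y G \<Longrightarrow>
       \<exists>i. mem w' i XE \<and> (\<forall>w''\<ge>w'. \<forall>z. mem w'' z y \<longleftrightarrow> mem w'' z S \<and> E.trace w'' i z)"
    by (rule fam) (rule that)
  have "closed w' S R \<beta>" if *: "w \<le> w'" "mem w' \<beta> G" for w' \<beta>
    using G(3)[OF *] E.trace_closed[OF *(1)] by blast
  moreover have "\<exists>\<beta>. mem v \<beta> G \<and> mem v x \<beta> \<and> incl v \<beta> \<alpha>"
    if *: "w \<le> w'" "\<alpha> \<in> obj w'" "closed w' S R \<alpha>" "w' \<le> v" "mem v x \<alpha>" for w' \<alpha> v x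
  proof -
    have wv: "w \<le> v" using *(1,4) by (rule order_trans)
    have cl: "closed v S R \<alpha>"
      using *(3) incl_mono[OF _ *(4)] order_trans[OF *(4)] unfolding closed_def by blast
    obtain y where y: "mem v y XE" "E.trace v y x" "\<forall>v'\<ge>v. \<forall>z. E.trace v' y z \<longrightarrow> mem v' z \<alpha>"
      using E.trace_generates[OF wv obj_mono[OF *(2,4)] cl *(5)] by blast
    obtain \<beta> where \<beta>: "mem v \<beta> G" "\<forall>v'\<ge>v. \<forall>z. mem v' z \<beta> \<longleftrightarrow> mem v' z S \<and> E.trace v' y z"
      using G(2)[OF wv y(1)] by blast
    have "mem v x S" using cl *(5) incl_mem unfolding closed_def by blast
    then have "mem v x \<beta>" using \<beta>(2) y(2) by blast
    moreover have "incl v \<beta> \<alpha>" unfolding incl_def using \<beta>(2) y(3) by blast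
    ultimately show ?thesis using \<beta>(1) by blast
  qed
  ultimately have "generates w S R G" unfolding generates_def by blast
  with G(1) show ?thesis by blast
qed

theorem proposition33:
  shows "ECST \<union> {FPA} \<turnstile> Iff NID_fin CSpa_has_equalisers"
proof (rule completeness)
  fix w
  have "sat v id CSpa_has_equalisers" if NID: "sat v id NID_fin" for v
    unfolding sat_CSpa_has_equalisers
  proof (intro allI impI ballI, elim conjE)
    fix w' X1 V1 S1 X2 V2 S2 w'' r s r' s'
    assume w': "v \<le> w'" and o: "X1 \<in> obj w'" "V1 \<in> obj w'" "S1 \<in> obj w'" "X2 \<in> obj w'" "V2 \<in> obj w'" "S2 \<in> obj w'"
      and cs: "cspace w' X1 V1 S1" "cspace w' X2 V2 S2" and w'': "w' \<le> w''"
      and rs: "r \<in> obj w''" "s \<in> obj w''" "r' \<in> obj w''" "s' \<in> obj w''"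
      and a: "csarrow w'' X1 V1 S1 X2 V2 S2 r s" "csarrow w'' X1 V1 S1 X2 V2 S2 r' s'"
    have cs': "cspace w'' X1 V1 S1" "cspace w'' X2 V2 S2" using cs w'' cspace_mono by blast+
    have arrs: "arr w'' X1 V1 S1 X2 V2 S2 r s" "arr w'' X1 V1 S1 X2 V2 S2 r' s'"
      using a csarrow_iff[OF cs'] by blast+
    \<comment> \<open>\<open>NID_fin\<close> is forced at \<open>v\<close> and persists to the later
      world at which the arrows appear.\<close>
    have "sat w'' id NID_fin" using NID order_trans[OF w' w''] by (rule sat_mono)
    from NID_imp_equaliser[OF this cs' arrs obj_mono[OF o(1) w''] obj_mono[OF o(2) w''] obj_mono[OF o(3) w'']
        obj_mono[OF o(4) w''] obj_mono[OF o(5) w''] obj_mono[OF o(6) w''] rs(1,3)]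
    show "\<exists>XE\<in>obj w''. \<exists>VE\<in>obj w''. \<exists>SE\<in>obj w''. \<exists>p\<in>obj w''. \<exists>q\<in>obj w''. iseq w'' X1 V1 S1 V2 r r' XE VE SE p q" .
  qed
  moreover have "sat v id NID_fin" if eq: "sat v id CSpa_has_equalisers" for v
    unfolding sat_NID_fin using equalisers_imp_generates[OF sat_mono[OF eq]] by blast
  ultimately show "sat w id (Iff NID_fin CSpa_has_equalisers)" by simp
qed

end
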